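(* Let $p>1$ be a real number, $\mu$ a partition, $\alpha\in[-1,1]$ and $k$ a positive integer. Then $$M_{p,\mu}\big(P^{\mathrm{M},(k)}_{p,\alpha}\big)=M_{p,\mu}\big(P^{\mathrm{Sym},(k)}_{p}\big)=p^{\,n(\mu)+k\,l(\mu)}.$$
   Context: Partitions: a partition $\lambda=(\lambda_1,\lambda_2,\dots)$ is a weakly decreasing sequence of nonnegative integers with finite sum $|\lambda|$; $l(\lambda)=\lambda'_1$ is its number of positive parts; $\lambda'$ is the conjugate partition ($\lambda'_i=\#\{j:\lambda_j\ge i\}$); $m_i(\lambda)=\lambda'_i-\lambda'_{i+1}$ is the number of parts equal to $i$; $n(\lambda):=\sum_{i\ge1}\binom{\lambda'_i}{2}$. Throughout $q:=1/p\in(0,1)$, $(x;q)_\infty=\prod_{i\ge1}(1-xq^{i-1})$, $(x;q)_n=\prod_{i=1}^n(1-xq^{i-1})$ for $n\ge0$. Measures on the set of partitions: $$P^{\mathrm{Sym}}_{\infty,p}(\lambda):=\frac{q^{n(\lambda)+|\lambda|}(q;q^2)_\infty}{\prod_{i\ge1}(q^2;q^2)_{\lfloor m_i(\lambda)/2\rfloor}},\qquad P^{\mathrm{Sym},(k)}_{p}(\lambda):=\frac{q^{\binom k2}}{(-1;q)_k}\,p^{k\lambda'_1}\,P^{\mathrm{Sym}}_{\infty,p}(\lambda),$$ $$P^{\mathrm{M},(k)}_{p,\alpha}(\lambda):=\frac{q^{\binom k2}}{(-1;q)_k}\big(1+(-1)^{\lambda'_1}\alpha\big)\,p^{k\lambda'_1}\,P^{\mathrm{Sym}}_{\infty,p}(\lambda).$$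 Hall–Littlewood functions: for $l(\lambda)\le n$, $$P_\lambda(x_1,\dots,x_n;q)=\frac1{v_\lambda(q)}\sum_{w\in S_n}w\Big(x_1^{\lambda_1}\cdots x_n^{\lambda_n}\prod_{i<j}\frac{x_i-qx_j}{x_i-x_j}\Big),\quad v_\lambda(q)=\frac{(q;q)_{n-l(\lambda)}}{(1-q)^{n-l(\lambda)}}\prod_{i\ge1}\frac{(q;q)_{m_i(\lambda)}}{(1-q)^{m_i(\lambda)}},$$ where $S_n$ permutes the variables, extended by stability to symmetric functions in countably many variables; $Q_\lambda=b_\lambda(q)P_\lambda$ with $b_\lambda(q)=\prod_{i\ge1}(q;q)_{m_i(\lambda)}$. Define $g^\lambda_{\mu\nu}(q)$ by $Q_\mu Q_\nu=\sum_\lambda g^\lambda_{\mu\nu}(q)Q_\lambda$ and the skew function $P_{\lambda/\mu}:=\sum_\nu g^\lambda_{\mu\nu}(q)P_\nu$ (zero unless $\mu_i\le\lambda_i$ for all $i$). For real $p>1$ put $$|\mathrm{Sur}_p(\lambda,\mu)|:=\frac{P_{\lambda/\mu}(q,q^2,\dots;q)}{P_\lambda(q,q^2,\dots;q)\,Q_\mu(1,q,q^2,\dots;q)};$$ when $p$ is prime this is the number of surjective homomorphisms $\bigoplus_i\mathbb Z/p^{\lambda_i}\mathbb{Z}\to\bigoplus_i\mathbb Z/p^{\mu_i}\mathbb{Z}$. The $\mu$-moment of a measure $\nu$ on partitions is $M_{p,\mu}(\nu):=\sum_\lambda\nu(\lambda)\,|\mathrm{Sur}_p(\lambda,\mu)|$.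 *)

theory Defs
  imports "HOL-Analysis.Analysis" "HOL-Combinatorics.Permutations"
begin

text \<open>Sequences are indexed from 0 here: \<open>part lam j\<close> is $\lambda_{j+1}$.\<close>

typedef partition = "{f :: nat \<Rightarrow> nat. antimono f \<and> finite {j. f j \<noteq> 0}}"
  morphisms part Abs_partition
  by (rule exI[of _ "\<lambda>_. 0"]) (auto simp: monotone_def)

definition psize :: "partition \<Rightarrow> nat" where
  "psize lam = (\<Sum>j | part lam j \<noteq> 0. part lam j)"

text \<open>The number $\lambda'_i$; only meaningful for \<open>i \<ge> 1\<close>.\<close>

definition conj_part :: "partition \<Rightarrow> nat \<Rightarrow> nat" where
  "conj_part lam i = card {j. part lam j \<ge> i}"

definition plength :: "partition \<Rightarrow> nat" where
  "plength lam = conj_part lam 1"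

definition pmult :: "partition \<Rightarrow> nat \<Rightarrow> nat" where
  "pmult lam i = conj_part lam i - conj_part lam (i + 1)"

text \<open>
  Here and below, sums and products over all \<open>i \<ge> 1\<close> are cut off at the largest part
  \<open>part lam 0\<close>, since beyond it $\lambda'_i = m_i(\lambda) = 0$ and the terms are trivial.
\<close>

definition pstat :: "partition \<Rightarrow> nat" where
  "pstat lam = (\<Sum>i=1..part lam 0. conj_part lam i choose 2)"

definition qpoch :: "real \<Rightarrow> real \<Rightarrow> nat \<Rightarrow> real" where
  "qpoch x q n = (\<Prod>i<n. 1 - x * q ^ i)"

definition qpoch_inf :: "real \<Rightarrow> real \<Rightarrow> real" where
  "qpoch_inf x q = prodinf (\<lambda>i. 1 - x * q ^ i)"

definition PSym_inf :: "real \<Rightarrow> partition \<Rightarrow> real" where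
  "PSym_inf p lam = (let q = 1 / p in
     q ^ (pstat lam + psize lam) * qpoch_inf q (q ^ 2) /
     (\<Prod>i=1..part lam 0. qpoch (q ^ 2) (q ^ 2) (pmult lam i div 2)))"

definition PSym :: "real \<Rightarrow> nat \<Rightarrow> partition \<Rightarrow> real" where
  "PSym p k lam = (let q = 1 / p in
     q ^ (k choose 2) / qpoch (-1) q k * p ^ (k * conj_part lam 1) * PSym_inf p lam)"

definition PM :: "real \<Rightarrow> real \<Rightarrow> nat \<Rightarrow> partition \<Rightarrow> real" where
  "PM p \<alpha> k lam = (let q = 1 / p in
     q ^ (k choose 2) / qpoch (-1) q k * (1 + (-1) ^ conj_part lam 1 * \<alpha>) *
     p ^ (k * conj_part lam 1) * PSym_inf p lam)"

text \<open>
  A symmetric function in countably many variables is represented by its compatible family of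
  restrictions to finitely many variables: \<open>F n x\<close> is the value of \<open>F\<close> at
  \<open>x 0, \<dots>, x (n - 1)\<close>, all later variables being set to zero.  As the Hall--Littlewood
  polynomials are written as sums of rational functions with denominators $x_i - x_j$, the value
  \<open>F n x\<close> is significant only at points with pairwise distinct coordinates, that is if
  \<open>inj_on x {..<n}\<close>; over the reals such points determine a polynomial.
\<close>

type_synonym symfun = "nat \<Rightarrow> (nat \<Rightarrow> real) \<Rightarrow> real"

definition hl_v :: "nat \<Rightarrow> partition \<Rightarrow> real \<Rightarrow> real" where
  "hl_v n lam q =
     qpoch q q (n - plength lam) / (1 - q) ^ (n - plength lam) *
     (\<Prod>i=1..part lam 0. qpoch q q (pmult lam i) / (1 - q) ^ pmult lam i)"

text \<open>By stability, $P_\lambda$ restricts to zero in fewer than $l(\lambda)$ variables.\<close>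

definition hl_P :: "real \<Rightarrow> partition \<Rightarrow> symfun" where
  "hl_P q lam n x =
     (if plength lam \<le> n then
        1 / hl_v n lam q *
        (\<Sum>w | w permutes {..<n}.
           (\<Prod>i<n. x (w i) ^ part lam i) *
           (\<Prod>j<n. \<Prod>i<j. (x (w i) - q * x (w j)) / (x (w i) - x (w j))))
      else 0)"

definition hl_b :: "real \<Rightarrow> partition \<Rightarrow> real" where
  "hl_b q lam = (\<Prod>i=1..part lam 0. qpoch q q (pmult lam i))"

definition hl_Q :: "real \<Rightarrow> partition \<Rightarrow> symfun" where
  "hl_Q q lam n x = hl_b q lam * hl_P q lam n x"

text \<open>
  \<open>hl_g q mu nu lam\<close> is $g^\lambda_{\mu\nu}(q)$: the coefficient of $Q_\lambda$ in the finite
  expansion of $Q_\mu Q_\nu$ in the basis of all $Q_\lambda$.  An identity of symmetric functions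
  is an identity in every finite number of variables.
\<close>

definition hl_g :: "real \<Rightarrow> partition \<Rightarrow> partition \<Rightarrow> partition \<Rightarrow> real" where
  "hl_g q mu nu = (THE c. finite {lam. c lam \<noteq> 0} \<and>
     (\<forall>n x. inj_on x {..<n} \<longrightarrow>
        hl_Q q mu n x * hl_Q q nu n x = (\<Sum>lam | c lam \<noteq> 0. c lam * hl_Q q lam n x)))"

text \<open>
  The index set of the sum is finite, because $g^\lambda_{\mu\nu}$ vanishes
  unless $|\lambda| = |\mu| + |\nu|$.
\<close>

definition hl_skewP :: "real \<Rightarrow> partition \<Rightarrow> partition \<Rightarrow> symfun" where
  "hl_skewP q lam mu n x =
     (\<Sum>nu | hl_g q mu nu lam \<noteq> 0. hl_g q mu nu lam * hl_P q nu n x)"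

text \<open>The value of a symmetric function at an infinite sequence of distinct reals.\<close>

definition specialize :: "symfun \<Rightarrow> (nat \<Rightarrow> real) \<Rightarrow> real" where
  "specialize F x = lim (\<lambda>n. F n x)"

definition sur :: "real \<Rightarrow> partition \<Rightarrow> partition \<Rightarrow> real" where
  "sur p lam mu = (let q = 1 / p in
     specialize (hl_skewP q lam mu) (\<lambda>i. q ^ (i + 1)) /
     (specialize (hl_P q lam) (\<lambda>i. q ^ (i + 1)) * specialize (hl_Q q mu) (\<lambda>i. q ^ i)))"

text \<open>
  A non-summable family has \<open>infsum\<close> equal to 0, so stating that a moment equals
  a positive number includes its convergence.
\<close>

definition moment :: "real \<Rightarrow> partition \<Rightarrow> (partition \<Rightarrow> real) \<Rightarrow> real" where
  "moment p mu \<nu> = (\<Sum>\<^sub>\<infinity>lam. \<nu> lam * sur p lam mu)"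

end

theory Submission
  imports Defs
begin

text \<open>
  Applying an elementary symmetric function to the symmetrisation that defines \<open>P\<^sub>\<mu>\<close> and sorting
  exponents by the relation \<open>R(\<dots>, a, a + 1, \<dots>) = q R(\<dots>, a + 1, a, \<dots>)\<close> gives the Pieri rule for
  \<open>e\<^sub>r P\<^sub>\<mu>\<close>. Its matrix is inverted by the finite \<open>q\<close>-binomial theorem, which gives the Pieri rule for
  \<open>h\<^sub>r P\<^sub>\<mu>\<close>. As \<open>Q\<^sub>\<nu>(q, q\<^sup>2, \<dots>) = q\<^bsup>|\<nu>| + n(\<nu>)\<^esup>\<close>, the value \<open>P\<^bsub>\<lambda>/\<mu>\<^esub>(q, q\<^sup>2, \<dots>)\<close> is, up to
  normalisation, a coefficient of that rule, and the number of surjections becomes a product over the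
  columns of \<open>\<lambda>\<close> and \<open>\<mu>\<close>.

  The moment can then be summed one column at a time. Every column after the first is absorbed by
  \<open>\<Sum>\<^sub>d q\<^bsup>d(d + 1)/2\<^esup> / ((q;q)\<^sub>d (q\<^sup>2;q\<^sup>2)\<^bsub>\<lfloor>(N - d)/2\<rfloor>\<^esub>) = 1 / (q;q)\<^sub>N\<close>, independently of \<open>\<mu>\<close>, and the first one
  leaves \<open>\<Sum>\<^sub>d y\<^sup>d q\<^bsup>d(d + 1)/2\<^esup> / (q;q)\<^sub>d = \<Prod>\<^bsub>i \<ge> 1\<^esub> (1 + y q\<^sup>i)\<close>. At \<open>y = p\<^sup>k\<close> this cancels the
  normalising constant of the measure, and at \<open>y = -p\<^sup>k\<close>, where the \<open>\<alpha>\<close>-term leads, it vanishes.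
\<close>

section \<open>Partitions and their columns\<close>

text \<open>As \<open>hl_g\<close> is a definite description, nothing can be said about it before
  two facts are known: the \<open>P_lam\<close> are linearly independent already as functions on
  points with distinct coordinates, and a product of two of them is a finite combination whose
  coefficients do not depend on the number of variables. From then on coefficients may be compared.
  Of the structure constants only one combination enters. In \<open>P_{lam/mu}(q, q^2, ...)\<close>
  the constant for \<open>nu\<close> is weighted by \<open>q^(|nu| + n(nu)) / b_nu\<close>. Up to
  the common power \<open>q^|nu|\<close> these weights are the coefficients of \<open>h_d\<close> in
  the basis \<open>Q_nu\<close>, because \<open>h_d\<close> is the sum of
  \<open>q^n(nu) P_nu\<close> over \<open>|nu| = d\<close>; this is how a Pieri coefficient comes to
  stand for the skew function. Stripping columns from \<open>mu\<close> ends at the empty partition,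
  where the recursion for the total weight expresses that total through itself. Summability is
  therefore established there separately, by a bound on finite partial sums.\<close>

definition col :: "partition \<Rightarrow> nat \<Rightarrow> nat" where
  "col lam i = conj_part lam (Suc i)"

lemma down_closed_eq_lessThan:
  fixes A :: "nat set"
  assumes "finite A" "\<And>i j. j \<in> A \<Longrightarrow> i \<le> j \<Longrightarrow> i \<in> A"
  shows "A = {..<card A}"
proof (cases "A = {}")
  case False
  then have "A = {..Max A}"
    using assms(1) assms(2)[OF Max_in[OF assms(1)]] by (intro set_eqI iffI) auto
  then show ?thesis
    by (metis card_atMost lessThan_Suc_atMost)
qed auto

lemma antimono_part: "antimono (part lam)"
  and finite_part_support: "finite {j. part lam j \<noteq> 0}"
  using part[of lam] by auto

lemma part_antimono: "i \<le> j \<Longrightarrow> part lam j \<le> part lam i"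
  using antimono_part by (rule antimonoD)

text \<open>Both sides say that the cell in row \<open>j\<close> and column \<open>i\<close> lies in
  the diagram. This equivalence carries every passage between rows and columns.\<close>

lemma less_col_iff: "j < col lam i \<longleftrightarrow> i < part lam j"
proof -
  let ?A = "{j. Suc i \<le> part lam j}"
  have "finite ?A"
    by (rule finite_subset[OF _ finite_part_support[of lam]]) auto
  then have "?A = {..<card ?A}"
    by (rule down_closed_eq_lessThan) (use part_antimono in \<open>auto intro: le_trans\<close>)
  then have "j \<in> ?A \<longleftrightarrow> j < card ?A"
    by blast
  then show ?thesis
    unfolding col_def conj_part_def by (simp add: Suc_le_eq)
qed

lemma col_antimono: "i \<le> j \<Longrightarrow> col lam j \<le> col lam i"
proof (rule ccontr)
  assume "i \<le> j" "\<not> col lam j \<le> col lam i"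
  then have "j < part lam (col lam i)" "\<not> i < part lam (col lam i)"
    by (simp_all flip: less_col_iff)
  then show False
    using \<open>i \<le> j\<close> by simp
qed

lemma col_Suc_le: "col lam (Suc i) \<le> col lam i"
  by (rule col_antimono) simp

lemma col_eq_0_iff: "col lam i = 0 \<longleftrightarrow> part lam 0 \<le> i"
  using less_col_iff[of 0 lam i] by auto

lemma part_eq_0_iff: "part lam j = 0 \<longleftrightarrow> col lam 0 \<le> j"
  using less_col_iff[of j lam 0] by auto

lemma plength_eq_col: "plength lam = col lam 0"
  and conj_part_Suc: "conj_part lam (Suc i) = col lam i"
  by (simp_all add: plength_def col_def)

lemma pmult_Suc: "pmult lam (Suc i) = col lam i - col lam (Suc i)"
  by (simp add: pmult_def col_def)

lemma partition_eqI:
  assumes "\<And>i. col a i = col b i"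
  shows "a = b"
proof -
  have "part a j = part b j" for j
    using assms less_col_iff[of j a] less_col_iff[of j b]
    by (metis linorder_neqE_nat less_irrefl)
  then show ?thesis
    by (simp add: part_inject[symmetric] fun_eq_iff)
qed

text \<open>Row \<open>j\<close> is the number of columns longer than \<open>j\<close>; as
  \<open>c\<close> decreases, these columns form an initial segment. Every partition built later is
  given by its column lengths.\<close>

lemma ex_partition_col:
  assumes "\<And>i. c (Suc i) \<le> c i" "c N = 0"
  shows "\<exists>lam. \<forall>i. col lam i = c i"
proof -
  have anti: "i \<le> j \<Longrightarrow> c j \<le> c i" for i j
    using lift_Suc_antimono_le[of c] assms(1) by blast
  define A where "A j = {i. j < c i}" for j
  have A_sub: "A j \<subseteq> {..<N}" for j
  proof
    fix i assume "i \<in> A j"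
    then show "i \<in> {..<N}"
      using anti[of N i] assms(2) by (cases "N \<le> i") (auto simp: A_def)
  qed
  have A_eq: "A j = {..<card (A j)}" for j
    by (rule down_closed_eq_lessThan)
       (use finite_subset[OF A_sub] in \<open>auto simp: A_def intro: less_le_trans[OF _ anti]\<close>)
  let ?f = "\<lambda>j. card (A j)"
  have "antimono ?f"
    by (intro antimonoI card_mono) (use finite_subset[OF A_sub] in \<open>auto simp: A_def\<close>)
  moreover have "{j. ?f j \<noteq> 0} \<subseteq> {..<c 0}"
  proof
    fix j assume "j \<in> {j. ?f j \<noteq> 0}"
    then have "A j \<noteq> {}" by auto
    then obtain i where "j < c i" by (auto simp: A_def)
    then show "j \<in> {..<c 0}" using anti[of 0 i] by auto
  qed
  then have "finite {j. ?f j \<noteq> 0}"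
    using finite_subset by blast
  ultimately have part: "part (Abs_partition ?f) = ?f"
    by (subst Abs_partition_inverse) (simp_all del: card_eq_0_iff)
  have "j < col (Abs_partition ?f) i \<longleftrightarrow> j < c i" for i j
  proof -
    have "i < ?f j \<longleftrightarrow> i \<in> A j"
      using A_eq[of j] by blast
    then show ?thesis
      unfolding less_col_iff part by (simp add: A_def)
  qed
  then have "col (Abs_partition ?f) i = c i" for i
    by (metis linorder_neqE_nat less_irrefl)
  then show ?thesis
    by blast
qed

text \<open>Double counting of cells, a cell in row \<open>j\<close> having weight
  \<open>f j\<close>. Weight 1 gives the size, and weight \<open>j\<close> gives the two forms of
  \<open>n(lam)\<close>.\<close>

lemma sum_rows_eq_sum_cols:
  fixes f :: "nat \<Rightarrow> nat"
  assumes "col lam 0 \<le> n" "part lam 0 \<le> N"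
  shows "(\<Sum>j<n. f j * part lam j) = (\<Sum>i<N. \<Sum>j<col lam i. f j)"
proof -
  have rows: "f j * part lam j = (\<Sum>i<N. if i < part lam j then f j else 0)" for j
  proof -
    have "{i \<in> {..<N}. i < part lam j} = {..<part lam j}"
      using part_antimono[of 0 j lam] assms(2) by auto
    then show ?thesis
      using sum.inter_filter[of "{..<N}" "\<lambda>_. f j" "\<lambda>i. i < part lam j"] by (simp add: mult.commute)
  qed
  have "(\<Sum>j<n. f j * part lam j) = (\<Sum>i<N. \<Sum>j<n. if j < col lam i then f j else 0)"
    unfolding rows less_col_iff by (rule sum.swap)
  also have "\<dots> = (\<Sum>i<N. \<Sum>j<col lam i. f j)"
  proof (rule sum.cong[OF refl])
    fix i
    have "{j \<in> {..<n}. j < col lam i} = {..<col lam i}"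
      using col_antimono[of 0 i lam] assms(1) by auto
    then show "(\<Sum>j<n. if j < col lam i then f j else 0) = (\<Sum>j<col lam i. f j)"
      using sum.inter_filter[of "{..<n}" f "\<lambda>j. j < col lam i"] by simp
  qed
  finally show ?thesis .
qed

lemma psize_eq_sum_part:
  assumes "col lam 0 \<le> n"
  shows "psize lam = (\<Sum>j<n. part lam j)"
proof -
  have "{j. part lam j \<noteq> 0} \<subseteq> {..<n}"
    using assms by (auto simp: less_col_iff[symmetric])
  then show ?thesis
    unfolding psize_def by (intro sum.mono_neutral_left) simp_all
qed

lemma psize_eq_sum_col:
  assumes "part lam 0 \<le> N"
  shows "psize lam = (\<Sum>i<N. col lam i)"
  using sum_rows_eq_sum_cols[OF order_refl assms, of "\<lambda>_. 1"]
    psize_eq_sum_part[OF order_refl, of lam]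
  by simp

lemma pstat_eq_sum_col:
  assumes "part lam 0 \<le> N"
  shows "pstat lam = (\<Sum>i<N. col lam i choose 2)"
proof -
  have "pstat lam = (\<Sum>i<part lam 0. col lam i choose 2)"
    by (simp add: pstat_def sum.atLeast1_atMost_eq conj_part_Suc)
  also have "\<dots> = (\<Sum>i<N. col lam i choose 2)"
    by (rule sum.mono_neutral_left) (use assms in \<open>auto simp: col_eq_0_iff[THEN iffD2]\<close>)
  finally show ?thesis .
qed

lemma sum_lessThan_choose_2: "(\<Sum>j<m. j) = m choose 2"
  by (induction m) (simp_all add: numeral_2_eq_2)

lemma pstat_eq_sum_part:
  assumes "col lam 0 \<le> n"
  shows "pstat lam = (\<Sum>j<n. j * part lam j)"
  using sum_rows_eq_sum_cols[OF assms order_refl, of "\<lambda>j. j"] pstat_eq_sum_col[OF order_refl, of lam]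
  by (simp add: sum_lessThan_choose_2)

text \<open>With \<open>F 0 = 1\<close> the cut-off may be any bound on the largest part, so that
  products belonging to different partitions can be compared over a common range.\<close>

lemma prod_pmult_eq:
  fixes F :: "nat \<Rightarrow> real"
  assumes "part lam 0 \<le> N" "F 0 = 1"
  shows "(\<Prod>i=1..part lam 0. F (pmult lam i)) = (\<Prod>i<N. F (col lam i - col lam (Suc i)))"
proof -
  have "(\<Prod>i=1..part lam 0. F (pmult lam i)) = (\<Prod>i<part lam 0. F (col lam i - col lam (Suc i)))"
    unfolding One_nat_def prod.atLeast1_atMost_eq pmult_Suc ..
  also have "\<dots> = (\<Prod>i<N. F (col lam i - col lam (Suc i)))"
    by (rule prod.mono_neutral_left) (use assms in \<open>auto simp: col_eq_0_iff[THEN iffD2]\<close>)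
  finally show ?thesis .
qed

lemma qpoch_0 [simp]: "qpoch x q 0 = 1"
  and qpoch_Suc: "qpoch x q (Suc n) = qpoch x q n * (1 - x * q ^ n)"
  by (simp_all add: qpoch_def)

lemma hl_b_eq:
  assumes "part lam 0 \<le> N"
  shows "hl_b q lam = (\<Prod>i<N. qpoch q q (col lam i - col lam (Suc i)))"
  unfolding hl_b_def by (rule prod_pmult_eq) (use assms in auto)

lemma part_0_le_psize: "part lam 0 \<le> psize lam"
  and col_0_le_psize: "col lam 0 \<le> psize lam"
proof -
  show "part lam 0 \<le> psize lam"
    using psize_eq_sum_part[of lam "Suc (col lam 0)"]
    by (simp add: sum.lessThan_Suc_shift del: sum.lessThan_Suc)
  show "col lam 0 \<le> psize lam"
    using psize_eq_sum_col[of lam "Suc (part lam 0)"]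
    by (simp add: sum.lessThan_Suc_shift del: sum.lessThan_Suc)
qed

lemma finite_partitions_bounded: "finite {lam. part lam 0 \<le> A \<and> col lam 0 \<le> B}"
proof -
  let ?X = "{lam. part lam 0 \<le> A \<and> col lam 0 \<le> B}"
  have "inj_on (\<lambda>lam. restrict (col lam) {..<A}) ?X"
  proof (rule inj_onI)
    fix a b assume *: "a \<in> ?X" "b \<in> ?X" "restrict (col a) {..<A} = restrict (col b) {..<A}"
    show "a = b"
    proof (rule partition_eqI)
      fix i show "col a i = col b i"
      proof (cases "i < A")
        case True
        then show ?thesis using fun_cong[OF *(3), of i] by simp
      next
        case False
        then have "col a i = 0" "col b i = 0" using * by (auto simp: col_eq_0_iff)
        then show ?thesis by simp
      qed
    qed
  qed
  moreover have "(\<lambda>lam. restrict (col lam) {..<A}) ` ?X \<subseteq> PiE {..<A} (\<lambda>_. {..B})"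
    by (intro image_subsetI restrict_PiE_iff[THEN iffD2]) (auto intro: le_trans[OF col_antimono[of 0]])
  ultimately show ?thesis
    by (intro finite_imageD[of "\<lambda>lam. restrict (col lam) {..<A}"])
       (erule finite_subset, auto intro: finite_PiE)
qed

lemma finite_psize_le: "finite {lam. psize lam \<le> d}"
  by (rule finite_subset[OF _ finite_partitions_bounded[of d d]])
     (auto intro: le_trans[OF part_0_le_psize] le_trans[OF col_0_le_psize])

lemma finite_psize_eq: "finite {lam. psize lam = d}"
  by (rule finite_subset[OF _ finite_psize_le[of d]]) auto

section \<open>Symmetrisations\<close>

text \<open>The numerator of \<open>P_lam\<close>, but for arbitrary exponent vectors:
  multiplication by an elementary symmetric function produces exponents that are not weakly
  decreasing.\<close>

definition hl_R :: "real \<Rightarrow> nat \<Rightarrow> (nat \<Rightarrow> real) \<Rightarrow> (nat \<Rightarrow> nat) \<Rightarrow> real" where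
  "hl_R q n x \<kappa> = (\<Sum>w | w permutes {..<n}. (\<Prod>i<n. x (w i) ^ \<kappa> i) *
     (\<Prod>j<n. \<Prod>i<j. (x (w i) - q * x (w j)) / (x (w i) - x (w j))))"

lemma hl_P_eq_hl_R:
  "hl_P q lam n x = (if plength lam \<le> n then hl_R q n x (part lam) / hl_v n lam q else 0)"
  by (simp add: hl_P_def hl_R_def)

lemma hl_R_cong:
  assumes "\<And>i. i < n \<Longrightarrow> \<kappa> i = \<kappa>' i"
  shows "hl_R q n x \<kappa> = hl_R q n x \<kappa>'"
  unfolding hl_R_def using assms by (intro sum.cong refl arg_cong2[where f = "(*)"] prod.cong) auto

text \<open>The terms of \<open>w\<close> and of \<open>w\<close> composed with the transposition
  share all factors except the one for the positions \<open>i\<close>, \<open>Suc i\<close> and one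
  variable of the monomial. With \<open>a\<close>, \<open>b\<close> the variables at these
  positions, what remains is that \<open>b phi(a,b) + a phi(b,a)\<close> equals
  \<open>q (a + b)\<close> while \<open>a phi(a,b) + b phi(b,a)\<close> equals
  \<open>a + b\<close>.\<close>

lemma hl_R_transpose:
  assumes inj: "inj_on x {..<n}" and i: "Suc i < n" and \<kappa>: "\<kappa> i = Suc (\<kappa> (Suc i))"
  shows "hl_R q n x (\<kappa> \<circ> Transposition.transpose i (Suc i)) = q * hl_R q n x \<kappa>"
proof -
  define \<tau> where "\<tau> = Transposition.transpose i (Suc i)"
  define \<phi> where "\<phi> a b = (x a - q * x b) / (x a - x b)" for a b
  define P where "P = Sigma {..<n} (\<lambda>j. {..<j})"
  define \<Phi> where "\<Phi> w = (\<Prod>j<n. \<Prod>i<j. \<phi> (w i) (w j))" for w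
  define mon where "mon \<kappa> w = (\<Prod>i<n. x (w i) ^ \<kappa> i)" for \<kappa> and w :: "nat \<Rightarrow> nat"
  define B where "B w = (\<Prod>(b, a)\<in>P - {(Suc i, i)}. \<phi> (w a) (w b))" for w
  have \<tau>: "\<tau> permutes {..<n}"
    unfolding \<tau>_def using i by (intro permutes_swap_id) auto
  have \<tau>\<tau>: "\<tau> (\<tau> j) = j" for j
    by (simp add: \<tau>_def)
  have \<tau>_i: "\<tau> i = Suc i" "\<tau> (Suc i) = i"
    by (simp_all add: \<tau>_def)
  have finP: "finite P" and iP: "(Suc i, i) \<in> P"
    using i by (auto simp: P_def)
  have \<Phi>: "\<Phi> w = \<phi> (w i) (w (Suc i)) * B w" for w
  proof -
    have "\<Phi> w = (\<Prod>(b, a)\<in>P. \<phi> (w a) (w b))"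
      unfolding \<Phi>_def P_def by (subst prod.Sigma) auto
    also have "\<dots> = (case (Suc i, i) of (b, a) \<Rightarrow> \<phi> (w a) (w b)) * B w"
      unfolding B_def by (rule prod.remove[OF finP iP])
    finally show ?thesis by simp
  qed
  have B: "B (w \<circ> \<tau>) = B w" for w
  proof -
    \<comment> \<open>Transposing neighbours reverses the order of no pair of positions but the pair
      of these neighbours.\<close>
    have mem: "map_prod \<tau> \<tau> z \<in> P - {(Suc i, i)}" if "z \<in> P - {(Suc i, i)}" for z
      using that i unfolding P_def \<tau>_def Transposition.transpose_def
      by (auto split: if_splits)
    have "bij_betw (map_prod \<tau> \<tau>) (P - {(Suc i, i)}) (P - {(Suc i, i)})"
      by (rule bij_betw_byWitness[where f' = "map_prod \<tau> \<tau>"])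
         ((intro ballI, simp add: map_prod_def case_prod_unfold \<tau>\<tau>)+, (intro image_subsetI mem, assumption)+)
    from prod.reindex_bij_betw[OF this, of "\<lambda>(b, a). \<phi> (w a) (w b)"]
    show ?thesis
      unfolding B_def by (simp add: case_prod_unfold)
  qed
  have mon_\<tau>: "mon (\<kappa> \<circ> \<tau>) (w \<circ> \<tau>) = mon \<kappa> w" for \<kappa> w
    unfolding mon_def using prod.permute[OF \<tau>, of "\<lambda>i. x (w i) ^ \<kappa> i"] by (simp add: o_def)
  have mon_\<tau>': "mon \<kappa> (w \<circ> \<tau>) = mon (\<kappa> \<circ> \<tau>) w" for w
    using mon_\<tau>[of "\<kappa> \<circ> \<tau>" w] by (simp add: o_def \<tau>\<tau>)
  have split: "{..<n} = insert i (insert (Suc i) ({..<n} - {i, Suc i}))"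
    using i by auto
  have termwise: "mon (\<kappa> \<circ> \<tau>) w * \<Phi> w + mon (\<kappa> \<circ> \<tau>) (w \<circ> \<tau>) * \<Phi> (w \<circ> \<tau>) =
      q * (mon \<kappa> w * \<Phi> w + mon \<kappa> (w \<circ> \<tau>) * \<Phi> (w \<circ> \<tau>))"
    if w: "w permutes {..<n}" for w
  proof -
    define C where "C = (\<Prod>j\<in>{..<n} - {i, Suc i}. x (w j) ^ \<kappa> j)
      * x (w i) ^ \<kappa> (Suc i) * x (w (Suc i)) ^ \<kappa> (Suc i)"
    have m1: "mon \<kappa> w = C * x (w i)"
      unfolding mon_def C_def by (subst split, subst prod.insert) (simp_all add: \<kappa>)
    have "(\<Prod>j\<in>{..<n} - {i, Suc i}. x (w j) ^ \<kappa> (\<tau> j)) = (\<Prod>j\<in>{..<n} - {i, Suc i}. x (w j) ^ \<kappa> j)"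
      by (rule prod.cong) (auto simp: \<tau>_def Transposition.transpose_def)
    then have m2: "mon (\<kappa> \<circ> \<tau>) w = C * x (w (Suc i))"
      unfolding mon_def C_def by (subst split, subst prod.insert) (simp_all add: \<kappa> \<tau>_i)
    have "w i \<noteq> w (Suc i)" "w i \<in> {..<n}" "w (Suc i) \<in> {..<n}"
      using permutes_inj[OF w] permutes_in_image[OF w] i by (auto simp: inj_eq)
    then have ne: "x (w i) - x (w (Suc i)) \<noteq> 0"
      using inj by (auto dest: inj_onD)
    have ph: "\<phi> (w (Suc i)) (w i) = - (x (w (Suc i)) - q * x (w i)) / (x (w i) - x (w (Suc i)))"
      using ne unfolding \<phi>_def by (metis minus_diff_eq minus_divide_divide minus_minus)
    have "x (w (Suc i)) * \<phi> (w i) (w (Suc i)) + x (w i) * \<phi> (w (Suc i)) (w i) =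
      q * (x (w i) * \<phi> (w i) (w (Suc i)) + x (w (Suc i)) * \<phi> (w (Suc i)) (w i))"
      unfolding ph unfolding \<phi>_def using ne by (simp add: divide_simps) (simp add: algebra_simps)
    from arg_cong[OF this, of "\<lambda>z. C * B w * z"] show ?thesis
      unfolding mon_\<tau> mon_\<tau>' m1 m2 \<Phi> B by (simp add: \<tau>_i algebra_simps)
  qed
  have R: "hl_R q n x \<kappa> = (\<Sum>w | w permutes {..<n}. mon \<kappa> w * \<Phi> w)" for \<kappa>
    by (simp add: hl_R_def mon_def \<Phi>_def \<phi>_def)
  have R': "hl_R q n x \<kappa> = (\<Sum>w | w permutes {..<n}. mon \<kappa> (w \<circ> \<tau>) * \<Phi> (w \<circ> \<tau>))" for \<kappa>
    unfolding R by (rule sum_permutations_compose_right[OF \<tau>])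
  \<comment> \<open>Adding the sum to its reindexed copy pairs the permutations without choosing
    representatives.\<close>
  have "2 * hl_R q n x (\<kappa> \<circ> \<tau>) = hl_R q n x (\<kappa> \<circ> \<tau>) + hl_R q n x (\<kappa> \<circ> \<tau>)"
    by simp
  also have "\<dots> = (\<Sum>w | w permutes {..<n}. mon (\<kappa> \<circ> \<tau>) w * \<Phi> w) +
      (\<Sum>w | w permutes {..<n}. mon (\<kappa> \<circ> \<tau>) (w \<circ> \<tau>) * \<Phi> (w \<circ> \<tau>))"
    by (rule arg_cong2[where f = "(+)", OF R R'])
  also have "\<dots> = (\<Sum>w | w permutes {..<n}. q * (mon \<kappa> w * \<Phi> w + mon \<kappa> (w \<circ> \<tau>) * \<Phi> (w \<circ> \<tau>)))"
    unfolding sum.distrib[symmetric] by (rule sum.cong[OF refl], rule termwise) simp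
  also have "\<dots> = q * (hl_R q n x \<kappa> + hl_R q n x \<kappa>)"
    unfolding sum_distrib_left[symmetric] sum.distrib using R[of \<kappa>] R'[of \<kappa>] by simp
  finally show ?thesis
    by (simp add: \<tau>_def)
qed

lemma hl_R_nth_swap:
  assumes "inj_on x {..<n}" "length us + length vs + 2 = n"
  shows "hl_R q n x ((!) (us @ a # Suc a # vs)) = q * hl_R q n x ((!) (us @ Suc a # a # vs))"
proof -
  let ?i = "length us" and ?\<kappa> = "(!) (us @ Suc a # a # vs)"
  have "hl_R q n x ((!) (us @ a # Suc a # vs)) = hl_R q n x (?\<kappa> \<circ> Transposition.transpose ?i (Suc ?i))"
  proof (rule hl_R_cong)
    fix j
    consider "j < ?i" | "j = ?i" | "j = Suc ?i" | d where "j = ?i + Suc (Suc d)"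
      by (metis add_Suc_right less_imp_Suc_add linorder_neqE_nat not_less_eq)
    then show "(us @ a # Suc a # vs) ! j = (?\<kappa> \<circ> Transposition.transpose ?i (Suc ?i)) j"
      by cases (simp_all add: nth_append)
  qed
  also have "\<dots> = q * hl_R q n x ?\<kappa>"
    by (rule hl_R_transpose) (use assms in \<open>auto simp: nth_append\<close>)
  finally show ?thesis .
qed

section \<open>Gaussian binomial coefficients\<close>

definition qbinom :: "real \<Rightarrow> nat \<Rightarrow> nat \<Rightarrow> real" where
  "qbinom q n k = (if k \<le> n then qpoch q q n / (qpoch q q k * qpoch q q (n - k)) else 0)"

lemma power_Suc_less_1:
  fixes q :: real
  assumes "0 < q" "q < 1"
  shows "q * q ^ n < 1"
  using power_Suc_less_one[OF assms] by simp

lemma qpoch_pos: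
  assumes "0 < q" "q < 1"
  shows "qpoch q q n > 0"
  unfolding qpoch_def using power_Suc_less_1[OF assms] by (intro prod_pos) simp

lemma qpoch_neq_0:
  assumes "0 < q" "q < 1"
  shows "qpoch q q n \<noteq> 0"
  using qpoch_pos[OF assms, of n] by simp

lemma qbinom_0 [simp]: "0 < q \<Longrightarrow> q < 1 \<Longrightarrow> qbinom q n 0 = 1"
  and qbinom_self [simp]: "0 < q \<Longrightarrow> q < 1 \<Longrightarrow> qbinom q n n = 1"
  and qbinom_eq_0 [simp]: "n < k \<Longrightarrow> qbinom q n k = 0"
  by (simp_all add: qbinom_def qpoch_neq_0)

text \<open>Of the two \<open>q\<close>-Pascal rules this one fits sorting: the power of
  \<open>q\<close> will be the cost of moving an unraised first entry behind the raised
  ones.\<close>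

lemma qbinom_Suc_Suc:
  assumes "0 < q" "q < 1"
  shows "qbinom q (Suc n) (Suc k) = q ^ Suc k * qbinom q n (Suc k) + qbinom q n k"
proof (cases n k rule: linorder_cases)
  case greater
  define d where "d = n - Suc k"
  have n: "n = Suc (k + d)"
    using greater by (simp add: d_def)
  have "1 - q ^ Suc i \<noteq> 0" for i
    using power_Suc_less_1[OF assms, of i] by simp
  note ne = qpoch_neq_0[OF assms, of k] qpoch_neq_0[OF assms, of d] this[of k] this[of d]
  have n1: "qbinom q (Suc n) (Suc k) = qpoch q q n * (1 - q ^ Suc n) /
      (qpoch q q k * (1 - q ^ Suc k) * (qpoch q q d * (1 - q ^ Suc d)))"
    by (simp add: n qbinom_def qpoch_Suc Suc_diff_le)
  have n2: "qbinom q n (Suc k) = qpoch q q n / (qpoch q q k * (1 - q ^ Suc k) * qpoch q q d)"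
    by (simp add: n qbinom_def qpoch_Suc)
  have n3: "qbinom q n k = qpoch q q n / (qpoch q q k * (qpoch q q d * (1 - q ^ Suc d)))"
    by (simp add: n qbinom_def qpoch_Suc Suc_diff_le)
  have e: "q ^ Suc n = q ^ Suc k * q ^ Suc d"
    by (simp add: n power_add)
  show ?thesis
    unfolding n1 n2 n3 e using ne by (simp add: divide_simps del: power_Suc) (simp add: algebra_simps)
qed (use assms in \<open>auto\<close>)

text \<open>\<open>bump l f\<close> is the sum of \<open>f (l + z) (sum z)\<close> over all 0-1-vectors \<open>z\<close>.\<close>

primrec bump :: "nat list \<Rightarrow> (nat list \<Rightarrow> nat \<Rightarrow> real) \<Rightarrow> real" where
  "bump [] f = f [] 0"
| "bump (a # l) f = bump l (\<lambda>l' k. f (a # l') k) + bump l (\<lambda>l' k. f (Suc a # l') (Suc k))"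

lemma bump_cong:
  assumes "\<And>l' k. length l' = length l \<Longrightarrow> f l' k = g l' k"
  shows "bump l f = bump l g"
  using assms
proof (induction l arbitrary: f g)
  case (Cons a l)
  have "bump l (\<lambda>l' k. f (a # l') k) = bump l (\<lambda>l' k. g (a # l') k)"
    "bump l (\<lambda>l' k. f (Suc a # l') (Suc k)) = bump l (\<lambda>l' k. g (Suc a # l') (Suc k))"
    by (rule Cons.IH; use Cons.prems in simp)+
  then show ?case by simp
qed auto

lemma bump_mult_left: "bump l (\<lambda>l' k. c * f l' k) = c * bump l f"
  by (induction l arbitrary: f) (simp_all add: algebra_simps)

lemma bump_sum: "bump l (\<lambda>l' k. \<Sum>r\<in>A. f r l' k) = (\<Sum>r\<in>A. bump l (f r))"
  by (induction l arbitrary: f) (simp_all add: sum.distrib)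

lemma bump_append:
  "bump (l1 @ l2) f = bump l1 (\<lambda>l k. bump l2 (\<lambda>l' k'. f (l @ l') (k + k')))"
  by (induction l1 arbitrary: f) simp_all

definition elem_sym :: "nat \<Rightarrow> nat \<Rightarrow> (nat \<Rightarrow> real) \<Rightarrow> real" where
  "elem_sym d n x = coeff (\<Prod>i<n. [:1, x i:]) d"

lemma elem_sym_permute:
  assumes "w permutes {..<n}"
  shows "elem_sym d n (\<lambda>i. x (w i)) = elem_sym d n x"
  unfolding elem_sym_def using prod.permute[OF assms, of "\<lambda>i. [:1, x i:]"] by (simp add: o_def)

lemma elem_sym_0 [simp]: "elem_sym 0 n x = 1"
  unfolding elem_sym_def by (induction n) (simp_all add: coeff_mult)

text \<open>A monomial of \<open>elem_sym d\<close> is a 0-1-vector of weight \<open>d\<close>,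
  added to the exponents. The induction splits off the first variable; the case \<open>d = 0\<close>
  is kept apart because there \<open>d - 1\<close> would be truncated.\<close>

lemma mult_elem_sym_eq_bump:
  "(\<Prod>i<length l. y i ^ (l ! i)) * elem_sym d (length l) y =
     bump l (\<lambda>l' k. (\<Prod>i<length l. y i ^ (l' ! i)) * of_bool (k = d))"
proof (induction l arbitrary: y d)
  case Nil
  then show ?case by (simp add: elem_sym_def)
next
  case (Cons a l)
  let ?n = "length l" and ?y = "\<lambda>i. y (Suc i)"
  have step: "elem_sym d (Suc ?n) y = elem_sym d ?n ?y + (if d = 0 then 0 else y 0 * elem_sym (d - 1) ?n ?y)"
    by (simp add: elem_sym_def prod.lessThan_Suc_shift coeff_pCons split: nat.split del: prod.lessThan_Suc)
  have b: "bump l (\<lambda>l' k. (\<Prod>i<Suc ?n. y i ^ ((b # l') ! i)) * of_bool (F k)) =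
      y 0 ^ b * bump l (\<lambda>l' k. (\<Prod>i<?n. y (Suc i) ^ (l' ! i)) * of_bool (F k))" for b F
    by (simp add: prod.lessThan_Suc_shift bump_mult_left[symmetric] mult.assoc del: prod.lessThan_Suc)
  have s: "bump l (\<lambda>l' k. (\<Prod>i<?n. y (Suc i) ^ (l' ! i)) * of_bool (Suc k = d)) =
    (if d = 0 then 0 else (\<Prod>i<?n. y (Suc i) ^ (l ! i)) * elem_sym (d - 1) ?n ?y)"
  proof (cases d)
    case 0
    then show ?thesis using bump_mult_left[of l 0 "\<lambda>_ _. 0"] by simp
  next
    case (Suc d')
    then show ?thesis using Cons.IH[of ?y d'] by simp
  qed
  have "(\<Prod>i<length (a # l). y i ^ ((a # l) ! i)) * elem_sym d (length (a # l)) y =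
      y 0 ^ a * (\<Prod>i<?n. y (Suc i) ^ (l ! i)) * elem_sym d (Suc ?n) y"
    by (simp add: prod.lessThan_Suc_shift del: prod.lessThan_Suc)
  also have "\<dots> = y 0 ^ a * ((\<Prod>i<?n. y (Suc i) ^ (l ! i)) * elem_sym d ?n ?y) +
     y 0 ^ Suc a * (if d = 0 then 0 else (\<Prod>i<?n. y (Suc i) ^ (l ! i)) * elem_sym (d - 1) ?n ?y)"
    unfolding step by (simp add: algebra_simps)
  also have "\<dots> = bump (a # l) (\<lambda>l' k. (\<Prod>i<length (a # l). y i ^ (l' ! i)) * of_bool (k = d))"
    unfolding bump.simps list.size(4) add_Suc_right add_0_right b s Cons.IH[of ?y d] ..
  finally show ?case .
qed

text \<open>Being symmetric, the elementary symmetric function may be evaluated at the permuted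
  variables inside each term of the symmetrisation.\<close>

lemma hl_R_mult_elem_sym:
  assumes "length l = n"
  shows "hl_R q n x ((!) l) * elem_sym d n x = bump l (\<lambda>l' k. hl_R q n x ((!) l') * of_bool (k = d))"
proof -
  define \<Phi> where "\<Phi> w = (\<Prod>j<n. \<Prod>i<j. (x (w i) - q * x (w j)) / (x (w i) - x (w j)))" for w
  have "hl_R q n x ((!) l) * elem_sym d n x =
      (\<Sum>w | w permutes {..<n}. \<Phi> w * ((\<Prod>i<n. x (w i) ^ (l ! i)) * elem_sym d n x))"
    unfolding hl_R_def \<Phi>_def sum_distrib_right by (simp add: mult_ac)
  also have "\<dots> = (\<Sum>w | w permutes {..<n}. \<Phi> w *
      bump l (\<lambda>l' k. (\<Prod>i<n. x (w i) ^ (l' ! i)) * of_bool (k = d)))"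
  proof (rule sum.cong[OF refl])
    fix w assume "w \<in> {w. w permutes {..<n}}"
    then have "elem_sym d n x = elem_sym d n (\<lambda>i. x (w i))"
      by (simp add: elem_sym_permute)
    then show "\<Phi> w * ((\<Prod>i<n. x (w i) ^ (l ! i)) * elem_sym d n x) =
      \<Phi> w * bump l (\<lambda>l' k. (\<Prod>i<n. x (w i) ^ (l' ! i)) * of_bool (k = d))"
      using mult_elem_sym_eq_bump[of "\<lambda>i. x (w i)" l d] assms by simp
  qed
  also have "\<dots> = bump l (\<lambda>l' k. hl_R q n x ((!) l') * of_bool (k = d))"
    unfolding bump_mult_left[symmetric] bump_sum[symmetric]
    by (rule arg_cong[where f = "bump l"])
       (simp add: fun_eq_iff hl_R_def \<Phi>_def sum_distrib_right mult_ac)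
  finally show ?thesis .
qed

section \<open>Sorting words by the adjacent-swap relation\<close>

context
  fixes q :: real and n :: nat and F :: "nat list \<Rightarrow> real"
  assumes q: "0 < q" "q < 1"
    and swap: "\<And>us a vs. length us + length vs + 2 = n \<Longrightarrow>
      F (us @ a # Suc a # vs) = q * F (us @ Suc a # a # vs)"
begin

lemma shift_through_replicate:
  "length us + r + length vs + 1 = n \<Longrightarrow>
     F (us @ a # replicate r (Suc a) @ vs) = q ^ r * F (us @ replicate r (Suc a) @ a # vs)"
proof (induction r arbitrary: us)
  case (Suc r)
  have 1: "F (us @ a # Suc a # (replicate r (Suc a) @ vs)) = q * F (us @ Suc a # a # (replicate r (Suc a) @ vs))"
    by (rule swap) (use Suc.prems in simp)
  have 2: "F ((us @ [Suc a]) @ a # replicate r (Suc a) @ vs) =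
      q ^ r * F ((us @ [Suc a]) @ replicate r (Suc a) @ a # vs)"
    by (rule Suc.IH) (use Suc.prems in simp)
  show ?case
    using 1 2 by simp
qed simp

text \<open>Sorting a word in \<open>a\<close> and \<open>Suc a\<close> costs one factor
  \<open>q\<close> for each inversion, and the inversion generating function of words with
  \<open>r\<close> raised letters among \<open>m\<close> is the Gaussian binomial. The induction
  takes the first letter raised or not. The contexts \<open>us\<close> and \<open>vs\<close> are
  there because the block sits inside a longer word.\<close>

lemma bump_replicate:
  "length us + m + length vs = n \<Longrightarrow>
     bump (replicate m a) (\<lambda>l k. F (us @ l @ vs) * g k) =
     (\<Sum>r\<le>m. qbinom q m r * (F (us @ replicate r (Suc a) @ replicate (m - r) a @ vs) * g r))"
proof (induction m arbitrary: us g)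
  case 0
  then show ?case using q by simp
next
  case (Suc m)
  define h where "h r = F (us @ replicate r (Suc a) @ replicate (Suc m - r) a @ vs) * g r" for r
  have 1: "bump (replicate m a) (\<lambda>l k. F (us @ (a # l) @ vs) * g k) = (\<Sum>r\<le>m. q ^ r * qbinom q m r * h r)"
  proof -
    have "F (us @ a # replicate r (Suc a) @ replicate (m - r) a @ vs) * g r = q ^ r * h r" if "r \<le> m" for r
      using shift_through_replicate[of us r "replicate (m - r) a @ vs" a] Suc.prems that
      by (simp add: h_def Suc_diff_le)
    note eq = this
    have "bump (replicate m a) (\<lambda>l k. F (us @ (a # l) @ vs) * g k) = (\<Sum>r\<le>m. qbinom q m r *
        (F (us @ a # replicate r (Suc a) @ replicate (m - r) a @ vs) * g r))"
      using Suc.IH[of "us @ [a]" g] Suc.prems by simp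
    also have "\<dots> = (\<Sum>r\<le>m. q ^ r * qbinom q m r * h r)"
      by (rule sum.cong[OF refl]) (simp only: eq atMost_iff mult.left_commute mult.assoc)
    finally show ?thesis .
  qed
  have 2: "bump (replicate m a) (\<lambda>l k. F (us @ (Suc a # l) @ vs) * g (Suc k)) = (\<Sum>r\<le>m. qbinom q m r * h (Suc r))"
    using Suc.IH[of "us @ [Suc a]" "\<lambda>k. g (Suc k)"] Suc.prems by (simp add: h_def)
  have 3: "(\<Sum>r\<le>m. q ^ r * qbinom q m r * h r) = h 0 + (\<Sum>r\<le>m. q ^ Suc r * qbinom q m (Suc r) * h (Suc r))"
  proof -
    have "(\<Sum>r\<le>m. q ^ r * qbinom q m r * h r) = (\<Sum>r\<le>Suc m. q ^ r * qbinom q m r * h r)"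
      by simp
    also have "\<dots> = h 0 + (\<Sum>r\<le>m. q ^ Suc r * qbinom q m (Suc r) * h (Suc r))"
      unfolding sum.atMost_Suc_shift using q by simp
    finally show ?thesis .
  qed
  have 4: "(\<Sum>r\<le>Suc m. qbinom q (Suc m) r * h r) =
      h 0 + (\<Sum>r\<le>m. q ^ Suc r * qbinom q m (Suc r) * h (Suc r)) + (\<Sum>r\<le>m. qbinom q m r * h (Suc r))"
    unfolding sum.atMost_Suc_shift using q
    by (simp add: qbinom_Suc_Suc[OF q] algebra_simps sum.distrib)
  have "bump (replicate (Suc m) a) (\<lambda>l k. F (us @ l @ vs) * g k) =
      (\<Sum>r\<le>m. q ^ r * qbinom q m r * h r) + (\<Sum>r\<le>m. qbinom q m r * h (Suc r))"
    using 1 2 by simp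
  also have "\<dots> = (\<Sum>r\<le>Suc m. qbinom q (Suc m) r * h r)"
    by (simp only: 3 4)
  finally show ?case
    by (simp only: h_def)
qed

end

primrec blocks :: "(nat \<Rightarrow> nat) \<Rightarrow> nat \<Rightarrow> nat list" where
  "blocks m 0 = []"
| "blocks m (Suc N) = replicate (m N) N @ blocks m N"

text \<open>The word left after sorting within each block: \<open>r i\<close> of the
  \<open>m i\<close> copies of \<open>i\<close> have been raised.\<close>

primrec split_blocks :: "(nat \<Rightarrow> nat) \<Rightarrow> (nat \<Rightarrow> nat) \<Rightarrow> nat \<Rightarrow> nat list" where
  "split_blocks m r 0 = []"
| "split_blocks m r (Suc N) = replicate (r N) (Suc N) @ replicate (m N - r N) N @ split_blocks m r N"

lemma length_split_blocks:
  assumes "\<And>i. i < N \<Longrightarrow> r i \<le> m i"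
  shows "length (split_blocks m r N) = (\<Sum>i<N. m i)"
  using assms
proof (induction N)
  case (Suc N)
  then have "r N \<le> m N" by blast
  moreover have "length (split_blocks m r N) = (\<Sum>i<N. m i)"
    using Suc by simp
  ultimately show ?case by simp
qed simp

lemma split_blocks_cong: "(\<And>i. i < N \<Longrightarrow> r i = r' i) \<Longrightarrow> split_blocks m r N = split_blocks m r' N"
  by (induction N) simp_all

text \<open>The raised copies of \<open>i\<close> stand directly behind the unraised copies of
  \<open>i + 1\<close> and merge with them. The word is thus already weakly decreasing, with new
  multiplicities, and different blocks never have to be sorted against each other.\<close>

lemma split_blocks_eq_blocks:
  "split_blocks m r (Suc N) = replicate (r N) (Suc N) @
     blocks (\<lambda>i. m i - r i + (case i of 0 \<Rightarrow> 0 | Suc i \<Rightarrow> r i)) (Suc N)"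
  by (induction N) (simp_all add: replicate_add)

lemma sum_PiE_lessThan_Suc:
  fixes G :: "(nat \<Rightarrow> 'a) \<Rightarrow> real"
  shows "(\<Sum>r\<in>PiE {..<Suc N} A. G r) = (\<Sum>r\<in>PiE {..<N} A. \<Sum>s\<in>A N. G (r(N := s)))"
proof -
  have "(\<Sum>r\<in>PiE {..<Suc N} A. G r) = (\<Sum>(s, r)\<in>A N \<times> PiE {..<N} A. G (r(N := s)))"
  proof -
    have "inj_on (\<lambda>(s, r). r(N := s)) (A N \<times> PiE {..<N} A)"
      by (rule inj_combinator) simp
    then show ?thesis
      unfolding lessThan_Suc PiE_insert_eq by (simp add: sum.reindex case_prod_unfold)
  qed
  also have "\<dots> = (\<Sum>s\<in>A N. \<Sum>r\<in>PiE {..<N} A. G (r(N := s)))"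
    by (rule sum.cartesian_product[symmetric])
  also have "\<dots> = (\<Sum>r\<in>PiE {..<N} A. \<Sum>s\<in>A N. G (r(N := s)))"
    by (rule sum.swap)
  finally show ?thesis .
qed

text \<open>The blocks are sorted one by one, each contributing its own Gaussian binomial. The
  generalised \<open>us\<close> holds the blocks already treated, and the shifted \<open>g\<close>
  remembers how many of their letters were raised.\<close>

lemma bump_blocks:
  fixes F :: "nat list \<Rightarrow> real"
  assumes q: "0 < q" "q < 1"
    and swap: "\<And>us a vs. length us + length vs + 2 = n \<Longrightarrow>
      F (us @ a # Suc a # vs) = q * F (us @ Suc a # a # vs)"
  shows "length us + (\<Sum>i<N. m i) = n \<Longrightarrow>
    bump (blocks m N) (\<lambda>l k. F (us @ l) * g k) =
    (\<Sum>r\<in>PiE {..<N} (\<lambda>i. {..m i}). (\<Prod>i<N. qbinom q (m i) (r i)) *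
       (F (us @ split_blocks m r N) * g (\<Sum>i<N. r i)))"
proof (induction N arbitrary: us g)
  case (Suc N)
  let ?A = "PiE {..<N} (\<lambda>i. {..m i})" and ?c = "\<lambda>r. \<Prod>i<N. qbinom q (m i) (r i)"
  have "bump (blocks m (Suc N)) (\<lambda>l k. F (us @ l) * g k) =
    bump (replicate (m N) N) (\<lambda>l k. bump (blocks m N) (\<lambda>l' k'. F ((us @ l) @ l') * g (k + k')))"
    by (simp add: bump_append)
  also have "\<dots> = bump (replicate (m N) N) (\<lambda>l k. \<Sum>r\<in>?A. ?c r *
      (F (us @ l @ split_blocks m r N) * g (k + (\<Sum>i<N. r i))))"
  proof (rule bump_cong)
    fix l :: "nat list" and k :: nat
    assume "length l = length (replicate (m N) N)"
    then have "length (us @ l) + sum m {..<N} = n"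
      using Suc.prems by simp
    from Suc.IH[OF this, of "\<lambda>k'. g (k + k')"]
    show "bump (blocks m N) (\<lambda>l' k'. F ((us @ l) @ l') * g (k + k')) =
      (\<Sum>r\<in>?A. ?c r * (F (us @ l @ split_blocks m r N) * g (k + (\<Sum>i<N. r i))))"
      by simp
  qed
  also have "\<dots> = (\<Sum>r\<in>?A. ?c r * (\<Sum>s\<le>m N. qbinom q (m N) s *
      (F (us @ replicate s (Suc N) @ replicate (m N - s) N @ split_blocks m r N) * g (s + (\<Sum>i<N. r i)))))"
    unfolding bump_sum bump_mult_left
  proof (rule sum.cong[OF refl])
    fix r assume "r \<in> ?A"
    then have "length (split_blocks m r N) = sum m {..<N}"
      by (intro length_split_blocks) auto
    then show "?c r * bump (replicate (m N) N)
        (\<lambda>l k. F (us @ l @ split_blocks m r N) * g (k + (\<Sum>i<N. r i))) =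
      ?c r * (\<Sum>s\<le>m N. qbinom q (m N) s *
      (F (us @ replicate s (Suc N) @ replicate (m N - s) N @ split_blocks m r N) * g (s + (\<Sum>i<N. r i))))"
      using bump_replicate[OF q swap, where us = us and m = "m N" and vs = "split_blocks m r N" and a = N
          and g = "\<lambda>k. g (k + (\<Sum>i<N. r i))"]
        Suc.prems by simp
  qed
  also have "\<dots> = (\<Sum>r\<in>PiE {..<Suc N} (\<lambda>i. {..m i}). (\<Prod>i<Suc N. qbinom q (m i) (r i)) *
       (F (us @ split_blocks m r (Suc N)) * g (\<Sum>i<Suc N. r i)))"
  proof -
    have "split_blocks m (r(N := s)) N = split_blocks m r N" for r s
      by (rule split_blocks_cong) simp
    moreover have "(\<Sum>i<N. (r(N := s)) i) = (\<Sum>i<N. r i)" for r :: "nat \<Rightarrow> nat" and s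
      by (rule sum.cong) auto
    moreover have "(\<Prod>i<N. qbinom q (m i) ((r(N := s)) i)) = ?c r" for r s
      by (rule prod.cong) auto
    ultimately show ?thesis
      unfolding sum_PiE_lessThan_Suc sum_distrib_left
      by (intro sum.cong refl)
         (simp only: split_blocks.simps prod.lessThan_Suc sum.lessThan_Suc fun_upd_same append_assoc
            mult.assoc mult.commute mult.left_commute add.commute)
  qed
  finally show ?case .
qed simp

section \<open>The Pieri rule for elementary symmetric functions\<close>

text \<open>The columns preceded by a virtual column of length \<open>n\<close>, the number of
  variables. In this way the zero parts form a block like any other, of multiplicity
  \<open>n\<close> minus the length.\<close>

definition level :: "nat \<Rightarrow> partition \<Rightarrow> nat \<Rightarrow> nat" where
  "level n lam i = (case i of 0 \<Rightarrow> n | Suc j \<Rightarrow> col lam j)"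

definition level_mult :: "nat \<Rightarrow> partition \<Rightarrow> nat \<Rightarrow> nat" where
  "level_mult n lam i = level n lam i - level n lam (Suc i)"

lemma level_simps [simp]: "level n lam 0 = n" "level n lam (Suc i) = col lam i"
  by (simp_all add: level_def)

lemma level_mult_simps [simp]:
  "level_mult n lam 0 = n - col lam 0" "level_mult n lam (Suc i) = col lam i - col lam (Suc i)"
  by (simp_all add: level_mult_def)

lemma level_Suc_le: "col lam 0 \<le> n \<Longrightarrow> level n lam (Suc k) \<le> level n lam k"
  by (cases k) (simp_all add: col_Suc_le)

lemma level_le: "col lam 0 \<le> n \<Longrightarrow> level n lam k \<le> n"
  by (cases k) (auto intro: le_trans[OF col_antimono[of 0]])

lemma col_eq_0: "part lam 0 \<le> N \<Longrightarrow> col lam N = 0"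
  by (simp add: col_eq_0_iff)

text \<open>The rows equal to \<open>k\<close> are those with index from
  \<open>level n lam (Suc k)\<close> up to, but excluding, \<open>level n lam k\<close>.\<close>

lemma map_part_eq_blocks:
  assumes "col lam 0 \<le> n"
  shows "map (part lam) [level n lam k..<n] = blocks (level_mult n lam) k"
proof (induction k)
  case (Suc k)
  let ?a = "level n lam (Suc k)" and ?b = "level n lam k"
  have le: "?a \<le> ?b" "?b \<le> n"
    using assms by (rule level_Suc_le level_le)+
  have const: "part lam j = k" if "?a \<le> j" "j < ?b" for j
  proof -
    have "part lam j \<le> k"
      using that(1) less_col_iff[of j lam k] by simp
    moreover have "k \<le> part lam j"
    proof (cases k)
      case (Suc k')
      then show ?thesis using that(2) less_col_iff[of j lam k'] by simp
    qed simp
    ultimately show ?thesis by simp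
  qed
  have "map (part lam) [?a..<?b] = map (\<lambda>_. k) [?a..<?b]"
    by (rule map_cong) (auto intro: const)
  also have "\<dots> = replicate (level_mult n lam k) k"
    by (simp add: map_replicate_const level_mult_def)
  finally have "map (part lam) [?a..<?b] = replicate (level_mult n lam k) k" .
  moreover have "[?a..<n] = [?a..<?b] @ [?b..<n]"
    using le upt_add_eq_append[of ?a ?b "n - ?b"] by simp
  ultimately show ?case
    using Suc.IH by (simp del: level_simps level_mult_simps)
qed simp

lemma sum_mult:
  assumes "col lam 0 \<le> n"
  shows "(\<Sum>i<N. level_mult n lam i) + level n lam N = n"
proof (induction N)
  case (Suc N)
  then show ?case
    using level_Suc_le[OF assms, of N] by (simp add: level_mult_def del: level_simps level_mult_simps)
qed simp

lemma hl_v_eq: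
  assumes "part lam 0 \<le> N" "col lam 0 \<le> n"
  shows "hl_v n lam q = (\<Prod>i\<le>N. qpoch q q (level_mult n lam i) / (1 - q) ^ level_mult n lam i)"
proof -
  have "(\<Prod>i=1..part lam 0. qpoch q q (pmult lam i) / (1 - q) ^ pmult lam i) =
      (\<Prod>i<N. qpoch q q (col lam i - col lam (Suc i)) / (1 - q) ^ (col lam i - col lam (Suc i)))"
    by (rule prod_pmult_eq[OF assms(1), of "\<lambda>m. qpoch q q m / (1 - q) ^ m"]) simp
  then show ?thesis
    unfolding hl_v_def plength_eq_col lessThan_Suc_atMost[symmetric] prod.lessThan_Suc_shift by simp
qed

text \<open>Adding at most one cell to each row amounts to this interlacing of column
  lengths.\<close>

definition vstrip :: "partition \<Rightarrow> partition \<Rightarrow> bool" where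
  "vstrip lam mu \<longleftrightarrow> (\<forall>i. col lam (Suc i) \<le> col mu i \<and> col mu i \<le> col lam i)"

definition pieri_e :: "real \<Rightarrow> partition \<Rightarrow> partition \<Rightarrow> real" where
  "pieri_e q lam mu = (\<Prod>i<part lam 0. qbinom q (col lam i - col lam (Suc i)) (col lam i - col mu i))"

lemma pieri_e_eq:
  assumes "0 < q" "q < 1" "part lam 0 \<le> N"
  shows "pieri_e q lam mu = (\<Prod>i<N. qbinom q (col lam i - col lam (Suc i)) (col lam i - col mu i))"
  unfolding pieri_e_def
  by (rule prod.mono_neutral_left) (use assms in \<open>auto simp: col_eq_0\<close>)

lemma qbinom_eq_scaled:
  fixes q :: real
  assumes "0 < q" "q < 1" "k \<le> n"
  defines "V \<equiv> \<lambda>m. qpoch q q m / (1 - q) ^ m"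
  shows "qbinom q n k = V n / (V k * V (n - k))"
proof -
  have "(1 - q) ^ n = (1 - q) ^ k * (1 - q) ^ (n - k)"
    using assms by (simp flip: power_add)
  then show ?thesis
    using assms by (simp add: qbinom_def V_def)
qed

lemma psize_eq_add_sum_col_diff:
  assumes "\<And>i. col mu i \<le> col lam i" "part lam 0 \<le> N" "part mu 0 \<le> N"
  shows "psize lam = psize mu + (\<Sum>i<N. col lam i - col mu i)"
proof -
  have "(\<Sum>i<N. col lam i) = (\<Sum>i<N. col mu i) + (\<Sum>i<N. col lam i - col mu i)"
    unfolding sum.distrib[symmetric] using assms(1) by (intro sum.cong) auto
  then show ?thesis
    using assms(2,3) by (simp add: psize_eq_sum_col)
qed

text \<open>Let \<open>r i\<close> parts of \<open>mu\<close> equal to \<open>i\<close> be raised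
  and \<open>s i\<close> be left alone. Then \<open>mu\<close> has \<open>r i + s i\<close> parts
  equal to \<open>i\<close>, whereas \<open>lam\<close> has \<open>r i + s (i + 1)\<close> parts
  equal to \<open>i + 1\<close> and \<open>s 0\<close> zero parts. Both sides are therefore the same
  quotient of values of \<open>V\<close>. This converts binomials in the multiplicities of
  \<open>mu\<close>, which see \<open>n\<close>, into binomials in those of \<open>lam\<close>,
  which do not.\<close>

lemma hl_v_pieri_e:
  assumes q: "0 < q" "q < 1" and vs: "vstrip lam mu" and n: "col lam 0 \<le> n"
    and N: "part mu 0 < N" "part lam 0 \<le> N"
  shows "(\<Prod>i<N. qbinom q (level_mult n mu i) (col lam i - col mu i)) * hl_v n lam q =
    pieri_e q lam mu * hl_v n mu q"
proof -
  define V where "V m = qpoch q q m / (1 - q) ^ m" for m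
  define r where "r i = col lam i - col mu i" for i
  have V: "V m \<noteq> 0" for m
    using q by (simp add: V_def qpoch_neq_0)
  have le: "col lam (Suc i) \<le> col mu i" "col mu i \<le> col lam i" for i
    using vs by (auto simp: vstrip_def)
  have nmu: "col mu 0 \<le> n"
    using le(2)[of 0] n by simp
  have r_le: "r i \<le> level_mult n mu i" for i
    using le n by (cases i) (auto simp: r_def intro: diff_le_mono)
  have m0: "level_mult n mu 0 - r 0 = level_mult n lam 0"
    using le(2)[of 0] n by (simp add: r_def)
  have mS: "level_mult n lam (Suc i) - r i = level_mult n mu (Suc i) - r (Suc i)" for i
    using le(1)[of i] le(2)[of i] le(2)[of "Suc i"] by (simp add: r_def)
  have rS: "r i \<le> level_mult n lam (Suc i)" for i
    using le(1)[of i] le(2)[of i] by (simp add: r_def)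
  have "(\<Prod>i<N. qbinom q (level_mult n mu i) (r i)) = (\<Prod>i\<le>N. qbinom q (level_mult n mu i) (r i))"
    using q N by (cases N) (simp_all add: r_def col_eq_0 lessThan_Suc_atMost[symmetric])
  also have "\<dots> = (\<Prod>i\<le>N. V (level_mult n mu i)) / ((\<Prod>i\<le>N. V (r i)) * (\<Prod>i\<le>N. V (level_mult n mu i - r i)))"
    unfolding V_def using q r_le by (simp add: qbinom_eq_scaled prod_dividef prod.distrib)
  also have "(\<Prod>i\<le>N. V (level_mult n mu i - r i)) = V (level_mult n lam 0) * (\<Prod>i<N. V (level_mult n lam (Suc i) - r i))"
    unfolding lessThan_Suc_atMost[symmetric] prod.lessThan_Suc_shift m0 mS by simp
  also have "(\<Prod>i\<le>N. V (r i)) = (\<Prod>i<N. V (r i))"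
    using N by (simp add: lessThan_Suc_atMost[symmetric] r_def col_eq_0 V_def)
  finally have 1: "(\<Prod>i<N. qbinom q (level_mult n mu i) (r i)) = (\<Prod>i\<le>N. V (level_mult n mu i)) /
     ((\<Prod>i<N. V (r i)) * (V (level_mult n lam 0) * (\<Prod>i<N. V (level_mult n lam (Suc i) - r i))))" .
  have 2: "(\<Prod>i\<le>N. V (level_mult n lam i)) = V (level_mult n lam 0) * (\<Prod>i<N. V (level_mult n lam (Suc i)))"
    unfolding lessThan_Suc_atMost[symmetric] prod.lessThan_Suc_shift by simp
  have "pieri_e q lam mu = (\<Prod>i<N. qbinom q (level_mult n lam (Suc i)) (r i))"
    using pieri_e_eq[OF q N(2)] by (simp add: r_def)
  also have "\<dots> = (\<Prod>i<N. V (level_mult n lam (Suc i))) / ((\<Prod>i<N. V (r i)) * (\<Prod>i<N. V (level_mult n lam (Suc i) - r i)))"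
    unfolding V_def using q rS by (simp only: qbinom_eq_scaled prod_dividef prod.distrib)
  finally have 3: "pieri_e q lam mu = \<dots>" .
  have ne: "V (level_mult n lam 0) \<noteq> 0" by (rule V)
  have "hl_v n lam q = (\<Prod>i\<le>N. V (level_mult n lam i))" "hl_v n mu q = (\<Prod>i\<le>N. V (level_mult n mu i))"
    using N n nmu by (simp_all add: hl_v_eq[of _ N] V_def)
  then show ?thesis
    unfolding r_def[symmetric] 1 3 using ne by (simp add: 2 del: level_mult_simps)
qed

lemma hl_v_pos:
  assumes q: "0 < q" "q < 1"
  shows "hl_v n lam q > 0"
  unfolding hl_v_def using q by (intro mult_pos_pos divide_pos_pos prod_pos zero_less_power) (auto simp: qpoch_pos)

text \<open>Raising \<open>r i\<close> parts equal to \<open>i\<close> lengthens column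
  \<open>i\<close> by \<open>r i\<close>. The bound of \<open>r i\<close> by the multiplicity is the
  vertical strip condition for \<open>i > 0\<close>, and for \<open>i = 0\<close> it says that the
  result still has at most \<open>n\<close> parts. Summation over \<open>r\<close> thus becomes
  summation over partitions.\<close>

lemma hl_R_pieri:
  assumes q: "0 < q" "q < 1" and inj: "inj_on x {..<n}" and n: "col mu 0 \<le> n" and N: "part mu 0 < N"
  shows "hl_R q n x (part mu) * elem_sym d n x =
    (\<Sum>lam | vstrip lam mu \<and> psize lam = psize mu + d \<and> col lam 0 \<le> n.
       (\<Prod>i<N. qbinom q (level_mult n mu i) (col lam i - col mu i)) * hl_R q n x (part lam))"
proof -
  let ?m = "level_mult n mu" and ?F = "\<lambda>l. hl_R q n x ((!) l)"
  let ?L = "{lam. vstrip lam mu \<and> psize lam = psize mu + d \<and> col lam 0 \<le> n}"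
  let ?A = "{r \<in> PiE {..<N} (\<lambda>i. {..?m i}). (\<Sum>i<N. r i) = d}"
  let ?c = "\<lambda>r. \<Prod>i<N. qbinom q (?m i) (r i)"
  have level_N: "level n mu N = 0" and mult_N: "?m N = 0"
    using N by (cases N; simp add: col_eq_0)+
  have map_mu: "map (part mu) [0..<n] = blocks ?m N"
    using map_part_eq_blocks[OF n, of N] level_N by simp
  have part_N: "part lam 0 \<le> N" if "lam \<in> ?L" for lam
  proof -
    have "col lam N \<le> col mu (N - 1)"
      using that N by (cases N) (auto simp: vstrip_def)
    also have "\<dots> = 0"
      using N by (simp add: col_eq_0)
    finally show ?thesis by (simp add: col_eq_0_iff)
  qed
  have "hl_R q n x (part mu) * elem_sym d n x = ?F (blocks ?m N) * elem_sym d n x"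
    unfolding map_mu[symmetric] by (intro arg_cong2[where f = "(*)"] hl_R_cong) auto
  also have "\<dots> = bump (blocks ?m N) (\<lambda>l k. ?F l * of_bool (k = d))"
    by (rule hl_R_mult_elem_sym) (simp flip: map_mu)
  also have "\<dots> = (\<Sum>r\<in>PiE {..<N} (\<lambda>i. {..?m i}). ?c r * (?F (split_blocks ?m r N) * of_bool ((\<Sum>i<N. r i) = d)))"
  proof -
    have "length ([] :: nat list) + (\<Sum>i<N. ?m i) = n"
      using sum_mult[OF n, of N] level_N by simp
    from bump_blocks[where q = q and n = n and F = ?F and g = "\<lambda>k. of_bool (k = d)", OF q _ this]
    show ?thesis
      using hl_R_nth_swap[OF inj] by (simp only: append_Nil)
  qed
  also have "\<dots> = (\<Sum>r\<in>?A. ?c r * ?F (split_blocks ?m r N))"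
    by (rule sum.mono_neutral_cong_right) (auto intro: finite_PiE)
  also have "\<dots> = (\<Sum>lam\<in>?L. ?c (\<lambda>i. col lam i - col mu i) * hl_R q n x (part lam))"
  proof (rule sum.reindex_bij_betw[symmetric, THEN trans, of "\<lambda>lam. restrict (\<lambda>i. col lam i - col mu i) {..<N}" ?L])
    let ?r = "\<lambda>lam. restrict (\<lambda>i. col lam i - col mu i) {..<N}"
    have r_le: "col lam i - col mu i \<le> ?m i" if "lam \<in> ?L" for lam i
      using that by (cases i) (auto simp: vstrip_def intro!: diff_le_mono)
    have maps: "?r lam \<in> ?A" if lam: "lam \<in> ?L" for lam
      using psize_eq_add_sum_col_diff[of mu lam N] lam part_N[OF lam] N r_le[OF lam]
      by (auto simp: vstrip_def)
    have inj: "lam = lam'" if "lam \<in> ?L" "lam' \<in> ?L" "?r lam = ?r lam'" for lam lam'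
    proof (rule partition_eqI)
      fix i
      show "col lam i = col lam' i"
      proof (cases "i < N")
        case True
        then have "col lam i - col mu i = col lam' i - col mu i"
          using fun_cong[OF that(3), of i] by simp
        moreover have "col mu i \<le> col lam i" "col mu i \<le> col lam' i"
          using that(1,2) by (auto simp: vstrip_def)
        ultimately show ?thesis by linarith
      next
        case False
        then show ?thesis
          using part_N[OF that(1)] part_N[OF that(2)] by (simp add: col_eq_0)
      qed
    qed
    have surj: "\<exists>lam\<in>?L. r = ?r lam" if r: "r \<in> ?A" for r
    proof -
      define r' where "r' i = (if i < N then r i else 0)" for i
      have r'_le: "r' i \<le> ?m i" for i
        using r by (auto simp: r'_def)
      have mono: "col mu (Suc i) + r' (Suc i) \<le> col mu i + r' i" for i
        using r'_le[of "Suc i"] col_Suc_le[of mu i] by simp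
      have zero: "col mu N + r' N = 0"
        using N by (simp add: r'_def col_eq_0)
      obtain lam where col: "\<And>i. col lam i = col mu i + r' i"
        using ex_partition_col[where c = "\<lambda>i. col mu i + r' i", OF mono zero] by blast
      have vs: "vstrip lam mu"
        unfolding vstrip_def
      proof (intro allI conjI)
        fix i
        show "col lam (Suc i) \<le> col mu i" "col mu i \<le> col lam i"
          using r'_le[of "Suc i"] col_Suc_le[of mu i] by (simp_all add: col)
      qed
      have "part lam 0 \<le> N"
        unfolding col_eq_0_iff[symmetric] col by (rule zero)
      then have "psize lam = psize mu + (\<Sum>i<N. r' i)"
        using psize_eq_add_sum_col_diff[of mu lam N] N by (simp add: col)
      then have "psize lam = psize mu + d"
        using r by (simp add: r'_def)
      moreover have "col lam 0 \<le> n"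
        using r'_le[of 0] n by (simp add: col)
      moreover have "r = ?r lam"
        using r by (auto simp: col r'_def fun_eq_iff PiE_iff extensional_def)
      ultimately show ?thesis using vs by blast
    qed
    show "bij_betw ?r ?L ?A"
      unfolding bij_betw_def
    proof
      show "inj_on ?r ?L"
        using inj by (intro inj_onI) blast
      show "?r ` ?L = ?A"
        using maps surj by blast
    qed
    show "(\<Sum>lam\<in>?L. ?c (?r lam) * ?F (split_blocks ?m (?r lam) N)) =
      (\<Sum>lam\<in>?L. ?c (\<lambda>i. col lam i - col mu i) * hl_R q n x (part lam))"
    proof (rule sum.cong[OF refl])
      fix lam assume lam: "lam \<in> ?L"
      let ?r' = "\<lambda>i. col lam i - col mu i"
      obtain N' where N': "N = Suc N'"
        using N by (cases N) auto
      have le: "col mu i \<le> col lam i" "col lam (Suc i) \<le> col mu i" for i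
        using lam by (auto simp: vstrip_def)
      have rN: "?r' N = 0"
        using part_N[OF lam] by (simp add: col_eq_0)
      have M: "?m i - ?r' i + (case i of 0 \<Rightarrow> 0 | Suc i \<Rightarrow> ?r' i) = level_mult n lam i" for i
        using le[of i] lam le[of "i - 1"] by (cases i) auto
      have MN: "level_mult n lam N = ?r' N'"
        using M[of N] mult_N by (simp add: N')
      have lev: "level n lam (Suc N) = 0"
        using part_N[OF lam] by (simp add: col_eq_0)
      have "split_blocks ?m (?r lam) N = split_blocks ?m ?r' N"
        by (rule split_blocks_cong) simp
      also have "\<dots> = replicate (?r' N') N @ blocks (level_mult n lam) N"
        unfolding N' split_blocks_eq_blocks M ..
      also have "\<dots> = blocks (level_mult n lam) (Suc N)"
        using MN by simp
      also have "\<dots> = map (part lam) [0..<n]"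
        using map_part_eq_blocks[of lam n "Suc N"] lam lev by (simp del: blocks.simps)
      finally have "?F (split_blocks ?m (?r lam) N) = ?F (map (part lam) [0..<n])"
        by simp
      also have "\<dots> = hl_R q n x (part lam)"
        by (rule hl_R_cong) simp
      finally show "?c (?r lam) * ?F (split_blocks ?m (?r lam) N) = ?c ?r' * hl_R q n x (part lam)"
        by simp
    qed
  qed
  finally show ?thesis .
qed

lemma finite_psize_eq_conj: "finite {lam. P lam \<and> psize lam = d}"
  by (rule finite_subset[OF _ finite_psize_eq[of d]]) auto

theorem hl_P_pieri:
  assumes q: "0 < q" "q < 1" and inj: "inj_on x {..<n}"
  shows "elem_sym d n x * hl_P q mu n x =
    (\<Sum>lam | vstrip lam mu \<and> psize lam = psize mu + d. pieri_e q lam mu * hl_P q lam n x)"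
proof (cases "col mu 0 \<le> n")
  case True
  let ?L = "{lam. vstrip lam mu \<and> psize lam = psize mu + d}"
  let ?L' = "{lam. vstrip lam mu \<and> psize lam = psize mu + d \<and> col lam 0 \<le> n}"
  \<comment> \<open>One column more than \<open>mu\<close> has, since raising a largest part opens a
    new column.\<close>
  let ?N = "Suc (part mu 0)"
  have "elem_sym d n x * hl_P q mu n x = hl_R q n x (part mu) * elem_sym d n x / hl_v n mu q"
    using True by (simp add: hl_P_eq_hl_R plength_eq_col)
  also have "\<dots> = (\<Sum>lam\<in>?L'. (\<Prod>i<?N. qbinom q (level_mult n mu i) (col lam i - col mu i)) *
      hl_R q n x (part lam) / hl_v n mu q)"
    by (simp only: hl_R_pieri[OF q inj True lessI] sum_divide_distrib)
  also have "\<dots> = (\<Sum>lam\<in>?L'. pieri_e q lam mu * hl_P q lam n x)"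
  proof (rule sum.cong[OF refl])
    fix lam assume lam: "lam \<in> ?L'"
    have "col lam ?N \<le> col mu (part mu 0)"
      using lam by (auto simp: vstrip_def)
    then have "part lam 0 \<le> ?N"
      by (simp add: col_eq_0 flip: col_eq_0_iff)
    then have "(\<Prod>i<?N. qbinom q (level_mult n mu i) (col lam i - col mu i)) * hl_v n lam q = pieri_e q lam mu * hl_v n mu q"
      using lam by (intro hl_v_pieri_e[OF q]) auto
    then have "(\<Prod>i<?N. qbinom q (level_mult n mu i) (col lam i - col mu i)) / hl_v n mu q = pieri_e q lam mu / hl_v n lam q"
      using hl_v_pos[OF q, of n lam] hl_v_pos[OF q, of n mu] by (simp add: divide_simps)
    from arg_cong[OF this, of "\<lambda>z. z * hl_R q n x (part lam)"]
    show "(\<Prod>i<?N. qbinom q (level_mult n mu i) (col lam i - col mu i)) * hl_R q n x (part lam) / hl_v n mu q =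
      pieri_e q lam mu * hl_P q lam n x"
      using lam by (simp add: hl_P_eq_hl_R plength_eq_col)
  qed
  \<comment> \<open>Partitions with more than \<open>n\<close> parts contribute zero, so the range
    of summation can be freed of \<open>n\<close>.\<close>
  also have "\<dots> = (\<Sum>lam\<in>?L. pieri_e q lam mu * hl_P q lam n x)"
    by (rule sum.mono_neutral_left[OF finite_psize_eq_conj]) (auto simp: hl_P_def plength_eq_col)
  finally show ?thesis .
next
  case False
  then have "hl_P q lam n x = 0" if "vstrip lam mu" for lam
    using that unfolding vstrip_def hl_P_def plength_eq_col by (meson le_trans)
  moreover have "hl_P q mu n x = 0"
    using False by (simp add: hl_P_def plength_eq_col)
  ultimately show ?thesis by simp
qed

section \<open>Linear independence\<close>

lemma digits_eq:
  fixes B :: nat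
  assumes "\<And>j. j < n \<Longrightarrow> d j < B" "\<And>j. j < n \<Longrightarrow> e j < B"
    and "(\<Sum>j<n. B ^ j * d j) = (\<Sum>j<n. B ^ j * e j)" "j < n"
  shows "d j = e j"
  using assms
proof (induction n arbitrary: d e j)
  case (Suc n)
  have expand: "(\<Sum>j<Suc n. B ^ j * f j) = f 0 + B * (\<Sum>j<n. B ^ j * f (Suc j))" for f
    unfolding sum.lessThan_Suc_shift sum_distrib_left by (simp add: mult.assoc)
  have eq: "d 0 + B * (\<Sum>j<n. B ^ j * d (Suc j)) = e 0 + B * (\<Sum>j<n. B ^ j * e (Suc j))"
    using Suc.prems(3) unfolding expand .
  have less: "d 0 < B" "e 0 < B"
    using Suc.prems(1,2) by blast+
  have d0: "d 0 = e 0"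
    using arg_cong[OF eq, of "\<lambda>z. z mod B"] less by simp
  then have rest: "(\<Sum>j<n. B ^ j * d (Suc j)) = (\<Sum>j<n. B ^ j * e (Suc j))"
    using eq less by simp
  have "d (Suc i) = e (Suc i)" if "i < n" for i
    by (rule Suc.IH[of "\<lambda>j. d (Suc j)" "\<lambda>j. e (Suc j)", OF _ _ rest that]) (use Suc.prems(1,2) in auto)
  then show ?case
    using d0 Suc.prems(4) by (cases j) auto
qed simp

lemma col_eq_sum_of_bool:
  assumes "col lam 0 \<le> n"
  shows "col lam i = (\<Sum>j<n. of_bool (i < part lam j))"
proof -
  have "{..<n} \<inter> {j. i < part lam j} = {..<col lam i}"
    using col_antimono[of 0 i lam] assms by (auto simp flip: less_col_iff)
  then show ?thesis
    by (simp add: sum_of_bool_eq)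
qed

lemma permuted_parts_determine_partition:
  assumes "col a 0 \<le> n" "col b 0 \<le> n" "u permutes {..<n}" "v permutes {..<n}"
    and eq: "\<And>j. j < n \<Longrightarrow> part a (u j) = part b (v j)"
  shows "a = b"
proof (rule partition_eqI)
  fix i
  have "col a i = (\<Sum>j<n. of_bool (i < part a (u j)))"
    unfolding col_eq_sum_of_bool[OF assms(1)]
    using sum.permute[OF assms(3), of "\<lambda>j. of_bool (i < part a j)"] by (simp add: o_def del: sum_of_bool_eq)
  also have "\<dots> = (\<Sum>j<n. of_bool (i < part b (v j)))"
    using eq by (intro sum.cong) auto
  also have "\<dots> = col b i"
    unfolding col_eq_sum_of_bool[OF assms(2)]
    using sum.permute[OF assms(4), of "\<lambda>j. of_bool (i < part b j)"]
    by (metis (no_types, lifting) o_def sum.cong)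
  finally show "col a i = col b i" .
qed

lemma tendsto_power_quotient_0:
  fixes a b :: nat
  assumes "a < b"
  shows "((\<lambda>s::real. s ^ a / s ^ b) \<longlongrightarrow> 0) at_top"
proof -
  have "((\<lambda>s::real. inverse (s ^ (b - a))) \<longlongrightarrow> 0) at_top"
    using assms by (intro tendsto_inverse_0_at_top filterlim_pow_at_top filterlim_ident) auto
  moreover have "\<forall>\<^sub>F s::real in at_top. inverse (s ^ (b - a)) = s ^ a / s ^ b"
    using eventually_gt_at_top[of 0]
    by eventually_elim (use assms in \<open>simp add: power_diff field_simps\<close>)
  ultimately show ?thesis
    using tendsto_cong by fast
qed

text \<open>What counts later is that both possible limits are positive for positive
  \<open>q\<close>: terms of equal growth cannot cancel.\<close>

lemma tendsto_hl_factor: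
  fixes q :: real and a b :: nat
  assumes "a \<noteq> b"
  shows "((\<lambda>s. (s ^ a - q * s ^ b) / (s ^ a - s ^ b)) \<longlongrightarrow> (if b < a then 1 else q)) at_top"
proof (cases "b < a")
  case True
  have "((\<lambda>s. (1 - q * (s ^ b / s ^ a)) / (1 - s ^ b / s ^ a)) \<longlongrightarrow> (1 - q * 0) / (1 - 0)) at_top"
    using True by (intro tendsto_intros tendsto_power_quotient_0) auto
  moreover have "\<forall>\<^sub>F s in at_top. (1 - q * (s ^ b / s ^ a)) / (1 - s ^ b / s ^ a) =
      (s ^ a - q * s ^ b) / (s ^ a - s ^ b)"
    using eventually_gt_at_top[of 0]
  proof eventually_elim
    case (elim s)
    have "(1 - q * (s ^ b / s ^ a)) = (s ^ a - q * s ^ b) / s ^ a" "1 - s ^ b / s ^ a = (s ^ a - s ^ b) / s ^ a"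
      using elim by (simp_all add: diff_divide_distrib)
    then show ?case using elim by simp
  qed
  ultimately have "((\<lambda>s. (s ^ a - q * s ^ b) / (s ^ a - s ^ b)) \<longlongrightarrow> (1 - q * 0) / (1 - 0)) at_top"
    using tendsto_cong by fast
  then show ?thesis using True by simp
next
  case False
  then have ab: "a < b" using assms by simp
  have "((\<lambda>s. (s ^ a / s ^ b - q) / (s ^ a / s ^ b - 1)) \<longlongrightarrow> (0 - q) / (0 - 1)) at_top"
    using ab by (intro tendsto_intros tendsto_power_quotient_0) auto
  moreover have "\<forall>\<^sub>F s in at_top. (s ^ a / s ^ b - q) / (s ^ a / s ^ b - 1) =
      (s ^ a - q * s ^ b) / (s ^ a - s ^ b)"
    using eventually_gt_at_top[of 0]
  proof eventually_elim
    case (elim s)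
    have "s ^ a / s ^ b - q = (s ^ a - q * s ^ b) / s ^ b" "s ^ a / s ^ b - 1 = (s ^ a - s ^ b) / s ^ b"
      using elim by (simp_all add: diff_divide_distrib)
    then show ?case using elim by simp
  qed
  ultimately have "((\<lambda>s. (s ^ a - q * s ^ b) / (s ^ a - s ^ b)) \<longlongrightarrow> (0 - q) / (0 - 1)) at_top"
    using tendsto_cong by fast
  then show ?thesis using False by simp
qed

text \<open>
  At \<open>x j = s ^ (B ^ j)\<close> with \<open>B\<close> larger than all parts, the order of growth of a term of a
  symmetrisation, as \<open>s\<close> tends to infinity, determines the partition from which it comes.
\<close>

theorem hl_P_independent:
  assumes q: "0 < q" "q < 1" and fin: "finite {lam. c lam \<noteq> 0}"
    and zero: "\<And>n x. inj_on x {..<n} \<Longrightarrow> (\<Sum>lam | c lam \<noteq> 0. c lam * hl_P q lam n x) = 0"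
  shows "c lam = 0"
proof (rule ccontr)
  assume c: "c lam \<noteq> 0"
  define S where "S = {lam. c lam \<noteq> 0}"
  define n where "n = (\<Sum>lam\<in>S. psize lam)"
  \<comment> \<open>The base exceeds all parts in the support, which are at most \<open>n\<close>,
    and is at least 2 even for \<open>n = 0\<close>, so that its powers are distinct.\<close>
  define B where "B = Suc (Suc n)"
  define W where "W = {w. w permutes {..<n}}"
  define A where "A = (\<lambda>(lam, w). \<Sum>i<n. B ^ w i * part lam i)"
  define \<Phi> where "\<Phi> w s = (\<Prod>j<n. \<Prod>i<j. (s ^ (B ^ w i) - q * s ^ (B ^ w j)) / (s ^ (B ^ w i) - s ^ (B ^ w j)))"
    for w and s :: real
  define \<Lambda> where "\<Lambda> w = (\<Prod>j<n. \<Prod>i<j. if B ^ w j < B ^ w i then 1 else q)" for w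
  define m where "m = Max (A ` (S \<times> W))"
  have finS: "finite S" and finW: "finite W" and ne: "S \<times> W \<noteq> {}"
    using fin c permutes_id[of "{..<n}"] unfolding S_def W_def by (auto simp: finite_permutations intro: exI[of _ id])
  have psize_le: "psize lam \<le> n" if "lam \<in> S" for lam
    unfolding n_def using finS that by (intro member_le_sum) auto
  have col_le: "col lam 0 \<le> n" and part_less: "part lam j < B" if "lam \<in> S" for lam j
    using psize_le[OF that] col_0_le_psize[of lam] part_0_le_psize[of lam] part_antimono[of 0 j lam]
    by (auto simp: B_def)
  have A_le: "A z \<le> m" if "z \<in> S \<times> W" for z
    unfolding m_def using that finS finW by (intro Max_ge) auto
  have "m \<in> A ` (S \<times> W)"
    unfolding m_def using finS finW ne by (intro Max_in) auto
  then obtain l0 w0 where l0: "l0 \<in> S" "w0 \<in> W" "A (l0, w0) = m"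
    by auto
  have A_eq: "A (lam, w) = (\<Sum>j<n. B ^ j * part lam (inv w j))" if "w \<in> W" for lam w
  proof -
    have w: "w permutes {..<n}" using that by (simp add: W_def)
    have "(\<Sum>i<n. B ^ w i * part lam i) = (\<Sum>j<n. B ^ w (inv w j) * part lam (inv w j))"
      using sum.permute[OF permutes_inv[OF w], of "\<lambda>i. B ^ w i * part lam i"] by (simp add: o_def)
    then show ?thesis
      unfolding A_def using permutes_inverses[OF w] by simp
  qed
  \<comment> \<open>In base \<open>B\<close> the digits of the exponent are the parts in permuted
    order, and these determine the partition. Several \<open>w\<close> may still attain the maximum
    with \<open>l0\<close>, as equal parts can be exchanged.\<close>
  have uniq: "lam = l0" if "lam \<in> S" "w \<in> W" "A (lam, w) = m" for lam w
  proof (rule permuted_parts_determine_partition)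
    show "col lam 0 \<le> n" "col l0 0 \<le> n"
      using that l0 col_le by auto
    show "inv w permutes {..<n}" "inv w0 permutes {..<n}"
      using that l0 by (auto simp: W_def permutes_inv)
    show "part lam (inv w j) = part l0 (inv w0 j)" if "j < n" for j
      by (rule digits_eq[OF _ _ _ that, of _ B])
         (use part_less \<open>lam \<in> S\<close> l0 A_eq[OF \<open>w \<in> W\<close>] A_eq[OF \<open>w0 \<in> W\<close>] \<open>A (lam, w) = m\<close> in auto)
  qed
  have inj_B: "B ^ i = B ^ j \<longleftrightarrow> i = j" for i j
    by (simp add: B_def)
  have \<Phi>_lim: "(\<Phi> w \<longlongrightarrow> \<Lambda> w) at_top" if "w \<in> W" for w
    unfolding \<Phi>_def \<Lambda>_def
  proof (intro tendsto_prod tendsto_hl_factor)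
    fix j i :: nat assume "i \<in> {..<j}"
    then have "w i \<noteq> w j"
      using permutes_inj[of w "{..<n}"] that by (auto simp: W_def inj_eq)
    then show "B ^ w i \<noteq> B ^ w j" by (simp add: inj_B)
  qed
  have \<Lambda>_pos: "\<Lambda> w > 0" for w
    unfolding \<Lambda>_def using q by (intro prod_pos) auto
  define G where "G s = (\<Sum>lam\<in>S. \<Sum>w\<in>W. c lam / hl_v n lam q * (s ^ A (lam, w) / s ^ m) * \<Phi> w s)" for s :: real
  have lim: "(G \<longlongrightarrow> (\<Sum>lam\<in>S. \<Sum>w\<in>W. c lam / hl_v n lam q * of_bool (A (lam, w) = m) * \<Lambda> w)) at_top"
    unfolding G_def
  proof (intro tendsto_sum tendsto_mult tendsto_const)
    fix lam w assume "lam \<in> S" "w \<in> W"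
    then show "(\<Phi> w \<longlongrightarrow> \<Lambda> w) at_top" by (simp add: \<Phi>_lim)
    show "((\<lambda>s::real. s ^ A (lam, w) / s ^ m) \<longlongrightarrow> of_bool (A (lam, w) = m)) at_top"
    proof (cases "A (lam, w) = m")
      case True
      have "\<forall>\<^sub>F s::real in at_top. s ^ A (lam, w) / s ^ m = 1"
        using eventually_gt_at_top[of 0] by eventually_elim (simp add: True)
      from tendsto_eventually[OF this] show ?thesis
        by (simp only: True of_bool_eq simp_thms)
    next
      case False
      then show ?thesis
        using A_le[of "(lam, w)"] \<open>lam \<in> S\<close> \<open>w \<in> W\<close> tendsto_power_quotient_0[of "A (lam, w)" m] by simp
    qed
  qed
  have G0: "\<forall>\<^sub>F s in at_top. G s = 0"
    using eventually_gt_at_top[of 1]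
  proof eventually_elim
    case (elim s)
    define x where "x j = s ^ (B ^ j)" for j
    have "inj_on x {..<n}"
      using elim by (auto simp: x_def inj_on_def inj_B)
    then have "0 = (\<Sum>lam\<in>S. c lam * hl_P q lam n x)"
      using zero by (simp add: S_def)
    also have "\<dots> = (\<Sum>lam\<in>S. \<Sum>w\<in>W. c lam / hl_v n lam q * s ^ A (lam, w) * \<Phi> w s)"
    proof (rule sum.cong[OF refl])
      fix lam assume "lam \<in> S"
      have "(\<Prod>i<n. x (w i) ^ part lam i) = s ^ A (lam, w)" for w
        by (simp add: x_def A_def power_sum power_mult)
      then show "c lam * hl_P q lam n x = (\<Sum>w\<in>W. c lam / hl_v n lam q * s ^ A (lam, w) * \<Phi> w s)"
        using col_le[OF \<open>lam \<in> S\<close>]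
        by (simp add: hl_P_eq_hl_R plength_eq_col hl_R_def W_def \<Phi>_def x_def sum_distrib_left sum_divide_distrib mult_ac)
    qed
    also have "\<dots> = s ^ m * G s"
      unfolding G_def sum_distrib_left by (intro sum.cong refl) (use elim in simp)
    finally show ?case using elim by simp
  qed
  have "0 = (\<Sum>lam\<in>S. \<Sum>w\<in>W. c lam / hl_v n lam q * of_bool (A (lam, w) = m) * \<Lambda> w)"
    by (rule tendsto_unique[OF trivial_limit_at_top_linorder tendsto_eventually[OF G0] lim])
  also have "(\<Sum>lam\<in>S. \<Sum>w\<in>W. c lam / hl_v n lam q * of_bool (A (lam, w) = m) * \<Lambda> w) =
      (\<Sum>lam\<in>S. if lam = l0 then \<Sum>w\<in>W. c l0 / hl_v n l0 q * of_bool (A (l0, w) = m) * \<Lambda> w else 0)"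
  proof (rule sum.cong[OF refl])
    fix lam assume "lam \<in> S"
    then have "lam \<noteq> l0 \<Longrightarrow> (\<Sum>w\<in>W. c lam / hl_v n lam q * of_bool (A (lam, w) = m) * \<Lambda> w) = 0"
      using uniq by (intro sum.neutral) auto
    then show "(\<Sum>w\<in>W. c lam / hl_v n lam q * of_bool (A (lam, w) = m) * \<Lambda> w) =
      (if lam = l0 then \<Sum>w\<in>W. c l0 / hl_v n l0 q * of_bool (A (l0, w) = m) * \<Lambda> w else 0)"
      by simp
  qed
  also have "\<dots> = c l0 / hl_v n l0 q * (\<Sum>w\<in>W. of_bool (A (l0, w) = m) * \<Lambda> w)"
    using finS l0 by (simp add: sum_distrib_left mult.assoc)
  finally have "(\<Sum>w\<in>W. of_bool (A (l0, w) = m) * \<Lambda> w) = 0"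
    using l0 hl_v_pos[OF q, of n l0] by (simp add: S_def)
  \<comment> \<open>All summands are nonnegative, and the one of \<open>w0\<close> is
    positive.\<close>
  moreover have "(\<Sum>w\<in>W. of_bool (A (l0, w) = m) * \<Lambda> w) > 0"
    by (rule sum_pos2[OF finW, of w0]) (use l0 \<Lambda>_pos in \<open>auto simp: less_imp_le\<close>)
  ultimately show False by simp
qed

section \<open>The case of the empty partition\<close>

text \<open>Partial fractions in \<open>z\<close>: the left side tends to 1 at infinity and has
  simple poles at the \<open>x i\<close>, where the residues are the coefficients on the
  right.\<close>

lemma partial_fraction_hl:
  fixes x :: "nat \<Rightarrow> real"
  assumes "inj_on x {..<n}" "z \<notin> x ` {..<n}"
  shows "(\<Prod>j<n. (z - t * x j) / (z - x j)) =
    1 + (1 - t) * (\<Sum>i<n. x i * (\<Prod>j\<in>{..<n} - {i}. (x i - t * x j) / (x i - x j)) / (z - x i))"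
  using assms
proof (induction n arbitrary: z)
  case (Suc n)
  let ?A = "\<lambda>i. \<Prod>j\<in>{..<n} - {i}. (x i - t * x j) / (x i - x j)"
  let ?A' = "\<lambda>i. \<Prod>j\<in>{..<Suc n} - {i}. (x i - t * x j) / (x i - x j)"
  let ?y = "x n"
  have inj: "inj_on x {..<n}"
    using Suc.prems(1) by (rule inj_on_subset) auto
  have y: "?y \<notin> x ` {..<n}"
    using Suc.prems(1) by (metis imageE inj_onD lessI lessThan_iff less_SucI less_irrefl)
  have z: "z \<notin> x ` {..<n}" "z \<noteq> ?y"
    using Suc.prems(2) by auto
  have A'_n: "?A' n = 1 + (1 - t) * (\<Sum>i<n. x i * ?A i / (?y - x i))"
  proof -
    have "{..<Suc n} - {n} = {..<n}" by auto
    then show ?thesis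
      using Suc.IH[OF inj y] by simp
  qed
  have A'_i: "?A' i = (x i - t * ?y) / (x i - ?y) * ?A i" if "i < n" for i
  proof -
    have "{..<Suc n} - {i} = insert n ({..<n} - {i})" using that by auto
    then show ?thesis by simp
  qed
  have split_term: "a / (z - x i) * ((z - t * ?y) / (z - ?y)) =
      a * ((x i - t * ?y) / (x i - ?y)) / (z - x i) + (1 - t) * ?y / (z - ?y) * (a / (?y - x i))"
    if "i < n" for a i
  proof -
    have ne: "z - x i \<noteq> 0" "z - ?y \<noteq> 0" "x i - ?y \<noteq> 0" "?y - x i \<noteq> 0"
      using z y that by (auto simp: image_iff) (metis lessThan_iff)+
    have neg: "a / (?y - x i) = - (a / (x i - ?y))"
      by (metis minus_diff_eq minus_divide_right)
    show ?thesis
      unfolding neg using ne by (simp add: divide_simps) (simp add: algebra_simps)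
  qed
  have last: "(z - t * ?y) / (z - ?y) = 1 + (1 - t) * ?y / (z - ?y)"
    using z(2) by (simp add: divide_simps) (simp add: algebra_simps)
  have "(\<Prod>j<Suc n. (z - t * x j) / (z - x j)) =
      (1 + (1 - t) * (\<Sum>i<n. x i * ?A i / (z - x i))) * ((z - t * ?y) / (z - ?y))"
    using Suc.IH[OF inj z(1)] by simp
  also have "\<dots> = (z - t * ?y) / (z - ?y) +
      (1 - t) * (\<Sum>i<n. x i * ?A i / (z - x i) * ((z - t * ?y) / (z - ?y)))"
    by (simp only: sum_distrib_right[symmetric] distrib_right mult_1_left mult.assoc)
  also have "(\<Sum>i<n. x i * ?A i / (z - x i) * ((z - t * ?y) / (z - ?y))) =
      (\<Sum>i<n. x i * ?A' i / (z - x i)) + (1 - t) * ?y / (z - ?y) * (\<Sum>i<n. x i * ?A i / (?y - x i))"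
    unfolding sum_distrib_left sum.distrib[symmetric]
  proof (rule sum.cong[OF refl])
    fix i assume "i \<in> {..<n}"
    then have i: "i < n" by simp
    show "x i * ?A i / (z - x i) * ((z - t * ?y) / (z - ?y)) =
      x i * ?A' i / (z - x i) + (1 - t) * ?y / (z - ?y) * (x i * ?A i / (?y - x i))"
      unfolding split_term[OF i] A'_i[OF i] by (simp add: mult_ac)
  qed
  also have "(z - t * ?y) / (z - ?y) + (1 - t) * ((\<Sum>i<n. x i * ?A' i / (z - x i)) +
      (1 - t) * ?y / (z - ?y) * (\<Sum>i<n. x i * ?A i / (?y - x i))) =
      1 + (1 - t) * ((\<Sum>i<n. x i * ?A' i / (z - x i)) + ?y * ?A' n / (z - ?y))"
    unfolding last A'_n by (simp add: algebra_simps add_divide_distrib diff_divide_distrib)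
  finally show ?case
    by (simp only: sum.lessThan_Suc)
qed simp

text \<open>When the variable \<open>x n\<close> is added, each old summand is multiplied by
  \<open>t\<close> and loses a correction. The new summand is the partial fraction expansion at
  \<open>z = x n\<close>, that is, 1 plus exactly the sum of these corrections.\<close>

lemma sum_prod_hl_factors:
  fixes x :: "nat \<Rightarrow> real"
  assumes "inj_on x {..<n}"
  shows "(\<Sum>i<n. \<Prod>j\<in>{..<n} - {i}. (x i - t * x j) / (x i - x j)) = (\<Sum>k<n. t ^ k)"
  using assms
proof (induction n)
  case (Suc n)
  let ?A = "\<lambda>i. \<Prod>j\<in>{..<n} - {i}. (x i - t * x j) / (x i - x j)"
  let ?A' = "\<lambda>i. \<Prod>j\<in>{..<Suc n} - {i}. (x i - t * x j) / (x i - x j)"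
  let ?y = "x n"
  have inj: "inj_on x {..<n}"
    using Suc.prems by (rule inj_on_subset) auto
  have y: "?y \<notin> x ` {..<n}"
    using Suc.prems by (metis imageE inj_onD lessI lessThan_iff less_SucI less_irrefl)
  have "{..<Suc n} - {n} = {..<n}" by auto
  then have A'_n: "?A' n = 1 + (1 - t) * (\<Sum>i<n. x i * ?A i / (?y - x i))"
    using partial_fraction_hl[OF inj y] by simp
  have A'_i: "?A' i = t * ?A i - (1 - t) * (x i * ?A i / (?y - x i))" if "i < n" for i
  proof -
    have "{..<Suc n} - {i} = insert n ({..<n} - {i})" using that by auto
    then have eq: "?A' i = (x i - t * ?y) / (x i - ?y) * ?A i" by simp
    have "x i \<noteq> ?y" using y that by (metis imageI lessThan_iff)
    then have "?y - x i \<noteq> 0" "x i - ?y \<noteq> 0" by auto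
    then have frac: "(x i - t * ?y) / (x i - ?y) = t - (1 - t) * x i / (?y - x i)"
      by (simp add: divide_simps) (simp add: algebra_simps)
    have "(t - u * a / d) * A = t * A - u * (a * A / d)" for u a d A :: real
      by (simp add: left_diff_distrib)
    then show ?thesis
      unfolding eq frac .
  qed
  have "(\<Sum>i<Suc n. ?A' i) = (\<Sum>i<n. t * ?A i - (1 - t) * (x i * ?A i / (?y - x i))) + ?A' n"
    using A'_i by simp
  also have "\<dots> = t * (\<Sum>i<n. ?A i) + 1"
    unfolding A'_n sum_subtractf sum_distrib_left[symmetric] by simp
  also have "\<dots> = (\<Sum>k<Suc n. t ^ k)"
    unfolding Suc.IH[OF inj] sum.lessThan_Suc_shift by (simp add: sum_distrib_left)
  finally show ?case .
qed simp

text \<open>The preceding sum at \<open>1 / t\<close>: each of the \<open>n\<close> factors yields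
  one \<open>t\<close>, and \<open>t^n\<close> reverses the geometric sum.\<close>

lemma sum_prod_hl_factors':
  fixes x :: "nat \<Rightarrow> real"
  assumes "inj_on x {..<Suc n}" "t \<noteq> 0"
  shows "(\<Sum>i<Suc n. \<Prod>j\<in>{..<Suc n} - {i}. (x j - t * x i) / (x j - x i)) = (\<Sum>k<Suc n. t ^ k)"
proof -
  have "(\<Prod>j\<in>{..<Suc n} - {i}. (x j - t * x i) / (x j - x i)) =
    t ^ n * (\<Prod>j\<in>{..<Suc n} - {i}. (x i - (1 / t) * x j) / (x i - x j))" if "i < Suc n" for i
  proof -
    have "(x j - t * x i) / (x j - x i) = t * ((x i - (1 / t) * x j) / (x i - x j))"
      if "j \<in> {..<Suc n} - {i}" for j
    proof -
      have "x j - x i \<noteq> 0" "x i - x j \<noteq> 0"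
        using assms(1) that \<open>i < Suc n\<close> by (auto dest: inj_onD)
      then show ?thesis
        using assms(2) by (simp add: divide_simps) (simp add: algebra_simps)
    qed
    then have "(\<Prod>j\<in>{..<Suc n} - {i}. (x j - t * x i) / (x j - x i)) =
        (\<Prod>j\<in>{..<Suc n} - {i}. t * ((x i - (1 / t) * x j) / (x i - x j)))"
      by (rule prod.cong[OF refl])
    also have "\<dots> = t ^ card ({..<Suc n} - {i}) * (\<Prod>j\<in>{..<Suc n} - {i}. (x i - (1 / t) * x j) / (x i - x j))"
      by (simp only: prod.distrib prod_constant)
    finally show ?thesis using that by simp
  qed
  then have "(\<Sum>i<Suc n. \<Prod>j\<in>{..<Suc n} - {i}. (x j - t * x i) / (x j - x i)) =
      t ^ n * (\<Sum>k<Suc n. (1 / t) ^ k)"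
    unfolding sum_prod_hl_factors[OF assms(1), symmetric] sum_distrib_left by (intro sum.cong) auto
  also have "\<dots> = (\<Sum>k<Suc n. t ^ (Suc n - Suc k))"
    unfolding sum_distrib_left using assms(2)
    by (intro sum.cong refl) (simp add: power_diff power_one_over divide_simps)
  also have "\<dots> = (\<Sum>k<Suc n. t ^ k)"
    by (rule sum.nat_diff_reindex)
  finally show ?thesis .
qed

text \<open>Permutations are sorted by the variable \<open>b\<close> in the last position. The
  factors involving that position give a product depending on \<open>b\<close> only, the others form
  the symmetrisation in the remaining \<open>n\<close> variables, and the sum over \<open>b\<close>
  is the geometric sum just computed.\<close>

lemma hl_R_0:
  assumes q: "0 < q" "q < 1" and "inj_on x {..<n}"
  shows "hl_R q n x (\<lambda>_. 0) = qpoch q q n / (1 - q) ^ n"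
  using assms(3)
proof (induction n arbitrary: x)
  case 0
  show ?case by (simp add: hl_R_def)
next
  case (Suc n)
  let ?\<phi> = "\<lambda>a b. (x a - q * x b) / (x a - x b)"
  let ?\<tau> = "Transposition.transpose n"
  define \<Phi> where "\<Phi> n x w = (\<Prod>j<n. \<Prod>i<j. (x (w i) - q * x (w j)) / (x (w i) - x (w j)))"
    for n and x :: "nat \<Rightarrow> real" and w :: "nat \<Rightarrow> nat"
  have R: "hl_R q n x (\<lambda>_. 0) = (\<Sum>w | w permutes {..<n}. \<Phi> n x w)" for n x
    by (simp add: hl_R_def \<Phi>_def)
  have "hl_R q (Suc n) x (\<lambda>_. 0) =
      (\<Sum>b\<in>insert n {..<n}. \<Sum>w | w permutes {..<n}. \<Phi> (Suc n) x (?\<tau> b \<circ> w))"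
    unfolding R lessThan_Suc by (rule sum_over_permutations_insert) auto
  also have "\<dots> = (\<Sum>b\<in>insert n {..<n}. (\<Prod>j\<in>{..<Suc n} - {b}. ?\<phi> j b) * (qpoch q q n / (1 - q) ^ n))"
  proof (rule sum.cong[OF refl])
    fix b assume b: "b \<in> insert n {..<n}"
    have "\<Phi> (Suc n) x (?\<tau> b \<circ> w) = (\<Prod>j\<in>{..<Suc n} - {b}. ?\<phi> j b) * \<Phi> n (x \<circ> ?\<tau> b) w"
      if w: "w permutes {..<n}" for w
    proof -
      have wn: "w n = n"
        using w by (simp add: permutes_def)
      have "(\<Prod>i<n. ?\<phi> (?\<tau> b (w i)) b) = (\<Prod>i<n. ?\<phi> (?\<tau> b i) b)"
        using prod.permute[OF w, of "\<lambda>i. ?\<phi> (?\<tau> b i) b"] by (simp add: o_def)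
      also have "\<dots> = (\<Prod>j\<in>{..<Suc n} - {b}. ?\<phi> j b)"
      proof (rule prod.reindex_bij_betw)
        show "bij_betw (?\<tau> b) {..<n} ({..<Suc n} - {b})"
          by (rule bij_betw_byWitness[where f' = "?\<tau> b"])
             (use b in \<open>auto simp: Transposition.transpose_def\<close>)
      qed
      finally show ?thesis
        by (simp add: \<Phi>_def wn mult.commute)
    qed
    then have "(\<Sum>w | w permutes {..<n}. \<Phi> (Suc n) x (?\<tau> b \<circ> w)) =
        (\<Prod>j\<in>{..<Suc n} - {b}. ?\<phi> j b) * hl_R q n (x \<circ> ?\<tau> b) (\<lambda>_. 0)"
      unfolding R sum_distrib_left by (intro sum.cong) auto
    moreover have "inj_on (x \<circ> ?\<tau> b) {..<n}"
    proof (rule comp_inj_on)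
      show "inj_on (?\<tau> b) {..<n}"
        by (metis inj_onI transpose_involutory)
      show "inj_on x (?\<tau> b ` {..<n})"
        by (rule inj_on_subset[OF Suc.prems]) (use b in \<open>auto simp: Transposition.transpose_def\<close>)
    qed
    ultimately show "(\<Sum>w | w permutes {..<n}. \<Phi> (Suc n) x (?\<tau> b \<circ> w)) =
        (\<Prod>j\<in>{..<Suc n} - {b}. ?\<phi> j b) * (qpoch q q n / (1 - q) ^ n)"
      by (simp only: Suc.IH)
  qed
  also have "\<dots> = (\<Sum>k<Suc n. q ^ k) * (qpoch q q n / (1 - q) ^ n)"
    unfolding sum_distrib_right[symmetric] lessThan_Suc[symmetric]
    using sum_prod_hl_factors'[OF Suc.prems, of q] q by simp
  also have "(\<Sum>k<Suc n. q ^ k) = (1 - q * q ^ n) / (1 - q)"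
    using q one_diff_power_eq[of q "Suc n"] by (simp add: field_simps)
  also have "\<dots> * (qpoch q q n / (1 - q) ^ n) = qpoch q q (Suc n) / (1 - q) ^ Suc n"
    by (simp add: qpoch_Suc)
  finally show ?case .
qed

lemma ex_partition_empty: "\<exists>lam. \<forall>i. col lam i = 0"
  using ex_partition_col[of "\<lambda>_. 0" 0] by simp

definition empty_partition :: partition where
  "empty_partition = (SOME lam. \<forall>i. col lam i = 0)"

lemma col_empty [simp]: "col empty_partition i = 0"
  unfolding empty_partition_def using someI_ex[OF ex_partition_empty] by blast

lemma part_empty [simp]: "part empty_partition j = 0"
  by (simp add: part_eq_0_iff)

lemma psize_empty [simp]: "psize empty_partition = 0"
  by (simp add: psize_def)

lemma eq_empty_partition_iff: "lam = empty_partition \<longleftrightarrow> col lam 0 = 0"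
proof
  assume "col lam 0 = 0"
  then have "col lam i = 0" for i
    using col_antimono[of 0 i lam] by simp
  then show "lam = empty_partition"
    by (intro partition_eqI) simp
qed simp

lemma hl_P_empty:
  assumes "0 < q" "q < 1" "inj_on x {..<n}"
  shows "hl_P q empty_partition n x = 1"
proof -
  have "hl_R q n x (part empty_partition) = qpoch q q n / (1 - q) ^ n"
    using hl_R_0[OF assms] by (simp cong: hl_R_cong)
  moreover have "hl_v n empty_partition q = qpoch q q n / (1 - q) ^ n"
    by (simp add: hl_v_def plength_eq_col)
  ultimately show ?thesis
    using qpoch_neq_0[OF assms(1,2)] assms(1,2) by (simp add: hl_P_eq_hl_R plength_eq_col)
qed

section \<open>Products\<close>

text \<open>The same coefficients have to serve for every number of variables, which makes this a
  statement about symmetric functions.\<close>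

definition hl_span :: "real \<Rightarrow> nat \<Rightarrow> symfun \<Rightarrow> bool" where
  "hl_span q d F \<longleftrightarrow> (\<exists>c. \<forall>n x. inj_on x {..<n} \<longrightarrow>
     F n x = (\<Sum>lam | psize lam = d. c lam * hl_P q lam n x))"

lemma hl_span_cong:
  assumes "hl_span q d F" "\<And>n x. inj_on x {..<n} \<Longrightarrow> G n x = F n x"
  shows "hl_span q d G"
  using assms unfolding hl_span_def by simp

lemma hl_span_hl_P:
  assumes "psize lam = d"
  shows "hl_span q d (hl_P q lam)"
  unfolding hl_span_def
  by (rule exI[of _ "\<lambda>mu. of_bool (mu = lam)"]) (use assms in \<open>simp add: finite_psize_eq\<close>)

lemma hl_span_diff_sum:
  assumes "hl_span q d F" "\<And>i. i \<in> A \<Longrightarrow> hl_span q d (G i)"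
  shows "hl_span q d (\<lambda>n x. F n x - (\<Sum>i\<in>A. a i * G i n x))"
proof -
  obtain c where c: "inj_on x {..<n} \<Longrightarrow> F n x = (\<Sum>lam | psize lam = d. c lam * hl_P q lam n x)" for n x
    using assms(1) unfolding hl_span_def by blast
  have "\<forall>i\<in>A. \<exists>e. \<forall>n x. inj_on x {..<n} \<longrightarrow> G i n x = (\<Sum>lam | psize lam = d. e lam * hl_P q lam n x)"
    using assms(2) unfolding hl_span_def by blast
  then obtain e where e: "i \<in> A \<Longrightarrow> inj_on x {..<n} \<Longrightarrow>
      G i n x = (\<Sum>lam | psize lam = d. e i lam * hl_P q lam n x)" for i n x
    by metis
  show ?thesis
    unfolding hl_span_def
  proof (intro exI allI impI)
    fix n and x :: "nat \<Rightarrow> real"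
    assume inj: "inj_on x {..<n}"
    have "(\<Sum>i\<in>A. a i * G i n x) = (\<Sum>i\<in>A. \<Sum>lam | psize lam = d. a i * e i lam * hl_P q lam n x)"
      by (rule sum.cong[OF refl]) (simp add: e inj sum_distrib_left mult.assoc)
    also have "\<dots> = (\<Sum>lam | psize lam = d. (\<Sum>i\<in>A. a i * e i lam) * hl_P q lam n x)"
      unfolding sum_distrib_right by (rule sum.swap)
    finally show "F n x - (\<Sum>i\<in>A. a i * G i n x) =
        (\<Sum>lam | psize lam = d. (c lam - (\<Sum>i\<in>A. a i * e i lam)) * hl_P q lam n x)"
      using c[OF inj] by (simp add: left_diff_distrib sum_subtractf)
  qed
qed

lemma sum_psize_conj:
  "(\<Sum>lam | P lam \<and> psize lam = k. f lam) = (\<Sum>lam | psize lam = k. if P lam then f lam else (0::real))"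
  by (rule sum.mono_neutral_cong_left[OF finite_psize_eq]) auto

lemma hl_span_elem_sym:
  assumes q: "0 < q" "q < 1" and F: "hl_span q d F"
  shows "hl_span q (d + r) (\<lambda>n x. elem_sym r n x * F n x)"
proof -
  obtain c where c: "inj_on x {..<n} \<Longrightarrow> F n x = (\<Sum>mu | psize mu = d. c mu * hl_P q mu n x)" for n x
    using F unfolding hl_span_def by blast
  show ?thesis
    unfolding hl_span_def
  proof (intro exI allI impI)
    fix n and x :: "nat \<Rightarrow> real"
    assume inj: "inj_on x {..<n}"
    have "elem_sym r n x * F n x = (\<Sum>mu | psize mu = d. c mu * (elem_sym r n x * hl_P q mu n x))"
      using c[OF inj] by (simp add: sum_distrib_left mult_ac)
    also have "\<dots> = (\<Sum>mu | psize mu = d. \<Sum>lam | psize lam = d + r.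
        c mu * (if vstrip lam mu then pieri_e q lam mu else 0) * hl_P q lam n x)"
    proof (rule sum.cong[OF refl])
      fix mu assume "mu \<in> {mu. psize mu = d}"
      then have "elem_sym r n x * hl_P q mu n x =
          (\<Sum>lam | psize lam = d + r. if vstrip lam mu then pieri_e q lam mu * hl_P q lam n x else 0)"
        using hl_P_pieri[OF q inj, of r mu] by (simp add: sum_psize_conj)
      then show "c mu * (elem_sym r n x * hl_P q mu n x) = (\<Sum>lam | psize lam = d + r.
        c mu * (if vstrip lam mu then pieri_e q lam mu else 0) * hl_P q lam n x)"
        by (simp only: sum_distrib_left) (auto intro: sum.cong)
    qed
    also have "\<dots> = (\<Sum>lam | psize lam = d + r.
        (\<Sum>mu | psize mu = d. c mu * (if vstrip lam mu then pieri_e q lam mu else 0)) * hl_P q lam n x)"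
      unfolding sum_distrib_right by (rule sum.swap)
    finally show "elem_sym r n x * F n x = (\<Sum>lam | psize lam = d + r.
        (\<Sum>mu | psize mu = d. c mu * (if vstrip lam mu then pieri_e q lam mu else 0)) * hl_P q lam n x)" .
  qed
qed

text \<open>
  \<open>\<nu>\<close> is the shortest partition in \<open>e\<^sub>r P\<^sub>\<kappa>\<close>, where \<open>\<kappa>\<close> is \<open>\<nu>\<close> without its first column
  and \<open>r\<close> is the length of that column.
\<close>

theorem hl_span_mult:
  assumes q: "0 < q" "q < 1"
  shows "hl_span q (psize mu + psize nu) (\<lambda>n x. hl_P q mu n x * hl_P q nu n x)"
proof (induction nu rule: wf_induct[OF wf_measures[of "[psize, \<lambda>nu. psize nu - col nu 0]"]])
  case (1 nu)
  show ?case
  proof (cases "nu = empty_partition")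
    case True
    have "hl_span q (psize mu) (hl_P q mu)"
      by (rule hl_span_hl_P) simp
    then show ?thesis
      unfolding True by (simp add: hl_span_cong hl_P_empty[OF q])
  next
    case False
    define r where "r = col nu 0"
    have r: "r > 0"
      using False by (simp add: r_def eq_empty_partition_iff)
    obtain kap where kap: "\<And>i. col kap i = col nu (Suc i)"
      using ex_partition_col[of "\<lambda>i. col nu (Suc i)" "part nu 0"] by (auto simp: col_Suc_le col_eq_0)
    define N where "N = part nu 0 + part kap 0"
    have psize_nu: "psize nu = psize kap + r"
    proof -
      have "psize nu = (\<Sum>i<Suc N. col nu i)"
        by (rule psize_eq_sum_col) (simp add: N_def)
      also have "\<dots> = r + (\<Sum>i<N. col kap i)"
        unfolding sum.lessThan_Suc_shift by (simp add: r_def kap)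
      also have "(\<Sum>i<N. col kap i) = psize kap"
        by (rule psize_eq_sum_col[symmetric]) (simp add: N_def)
      finally show ?thesis by simp
    qed
    define T where "T = {lam. vstrip lam kap \<and> psize lam = psize nu}"
    have finT: "finite T"
      unfolding T_def by (rule finite_psize_eq_conj)
    have nu_T: "nu \<in> T"
      by (simp add: T_def vstrip_def kap col_Suc_le)
    have pieri_e_nu: "pieri_e q nu kap = 1"
      using q by (simp add: pieri_e_def kap)
    \<comment> \<open>From the second column on, \<open>lam\<close> is bounded by \<open>nu\<close>
      because of the strip condition. Were its first column no longer than that of
      \<open>nu\<close>, it would lie inside \<open>nu\<close>, and equal size would force
      equality.\<close>
    have longer: "r < col lam 0" if "lam \<in> T" "lam \<noteq> nu" for lam
    proof (rule ccontr)
      assume "\<not> r < col lam 0"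
      then have le: "col lam i \<le> col nu i" for i
        using that(1) by (cases i) (auto simp: T_def vstrip_def kap r_def)
      let ?N = "part nu 0 + part lam 0"
      have "psize nu = psize lam + (\<Sum>i<?N. col nu i - col lam i)"
        by (rule psize_eq_add_sum_col_diff) (use le in auto)
      then have "\<forall>i<?N. col nu i - col lam i = 0"
        using that(1) by (simp add: T_def)
      then have "col lam i = col nu i" for i
        using le[of i] by (cases "i < ?N") (auto simp: col_eq_0)
      then show False
        using that(2) partition_eqI by blast
    qed
    have kap_less: "(kap, nu) \<in> measures [psize, \<lambda>nu. psize nu - col nu 0]"
      using r by (simp add: psize_nu)
    \<comment> \<open>The other terms have the size of \<open>nu\<close>. The second measure falls
      as the first column grows, and it cannot fall forever because that column is bounded by the
      size.\<close>
    have lam_less: "(lam, nu) \<in> measures [psize, \<lambda>nu. psize nu - col nu 0]" if "lam \<in> T - {nu}" for lam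
    proof -
      have "psize lam = psize nu" "r < col lam 0"
        using that longer by (auto simp: T_def)
      then show ?thesis
        using col_0_le_psize[of lam] by (simp add: r_def)
    qed
    have "hl_span q (psize mu + psize kap) (\<lambda>n x. hl_P q mu n x * hl_P q kap n x)"
      using 1 kap_less by blast
    from hl_span_elem_sym[OF q this, of r]
    have 2: "hl_span q (psize mu + psize nu) (\<lambda>n x. elem_sym r n x * (hl_P q mu n x * hl_P q kap n x))"
      by (simp add: psize_nu add.assoc)
    have 3: "hl_span q (psize mu + psize nu) (\<lambda>n x. hl_P q mu n x * hl_P q lam n x)" if "lam \<in> T - {nu}" for lam
    proof -
      have "psize lam = psize nu" using that by (simp add: T_def)
      moreover have "hl_span q (psize mu + psize lam) (\<lambda>n x. hl_P q mu n x * hl_P q lam n x)"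
        using 1 lam_less[OF that] by blast
      ultimately show ?thesis by (simp only:)
    qed
    have 4: "hl_span q (psize mu + psize nu) (\<lambda>n x. elem_sym r n x * (hl_P q mu n x * hl_P q kap n x) -
        (\<Sum>lam\<in>T - {nu}. pieri_e q lam kap * (hl_P q mu n x * hl_P q lam n x)))"
      by (rule hl_span_diff_sum[where F = "\<lambda>n x. elem_sym r n x * (hl_P q mu n x * hl_P q kap n x)"
          and G = "\<lambda>lam n x. hl_P q mu n x * hl_P q lam n x" and a = "\<lambda>lam. pieri_e q lam kap", OF 2 3])
    show ?thesis
    proof (rule hl_span_cong[OF 4])
      fix n and x :: "nat \<Rightarrow> real"
      assume inj: "inj_on x {..<n}"
      have "elem_sym r n x * hl_P q kap n x = (\<Sum>lam\<in>T. pieri_e q lam kap * hl_P q lam n x)"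
        using hl_P_pieri[OF q inj, of r kap] by (simp add: T_def psize_nu)
      also have "\<dots> = hl_P q nu n x + (\<Sum>lam\<in>T - {nu}. pieri_e q lam kap * hl_P q lam n x)"
        using sum.remove[OF finT nu_T, of "\<lambda>lam. pieri_e q lam kap * hl_P q lam n x"] pieri_e_nu by simp
      finally have nu: "hl_P q nu n x = elem_sym r n x * hl_P q kap n x -
          (\<Sum>lam\<in>T - {nu}. pieri_e q lam kap * hl_P q lam n x)" by simp
      show "hl_P q mu n x * hl_P q nu n x = elem_sym r n x * (hl_P q mu n x * hl_P q kap n x) -
          (\<Sum>lam\<in>T - {nu}. pieri_e q lam kap * (hl_P q mu n x * hl_P q lam n x))"
        unfolding nu by (simp add: right_diff_distrib sum_distrib_left mult_ac)
    qed
  qed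
qed

section \<open>Inversion of the Pieri matrix and complete symmetric functions\<close>

lemma qbinom_sym:
  assumes "k \<le> n"
  shows "qbinom q n (n - k) = qbinom q n k"
  using assms by (simp add: qbinom_def mult.commute)

text \<open>The finite \<open>q\<close>-binomial theorem. The \<open>q\<close>-Pascal rule turns the
  sum for \<open>Suc D\<close> into two sums for \<open>D\<close> at \<open>z q\<close>, with
  coefficients 1 and \<open>- z\<close>, which split off the first factor
  \<open>1 - z\<close>.\<close>

lemma sum_qbinom_eq_qpoch:
  assumes q: "0 < q" "q < 1"
  shows "(\<Sum>j\<le>D. (- z) ^ j * q ^ (j choose 2) * qbinom q D j) = qpoch z q D"
proof (induction D arbitrary: z)
  case 0
  then show ?case using q by (simp add: binomial_eq_0)
next
  case (Suc D)
  define t where "t j = (- z) ^ j * q ^ (j choose 2)" for j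
  have t0: "t 0 = 1"
    by (simp add: t_def binomial_eq_0)
  have tS: "t (Suc j) = - z * ((- (z * q)) ^ j * q ^ (j choose 2))" for j
  proof -
    have "(- (z * q)) ^ j = (- z) ^ j * q ^ j"
      by (metis mult_minus_left power_mult_distrib)
    then show ?thesis
      by (simp add: t_def numeral_2_eq_2 power_add)
  qed
  have tq: "t j * q ^ j = (- (z * q)) ^ j * q ^ (j choose 2)" for j
  proof -
    have "(- (z * q)) ^ j = (- z) ^ j * q ^ j"
      by (metis mult_minus_left power_mult_distrib)
    then show ?thesis
      by (simp add: t_def)
  qed
  have "(\<Sum>j\<le>Suc D. t j * q ^ j * qbinom q D j) = t 0 + (\<Sum>j\<le>D. t (Suc j) * q ^ Suc j * qbinom q D (Suc j))"
    unfolding sum.atMost_Suc_shift using q by simp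
  then have 1: "t 0 + (\<Sum>j\<le>D. t (Suc j) * q ^ Suc j * qbinom q D (Suc j)) = qpoch (z * q) q D"
    using Suc.IH[of "z * q"] unfolding tq by simp
  have 2: "(\<Sum>j\<le>D. t (Suc j) * qbinom q D j) = - z * qpoch (z * q) q D"
    unfolding Suc.IH[of "z * q", symmetric] sum_distrib_left tS by (simp add: mult.assoc)
  have "(\<Sum>j\<le>Suc D. t j * qbinom q (Suc D) j) =
      t 0 + (\<Sum>j\<le>D. t (Suc j) * q ^ Suc j * qbinom q D (Suc j)) + (\<Sum>j\<le>D. t (Suc j) * qbinom q D j)"
    unfolding sum.atMost_Suc_shift using q
    by (simp add: qbinom_Suc_Suc[OF q] sum.distrib distrib_left mult.assoc)
  also have "\<dots> = (1 - z) * qpoch (z * q) q D"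
    unfolding 1 2 by (simp add: algebra_simps)
  also have "\<dots> = qpoch z q (Suc D)"
    by (simp add: qpoch_def prod.lessThan_Suc_shift mult.assoc del: prod.lessThan_Suc)
  finally show ?case
    by (simp add: t_def)
qed

text \<open>The product of the two binomials is \<open>qbinom q K D * qbinom q D s\<close>. What is
  left is the finite \<open>q\<close>-binomial theorem at \<open>z = 1\<close>, where the first
  factor is \<open>1 - 1\<close>.\<close>

lemma alternating_sum_qbinom:
  assumes q: "0 < q" "q < 1" and D: "0 < D" "D \<le> K"
  shows "(\<Sum>s\<le>D. (- 1) ^ s * (q ^ ((D - s) choose 2) * qbinom q (K - s) (D - s)) * qbinom q K s) = 0"
proof -
  have "qbinom q (K - s) (D - s) * qbinom q K s = qbinom q K D * qbinom q D s" if "s \<le> D" for s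
  proof -
    have "K - s - (D - s) = K - D" using that D by simp
    then show ?thesis
      using that D qpoch_neq_0[OF q] by (simp add: qbinom_def)
  qed
  then have "(\<Sum>s\<le>D. (- 1) ^ s * (q ^ ((D - s) choose 2) * qbinom q (K - s) (D - s)) * qbinom q K s) =
      qbinom q K D * (\<Sum>s\<le>D. (- 1) ^ s * q ^ ((D - s) choose 2) * qbinom q D s)"
    unfolding sum_distrib_left by (intro sum.cong) (auto simp: mult_ac)
  also have "(\<Sum>s\<le>D. (- 1) ^ s * q ^ ((D - s) choose 2) * qbinom q D s) =
      (\<Sum>j\<le>D. (- 1) ^ (D - j) * q ^ (j choose 2) * qbinom q D (D - j))"
    by (rule sum.reindex_bij_witness[of _ "\<lambda>j. D - j" "\<lambda>j. D - j"]) auto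
  also have "\<dots> = (- 1) ^ D * (\<Sum>j\<le>D. (- 1) ^ j * q ^ (j choose 2) * qbinom q D j)"
    unfolding sum_distrib_left
    by (intro sum.cong refl)
       (simp add: qbinom_sym power_diff minus_one_power_iff)
  also have "(\<Sum>j\<le>D. (- 1) ^ j * q ^ (j choose 2) * qbinom q D j) = qpoch 1 q D"
    using sum_qbinom_eq_qpoch[OF q, of 1 D] by simp
  also have "qpoch 1 q D = 0"
    unfolding qpoch_def using D by (intro prod_zero) (auto intro!: bexI[of _ 0])
  finally show ?thesis by simp
qed

definition contains :: "partition \<Rightarrow> partition \<Rightarrow> bool" where
  "contains lam mu \<longleftrightarrow> (\<forall>i. col mu i \<le> col lam i)"

text \<open>These are the coefficients of \<open>P\<^sub>\<mu> \<Sum>\<^sub>d h\<^sub>d\<close> in the basis \<open>P\<^sub>\<lambda>\<close>.\<close>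

definition pieri_h :: "real \<Rightarrow> partition \<Rightarrow> partition \<Rightarrow> real" where
  "pieri_h q lam mu = (if contains lam mu then
     (\<Prod>i<part lam 0. q ^ ((col lam i - col mu i) choose 2) *
        qbinom q (col lam i - col mu (Suc i)) (col lam i - col mu i)) else 0)"

lemma containsD: "contains lam mu \<Longrightarrow> col mu i \<le> col lam i"
  by (simp add: contains_def)

lemma contains_part_0: "contains lam mu \<Longrightarrow> part mu 0 \<le> part lam 0"
  using containsD[of lam mu "part lam 0"] col_eq_0_iff[of mu "part lam 0"] by (simp add: col_eq_0)

lemma pieri_h_eq:
  assumes q: "0 < q" "q < 1" and "contains lam mu" "part lam 0 \<le> N"
  shows "pieri_h q lam mu = (\<Prod>i<N. q ^ ((col lam i - col mu i) choose 2) *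
        qbinom q (col lam i - col mu (Suc i)) (col lam i - col mu i))"
proof -
  have "pieri_h q lam mu = (\<Prod>i<part lam 0. q ^ ((col lam i - col mu i) choose 2) *
        qbinom q (col lam i - col mu (Suc i)) (col lam i - col mu i))"
    using assms by (simp add: pieri_h_def)
  also have "\<dots> = (\<Prod>i<N. q ^ ((col lam i - col mu i) choose 2) *
        qbinom q (col lam i - col mu (Suc i)) (col lam i - col mu i))"
    by (rule prod.mono_neutral_left) (use assms in \<open>auto simp: col_eq_0 binomial_eq_0\<close>)
  finally show ?thesis .
qed

lemma psize_contains:
  assumes "contains lam mu" "part lam 0 \<le> N"
  shows "psize lam = psize mu + (\<Sum>i<N. col lam i - col mu i)"
  using psize_eq_add_sum_col_diff[of mu lam N] assms contains_part_0[OF assms(1)] by (simp add: contains_def)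

text \<open>The columns of \<open>nu\<close> can be chosen independently of each other: they
  decrease automatically, as \<open>col lam (Suc i)\<close> lies between
  \<open>col nu (Suc i)\<close> and \<open>col nu i\<close>. A sum over \<open>nu\<close> of
  products over columns is therefore a product of sums.\<close>

lemma bij_betw_interlacing:
  assumes N: "part lam 0 \<le> N" and cont: "contains lam mu"
  shows "bij_betw (\<lambda>nu. restrict (col nu) {..<N}) {nu. vstrip lam nu \<and> contains nu mu}
    (PiE {..<N} (\<lambda>i. {max (col lam (Suc i)) (col mu i)..col lam i}))"
    (is "bij_betw ?r ?U ?V")
  unfolding bij_betw_def
proof
  have zero: "col nu i = 0" if "nu \<in> ?U" "N \<le> i" for nu i
    using that N le_trans[of "part lam 0" N i] by (auto simp: vstrip_def col_eq_0 dest!: spec[of _ i])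
  show "inj_on ?r ?U"
  proof (intro inj_onI partition_eqI)
    fix a b i assume *: "a \<in> ?U" "b \<in> ?U" "?r a = ?r b"
    show "col a i = col b i"
    proof (cases "i < N")
      case True
      then show ?thesis using fun_cong[OF *(3), of i] by simp
    next
      case False
      then show ?thesis using zero[of a i] zero[of b i] * by simp
    qed
  qed
  show "?r ` ?U = ?V"
  proof
    show "?r ` ?U \<subseteq> ?V"
      by (intro image_subsetI restrict_PiE_iff[THEN iffD2]) (auto simp: vstrip_def contains_def)
    show "?V \<subseteq> ?r ` ?U"
    proof
      fix v assume v: "v \<in> ?V"
      define v' where "v' i = (if i < N then v i else 0)" for i
      have mu_0: "col mu i = 0" if "N \<le> i" for i
        using containsD[OF cont, of i] N that by (simp add: col_eq_0)
        have v'_bounds: "col lam (Suc i) \<le> v' i" "col mu i \<le> v' i" "v' i \<le> col lam i" for i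
          using v mu_0 N by (auto simp: v'_def PiE_iff col_eq_0)
        have mono: "v' (Suc i) \<le> v' i" for i
          using v'_bounds(1)[of i] v'_bounds(3)[of "Suc i"] by simp
        have zero: "v' N = 0"
          by (simp add: v'_def)
        obtain nu where nu: "\<And>i. col nu i = v' i"
          using ex_partition_col[where c = v', OF mono zero] by blast
        have "nu \<in> ?U"
          using v'_bounds by (simp add: vstrip_def contains_def nu)
        moreover have "v = ?r nu"
          using v by (auto simp: nu v'_def fun_eq_iff PiE_iff extensional_def)
        ultimately show "v \<in> ?r ` ?U" by blast
    qed
  qed
qed


lemma alternating_sum_pieri:
  assumes q: "0 < q" "q < 1"
  shows "(\<Sum>nu | vstrip lam nu \<and> contains nu mu.
    (- 1) ^ (psize lam - psize nu) * pieri_h q nu mu * pieri_e q lam nu) = of_bool (lam = mu)"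
proof (cases "contains lam mu")
  case False
  then have "{nu. vstrip lam nu \<and> contains nu mu} = {}"
    by (auto simp: vstrip_def contains_def intro: order_trans)
  moreover have "lam \<noteq> mu"
    using False by (auto simp: contains_def)
  ultimately show ?thesis by (simp only: sum.empty of_bool_eq simp_thms)
next
  case True
  let ?N = "part lam 0"
  let ?U = "{nu. vstrip lam nu \<and> contains nu mu}"
  let ?V = "\<lambda>i. {max (col lam (Suc i)) (col mu i)..col lam i}"
  define h where "h i v = (- 1) ^ (col lam i - v) *
      (q ^ ((v - col mu i) choose 2) * qbinom q (v - col mu (Suc i)) (v - col mu i)) *
      qbinom q (col lam i - col lam (Suc i)) (col lam i - v)" for i v
  have "(\<Sum>nu\<in>?U. (- 1) ^ (psize lam - psize nu) * pieri_h q nu mu * pieri_e q lam nu) =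
      (\<Sum>nu\<in>?U. \<Prod>i<?N. h i (restrict (col nu) {..<?N} i))"
  proof (rule sum.cong[OF refl])
    fix nu assume nu: "nu \<in> ?U"
    then have cont: "contains nu mu" "contains lam nu"
      by (auto simp: vstrip_def contains_def)
    have "psize lam - psize nu = (\<Sum>i<?N. col lam i - col nu i)"
      using psize_contains[OF cont(2) order_refl] by simp
    then have "(- 1) ^ (psize lam - psize nu) = (\<Prod>i<?N. (- 1 :: real) ^ (col lam i - col nu i))"
      by (simp add: power_sum)
    then show "(- 1) ^ (psize lam - psize nu) * pieri_h q nu mu * pieri_e q lam nu =
        (\<Prod>i<?N. h i (restrict (col nu) {..<?N} i))"
      using pieri_h_eq[OF q cont(1) contains_part_0[OF cont(2)]]
      by (simp add: h_def pieri_e_def prod.distrib)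
  qed
  also have "\<dots> = (\<Sum>v\<in>PiE {..<?N} ?V. \<Prod>i<?N. h i (v i))"
    by (rule sum.reindex_bij_betw[OF bij_betw_interlacing[OF order_refl True]])
  also have "\<dots> = (\<Prod>i<?N. \<Sum>v\<in>?V i. h i v)"
    by (rule prod_sum_PiE[symmetric]) auto
  also have "\<dots> = of_bool (lam = mu)"
  proof (cases "lam = mu")
    case True
    have "(\<Sum>v\<in>?V i. h i v) = 1" for i
    proof -
      have "?V i = {col lam i}"
        using col_Suc_le[of lam i] by (auto simp: True)
      then show ?thesis
        using q by (simp add: h_def True binomial_eq_0)
    qed
    then show ?thesis using True by simp
  next
    case False
    let ?I = "{i. col mu i < col lam i}"
    have "?I \<noteq> {}"
    proof
      assume "?I = {}"
      then have "col lam i = col mu i" for i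
        using containsD[OF True, of i] by (auto simp: not_less intro: antisym)
      then show False
        using False partition_eqI by blast
    qed
    moreover have I_sub: "?I \<subseteq> {..<?N}"
    proof
      fix i assume "i \<in> ?I"
      then have "col lam i \<noteq> 0" by simp
      then show "i \<in> {..<?N}" by (simp add: col_eq_0_iff)
    qed
    moreover have finI: "finite ?I"
      by (rule finite_subset[OF I_sub]) simp
    ultimately have "Max ?I \<in> ?I"
      by (intro Max_in)
    \<comment> \<open>At the last column where the partitions differ, agreement in the next one
      gives both binomials the same upper index up to the shift by \<open>s\<close>, as in
      \<open>alternating_sum_qbinom\<close>. One vanishing factor suffices.\<close>
    define i where "i = Max ?I"
    have i: "col mu i < col lam i" and "i < ?N"
      using \<open>Max ?I \<in> ?I\<close> I_sub by (auto simp: i_def)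
    have "Suc i \<notin> ?I"
      using Max_ge[OF finI, of "Suc i"] unfolding i_def by (metis not_less_eq_eq order_refl)
    then have eq: "col lam (Suc i) = col mu (Suc i)"
      using containsD[OF True, of "Suc i"] by auto
    let ?D = "col lam i - col mu i" and ?K = "col lam i - col mu (Suc i)"
    have V: "?V i = {col mu i..col lam i}"
      using eq col_Suc_le[of mu i] by (simp add: max_def)
    have "(\<Sum>v\<in>?V i. h i v) = (\<Sum>s\<le>?D. (- 1) ^ s *
        (q ^ ((?D - s) choose 2) * qbinom q (?K - s) (?D - s)) * qbinom q ?K s)"
      unfolding V
    proof (rule sum.reindex_bij_witness[of _ "\<lambda>s. col lam i - s" "\<lambda>v. col lam i - v"])
      fix v assume v: "v \<in> {col mu i..col lam i}"
      have "?D - (col lam i - v) = v - col mu i" "?K - (col lam i - v) = v - col mu (Suc i)"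
        using v col_Suc_le[of mu i] by auto
      then show "(- 1) ^ (col lam i - v) * (q ^ ((?D - (col lam i - v)) choose 2) *
          qbinom q (?K - (col lam i - v)) (?D - (col lam i - v))) * qbinom q ?K (col lam i - v) = h i v"
        by (simp add: h_def eq)
    qed (use i in auto)
    also have "\<dots> = 0"
      by (rule alternating_sum_qbinom[OF q]) (use i col_Suc_le[of mu i] in auto)
    finally have "(\<Prod>i<?N. \<Sum>v\<in>?V i. h i v) = 0"
      using \<open>i < ?N\<close> by (intro prod_zero) auto
    then show ?thesis using False by simp
  qed
  finally show ?thesis .
qed

text \<open>The candidate for \<open>h_d P_mu\<close>, introduced through its expansion. For the
  empty partition it is \<open>h_d\<close> itself, by the relation with the \<open>e_r\<close> that
  follows.\<close>

definition hl_P_times_h :: "real \<Rightarrow> partition \<Rightarrow> nat \<Rightarrow> symfun" where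
  "hl_P_times_h q mu d n x = (\<Sum>lam | psize lam = psize mu + d. pieri_h q lam mu * hl_P q lam n x)"

text \<open>The degree \<open>d\<close> part of \<open>E(-1) H(1) P_mu = P_mu\<close>. Collecting
  all intermediate \<open>nu\<close> of size between \<open>|mu|\<close> and
  \<open>|mu| + d\<close>, the coefficient of \<open>P_lam\<close> is the sum in
  \<open>alternating_sum_pieri\<close>.\<close>

lemma sum_elem_sym_hl_P_times_h:
  assumes q: "0 < q" "q < 1" and inj: "inj_on x {..<n}"
  shows "(\<Sum>r\<le>d. (- 1) ^ r * elem_sym r n x * hl_P_times_h q mu (d - r) n x) = of_bool (d = 0) * hl_P q mu n x"
proof -
  let ?m = "psize mu"
  let ?T = "{nu. ?m \<le> psize nu \<and> psize nu \<le> ?m + d}"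
  let ?L = "{lam. psize lam = ?m + d}"
  have finT: "finite ?T"
    by (rule finite_subset[OF _ finite_psize_le[of "?m + d"]]) auto
  define f where "f nu = (- 1) ^ (?m + d - psize nu) * pieri_h q nu mu *
    (\<Sum>lam\<in>?L. if vstrip lam nu then pieri_e q lam nu * hl_P q lam n x else 0)" for nu
  have "(\<Sum>r\<le>d. (- 1) ^ r * elem_sym r n x * hl_P_times_h q mu (d - r) n x) =
      (\<Sum>r\<le>d. \<Sum>nu | nu \<in> ?T \<and> ?m + d - psize nu = r. f nu)"
  proof (rule sum.cong[OF refl])
    fix r assume "r \<in> {..d}"
    then have r: "r \<le> d" by simp
    have set: "{nu. nu \<in> ?T \<and> ?m + d - psize nu = r} = {nu. psize nu = ?m + (d - r)}"
      using r by auto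
    show "(- 1) ^ r * elem_sym r n x * hl_P_times_h q mu (d - r) n x = (\<Sum>nu | nu \<in> ?T \<and> ?m + d - psize nu = r. f nu)"
      unfolding set hl_P_times_h_def sum_distrib_left
    proof (rule sum.cong[OF refl])
      fix nu assume "nu \<in> {nu. psize nu = ?m + (d - r)}"
      then have nu: "psize nu = ?m + (d - r)" by simp
      have "psize nu + r = ?m + d" "?m + d - psize nu = r"
        using r nu by auto
      then have "f nu = (- 1) ^ r * pieri_h q nu mu * (elem_sym r n x * hl_P q nu n x)"
        using hl_P_pieri[OF q inj, of r nu] by (simp add: f_def sum_psize_conj)
      then show "(- 1) ^ r * elem_sym r n x * (pieri_h q nu mu * hl_P q nu n x) = f nu"
        by simp
    qed
  qed
  also have "\<dots> = (\<Sum>nu\<in>?T. f nu)"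
  proof -
    have "(\<lambda>nu. ?m + d - psize nu) ` ?T \<subseteq> {..d}" by auto
    from sum.group[OF finT finite_atMost this, of f] show ?thesis by simp
  qed
  also have "\<dots> = (\<Sum>nu\<in>?T. \<Sum>lam\<in>?L. (if vstrip lam nu
      then (- 1) ^ (psize lam - psize nu) * pieri_h q nu mu * pieri_e q lam nu else 0) * hl_P q lam n x)"
    unfolding f_def sum_distrib_left by (intro sum.cong refl) simp
  also have "\<dots> = (\<Sum>lam\<in>?L. (\<Sum>nu\<in>?T. if vstrip lam nu
      then (- 1) ^ (psize lam - psize nu) * pieri_h q nu mu * pieri_e q lam nu else 0) * hl_P q lam n x)"
    unfolding sum_distrib_right by (rule sum.swap)
  also have "\<dots> = (\<Sum>lam\<in>?L. of_bool (lam = mu) * hl_P q lam n x)"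
  proof (rule sum.cong[OF refl])
    fix lam assume lam: "lam \<in> ?L"
    have sub: "{nu. vstrip lam nu \<and> contains nu mu} \<subseteq> ?T"
    proof
      fix nu assume "nu \<in> {nu. vstrip lam nu \<and> contains nu mu}"
      then have "contains lam nu" "contains nu mu"
        by (auto simp: vstrip_def contains_def)
      then show "nu \<in> ?T"
        using psize_contains[of lam nu, OF _ order_refl] psize_contains[of nu mu, OF _ order_refl] lam
        by auto
    qed
    have "(\<Sum>nu\<in>?T. if vstrip lam nu
      then (- 1) ^ (psize lam - psize nu) * pieri_h q nu mu * pieri_e q lam nu else 0) =
      (\<Sum>nu | vstrip lam nu \<and> contains nu mu.
        (- 1) ^ (psize lam - psize nu) * pieri_h q nu mu * pieri_e q lam nu)"
      by (rule sum.mono_neutral_cong_right[OF finT sub]) (auto simp: pieri_h_def)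
    then show "(\<Sum>nu\<in>?T. if vstrip lam nu
      then (- 1) ^ (psize lam - psize nu) * pieri_h q nu mu * pieri_e q lam nu else 0) * hl_P q lam n x =
      of_bool (lam = mu) * hl_P q lam n x"
      using alternating_sum_pieri[OF q, of lam mu] by simp
  qed
  also have "\<dots> = of_bool (d = 0) * hl_P q mu n x"
    by (cases "d = 0") (auto simp: finite_psize_eq intro!: sum.neutral)
  finally show ?thesis .
qed

text \<open>The alternating relation is a recursion in \<open>d\<close> with initial value
  \<open>P_mu\<close>. It is linear in that value, which is 1 for the empty partition.\<close>

theorem hl_P_times_h_eq_mult:
  assumes q: "0 < q" "q < 1" and inj: "inj_on x {..<n}"
  shows "hl_P_times_h q mu d n x = hl_P q mu n x * hl_P_times_h q empty_partition d n x"
proof (induction d rule: less_induct)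
  case (less d)
  have split: "{..d} = insert 0 {1..d}" by auto
  have rec: "hl_P_times_h q mu d n x = of_bool (d = 0) * hl_P q mu n x -
      (\<Sum>r\<in>{1..d}. (- 1) ^ r * elem_sym r n x * hl_P_times_h q mu (d - r) n x)" for mu
    using sum_elem_sym_hl_P_times_h[OF q inj, where mu = mu and d = d] unfolding split by simp
  define Y where "Y = (\<Sum>r\<in>{1..d}. (- 1) ^ r * elem_sym r n x * hl_P_times_h q empty_partition (d - r) n x)"
  have Y: "(\<Sum>r\<in>{1..d}. (- 1) ^ r * elem_sym r n x * hl_P_times_h q mu (d - r) n x) = hl_P q mu n x * Y"
    unfolding sum_distrib_left Y_def
  proof (rule sum.cong[OF refl])
    fix r assume "r \<in> {1..d}"
    then have "hl_P_times_h q mu (d - r) n x = hl_P q mu n x * hl_P_times_h q empty_partition (d - r) n x"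
      by (intro less.IH) auto
    then show "(- 1) ^ r * elem_sym r n x * hl_P_times_h q mu (d - r) n x =
      hl_P q mu n x * ((- 1) ^ r * elem_sym r n x * hl_P_times_h q empty_partition (d - r) n x)"
      by simp
  qed
  show ?case
    unfolding rec[of mu] rec[of empty_partition] hl_P_empty[OF q inj] Y Y_def[symmetric]
    by (simp add: right_diff_distrib)
qed

lemma pieri_h_empty:
  assumes q: "0 < q" "q < 1"
  shows "pieri_h q lam empty_partition = q ^ pstat lam"
proof -
  have "pieri_h q lam empty_partition = (\<Prod>i<part lam 0. q ^ (col lam i choose 2))"
    using q by (simp add: pieri_h_def contains_def)
  also have "\<dots> = q ^ pstat lam"
    by (simp only: pstat_eq_sum_col[OF order_refl] power_sum)
  finally show ?thesis .
qed

section \<open>Principal specialisation and counting surjections\<close>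

lemma hl_b_pos:
  assumes "0 < q" "q < 1"
  shows "hl_b q lam > 0"
  unfolding hl_b_def using assms by (intro prod_pos) (simp add: qpoch_pos)

section \<open>Structure constants\<close>

definition hl_expansion :: "real \<Rightarrow> partition \<Rightarrow> partition \<Rightarrow> (partition \<Rightarrow> real) \<Rightarrow> bool" where
  "hl_expansion q mu nu c \<longleftrightarrow> finite {lam. c lam \<noteq> 0} \<and> (\<forall>n x. inj_on x {..<n} \<longrightarrow>
     hl_Q q mu n x * hl_Q q nu n x = (\<Sum>lam | c lam \<noteq> 0. c lam * hl_Q q lam n x))"

text \<open>Existence comes from \<open>hl_span_mult\<close> after rescaling by the
  \<open>b_lam\<close>, and this solution is homogeneous. Uniqueness comes from
  \<open>hl_P_independent\<close>, applied to the difference of two solutions.\<close>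

lemma hl_expansion_ex1:
  assumes q: "0 < q" "q < 1"
  shows "\<exists>!c. hl_expansion q mu nu c"
    and "\<exists>c. hl_expansion q mu nu c \<and> (\<forall>lam. c lam \<noteq> 0 \<longrightarrow> psize lam = psize mu + psize nu)"
proof -
  let ?d = "psize mu + psize nu"
  obtain c where c: "inj_on x {..<n} \<Longrightarrow> hl_P q mu n x * hl_P q nu n x = (\<Sum>lam | psize lam = ?d. c lam * hl_P q lam n x)" for n x
    using hl_span_mult[OF q, of mu nu] unfolding hl_span_def by blast
  define e where "e lam = (if psize lam = ?d then hl_b q mu * hl_b q nu * c lam / hl_b q lam else 0)" for lam
  have sub: "{lam. e lam \<noteq> 0} \<subseteq> {lam. psize lam = ?d}"
    by (auto simp: e_def)
  have Pe: "hl_expansion q mu nu e"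
    unfolding hl_expansion_def
  proof (intro conjI allI impI)
    show "finite {lam. e lam \<noteq> 0}"
      by (rule finite_subset[OF sub finite_psize_eq])
    fix n and x :: "nat \<Rightarrow> real" assume inj: "inj_on x {..<n}"
    have "hl_Q q mu n x * hl_Q q nu n x = hl_b q mu * hl_b q nu * (hl_P q mu n x * hl_P q nu n x)"
      by (simp add: hl_Q_def)
    also have "\<dots> = (\<Sum>lam | psize lam = ?d. e lam * hl_Q q lam n x)"
      unfolding c[OF inj] sum_distrib_left
      by (rule sum.cong[OF refl]) (use hl_b_pos[OF q] in \<open>simp add: e_def hl_Q_def less_imp_neq[symmetric]\<close>)
    also have "\<dots> = (\<Sum>lam | e lam \<noteq> 0. e lam * hl_Q q lam n x)"
      by (rule sum.mono_neutral_right[OF finite_psize_eq sub]) auto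
    finally show "hl_Q q mu n x * hl_Q q nu n x = (\<Sum>lam | e lam \<noteq> 0. e lam * hl_Q q lam n x)" .
  qed
  show "\<exists>c. hl_expansion q mu nu c \<and> (\<forall>lam. c lam \<noteq> 0 \<longrightarrow> psize lam = psize mu + psize nu)"
    using Pe sub by blast
  show "\<exists>!c. hl_expansion q mu nu c"
  proof (rule ex1I[where a = e and P = "hl_expansion q mu nu", OF Pe])
    fix f assume Pf: "hl_expansion q mu nu f"
    have "f lam = e lam" for lam
    proof -
      define g where "g lam = (f lam - e lam) * hl_b q lam" for lam
      let ?A = "{lam. f lam \<noteq> 0} \<union> {lam. e lam \<noteq> 0}"
      have finA: "finite ?A"
        using Pf Pe unfolding hl_expansion_def by blast
      have subg: "{lam. g lam \<noteq> 0} \<subseteq> ?A"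
        by (auto simp: g_def)
      have "g lam = 0"
      proof (rule hl_P_independent[OF q])
        show "finite {lam. g lam \<noteq> 0}"
          by (rule finite_subset[OF subg finA])
        fix n and x :: "nat \<Rightarrow> real" assume inj: "inj_on x {..<n}"
        have extend: "(\<Sum>lam | h lam \<noteq> 0. h lam * hl_Q q lam n x) = (\<Sum>lam\<in>?A. h lam * hl_Q q lam n x)"
          if "{lam. h lam \<noteq> 0} \<subseteq> ?A" for h
          by (rule sum.mono_neutral_left[OF finA that]) auto
        have "(\<Sum>lam | g lam \<noteq> 0. g lam * hl_P q lam n x) = (\<Sum>lam\<in>?A. g lam * hl_P q lam n x)"
          by (rule sum.mono_neutral_left[OF finA subg]) auto
        also have "\<dots> = (\<Sum>lam\<in>?A. f lam * hl_Q q lam n x) - (\<Sum>lam\<in>?A. e lam * hl_Q q lam n x)"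
          unfolding sum_subtractf[symmetric]
          by (rule sum.cong[OF refl]) (simp add: g_def hl_Q_def algebra_simps)
        also have "\<dots> = hl_Q q mu n x * hl_Q q nu n x - hl_Q q mu n x * hl_Q q nu n x"
        proof -
          have "(\<Sum>lam\<in>?A. f lam * hl_Q q lam n x) = hl_Q q mu n x * hl_Q q nu n x"
            unfolding extend[of f, OF Un_upper1, symmetric] using Pf inj unfolding hl_expansion_def by metis
          moreover have "(\<Sum>lam\<in>?A. e lam * hl_Q q lam n x) = hl_Q q mu n x * hl_Q q nu n x"
            unfolding extend[of e, OF Un_upper2, symmetric] using Pe inj unfolding hl_expansion_def by metis
          ultimately show ?thesis by (simp only:)
        qed
        finally show "(\<Sum>lam | g lam \<noteq> 0. g lam * hl_P q lam n x) = 0"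
          by simp
      qed
      then show ?thesis
        using hl_b_pos[OF q, of lam] by (simp add: g_def)
    qed
    then show "f = e" ..
  qed
qed

lemma
  assumes q: "0 < q" "q < 1"
  shows hl_Q_mult: "inj_on x {..<n} \<Longrightarrow> hl_Q q mu n x * hl_Q q nu n x =
      (\<Sum>lam | psize lam = psize mu + psize nu. hl_g q mu nu lam * hl_Q q lam n x)"
    and hl_g_psize: "hl_g q mu nu lam \<noteq> 0 \<Longrightarrow> psize lam = psize mu + psize nu"
proof -
  have "hl_g q mu nu = (THE c. hl_expansion q mu nu c)"
    by (simp only: hl_g_def hl_expansion_def)
  then have g: "hl_expansion q mu nu (hl_g q mu nu)"
    using theI'[OF hl_expansion_ex1(1)[OF q]] by simp
  then have size: "\<forall>lam. hl_g q mu nu lam \<noteq> 0 \<longrightarrow> psize lam = psize mu + psize nu"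
    using hl_expansion_ex1[OF q, of mu nu] by blast
  then show "hl_g q mu nu lam \<noteq> 0 \<Longrightarrow> psize lam = psize mu + psize nu"
    by blast
  assume inj: "inj_on x {..<n}"
  have "hl_Q q mu n x * hl_Q q nu n x = (\<Sum>lam | hl_g q mu nu lam \<noteq> 0. hl_g q mu nu lam * hl_Q q lam n x)"
    using g inj unfolding hl_expansion_def by blast
  also have "\<dots> = (\<Sum>lam | psize lam = psize mu + psize nu. hl_g q mu nu lam * hl_Q q lam n x)"
    by (rule sum.mono_neutral_left[OF finite_psize_eq]) (use size in auto)
  finally show "hl_Q q mu n x * hl_Q q nu n x =
      (\<Sum>lam | psize lam = psize mu + psize nu. hl_g q mu nu lam * hl_Q q lam n x)" .
qed

text \<open>Two expansions of \<open>Q_mu h_d\<close> are compared: one writes \<open>h_d\<close> as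
  the sum of \<open>q^n(nu) Q_nu / b_nu\<close> and multiplies with the structure constants, the
  other uses the Pieri rule.\<close>

lemma sum_hl_g_eq_sk:
  assumes q: "0 < q" "q < 1" and lam: "psize lam = psize mu + d"
  shows "(\<Sum>nu | psize nu = d. q ^ pstat nu * hl_g q mu nu lam / hl_b q nu) = pieri_h q lam mu * hl_b q mu / hl_b q lam"
proof -
  let ?L = "{lam. psize lam = psize mu + d}"
  \<comment> \<open>The coefficient of \<open>P_lam\<close> in the difference of the two expansions,
    cut off outside the relevant degree to have finite support.\<close>
  define e where "e lam = (if psize lam = psize mu + d then
    (\<Sum>nu | psize nu = d. q ^ pstat nu * hl_g q mu nu lam / hl_b q nu) * hl_b q lam - pieri_h q lam mu * hl_b q mu else 0)" for lam
  have sub: "{lam. e lam \<noteq> 0} \<subseteq> ?L"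
    by (auto simp: e_def)
  have b_ne: "hl_b q lam \<noteq> 0" for lam
    using hl_b_pos[OF q, of lam] by simp
  have "e lam = 0"
  proof (rule hl_P_independent[OF q])
    show "finite {lam. e lam \<noteq> 0}"
      by (rule finite_subset[OF sub finite_psize_eq])
    fix n and x :: "nat \<Rightarrow> real" assume inj: "inj_on x {..<n}"
    have "(\<Sum>lam | e lam \<noteq> 0. e lam * hl_P q lam n x) = (\<Sum>lam\<in>?L. e lam * hl_P q lam n x)"
      by (rule sum.mono_neutral_left[OF finite_psize_eq sub]) auto
    also have "\<dots> = (\<Sum>lam\<in>?L. \<Sum>nu | psize nu = d. q ^ pstat nu / hl_b q nu * (hl_g q mu nu lam * hl_Q q lam n x)) -
        hl_b q mu * (\<Sum>lam\<in>?L. pieri_h q lam mu * hl_P q lam n x)"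
      unfolding sum_distrib_left[of "hl_b q mu"] sum_subtractf[symmetric]
    proof (rule sum.cong[OF refl])
      fix lam assume lam: "lam \<in> ?L"
      have "(\<Sum>nu | psize nu = d. q ^ pstat nu / hl_b q nu * (hl_g q mu nu lam * hl_Q q lam n x)) =
          (\<Sum>nu | psize nu = d. q ^ pstat nu * hl_g q mu nu lam / hl_b q nu) * hl_Q q lam n x"
        unfolding sum_distrib_right by (rule sum.cong) auto
      then show "e lam * hl_P q lam n x =
          (\<Sum>nu | psize nu = d. q ^ pstat nu / hl_b q nu * (hl_g q mu nu lam * hl_Q q lam n x)) -
          hl_b q mu * (pieri_h q lam mu * hl_P q lam n x)"
        using lam by (simp add: e_def hl_Q_def left_diff_distrib)
    qed
    also have "(\<Sum>lam\<in>?L. \<Sum>nu | psize nu = d. q ^ pstat nu / hl_b q nu * (hl_g q mu nu lam * hl_Q q lam n x)) =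
        (\<Sum>nu | psize nu = d. q ^ pstat nu / hl_b q nu * (hl_Q q mu n x * hl_Q q nu n x))"
      unfolding sum.swap[of _ _ ?L]
    proof (rule sum.cong[OF refl])
      fix nu assume "nu \<in> {nu. psize nu = d}"
      then have "hl_Q q mu n x * hl_Q q nu n x = (\<Sum>lam\<in>?L. hl_g q mu nu lam * hl_Q q lam n x)"
        using hl_Q_mult[OF q inj, of mu nu] by simp
      then show "(\<Sum>lam\<in>?L. q ^ pstat nu / hl_b q nu * (hl_g q mu nu lam * hl_Q q lam n x)) =
          q ^ pstat nu / hl_b q nu * (hl_Q q mu n x * hl_Q q nu n x)"
        by (simp only: sum_distrib_left)
    qed
    also have "\<dots> = hl_b q mu * (hl_P q mu n x * hl_P_times_h q empty_partition d n x)"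
      unfolding hl_P_times_h_def sum_distrib_left
      by (simp add: pieri_h_empty[OF q] hl_Q_def b_ne mult_ac)
    also have "hl_P q mu n x * hl_P_times_h q empty_partition d n x = (\<Sum>lam\<in>?L. pieri_h q lam mu * hl_P q lam n x)"
      using hl_P_times_h_eq_mult[OF q inj, of mu d] by (simp only: hl_P_times_h_def)
    finally show "(\<Sum>lam | e lam \<noteq> 0. e lam * hl_P q lam n x) = 0"
      by simp
  qed
  then show ?thesis
    using lam b_ne[of lam] by (simp add: e_def field_simps)
qed

text \<open>
  At a geometric progression of ratio \<open>q\<close> the factor \<open>x\<^sub>i - q x\<^sub>j\<close> vanishes for \<open>x\<^sub>i = q x\<^sub>j\<close>,
  so only the identity permutation contributes.
\<close>

lemma hl_R_geometric:
  assumes q: "0 < q" "q < 1" and a: "a \<noteq> 0"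
  shows "hl_R q n (\<lambda>i. a * q ^ i) \<kappa> = (\<Prod>i<n. (a * q ^ i) ^ \<kappa> i) * (qpoch q q n / (1 - q) ^ n)"
proof -
  let ?x = "\<lambda>i. a * q ^ i"
  let ?\<Phi> = "\<lambda>w. \<Prod>j<n. \<Prod>i<j. (?x (w i) - q * ?x (w j)) / (?x (w i) - ?x (w j))"
  have zero: "?\<Phi> w = 0" if w: "w permutes {..<n}" and ne: "w \<noteq> id" for w
  proof (rule ccontr)
    assume nz: "?\<Phi> w \<noteq> 0"
    \<comment> \<open>A nonvanishing term never has the value \<open>m + 1\<close> in front of
      \<open>m\<close>, so the inverse permutation is increasing.\<close>
    have no_descent: "w i \<noteq> Suc (w j)" if "i < j" "j < n" for i j
    proof
      assume "w i = Suc (w j)"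
      then have "(?x (w i) - q * ?x (w j)) / (?x (w i) - ?x (w j)) = 0" by simp
      then have "(\<Prod>i<j. (?x (w i) - q * ?x (w j)) / (?x (w i) - ?x (w j))) = 0"
        using that(1) by (intro prod_zero) auto
      then have "?\<Phi> w = 0"
        using that(2) by (intro prod_zero) auto
      then show False using nz by simp
    qed
    define u where "u = inv w"
    have u: "u permutes {..<n}" and wu: "w (u m) = m" for m
      using w by (auto simp: u_def permutes_inv permutes_inverses)
    have step: "u m < u (Suc m)" if "Suc m < n" for m
    proof (rule ccontr)
      assume "\<not> u m < u (Suc m)"
      moreover have "u m \<noteq> u (Suc m)"
        using permutes_inj[OF u] by (simp add: inj_eq)
      moreover have "u m < n"
        using permutes_in_image[OF u, of m] that by simp
      ultimately show False
        using no_descent[of "u (Suc m)" "u m"] wu by auto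
    qed
    have "m < n \<Longrightarrow> m \<le> u m" for m
    proof (induction m)
      case (Suc m)
      then show ?case using step[of m] by simp
    qed simp
    then have "u = id"
      using permutes_natset_ge[OF u] by simp
    then show False
      using ne wu by (auto simp: fun_eq_iff)
  qed
  \<comment> \<open>Read backwards from \<open>i = j - 1\<close>, the factors are
    \<open>(1 - q^(i+2)) / (1 - q^(i+1))\<close> and telescope.\<close>
  have tele: "(\<Prod>i<j. (?x i - q * ?x j) / (?x i - ?x j)) = (1 - q * q ^ j) / (1 - q)" for j
  proof -
    have q_ne: "1 - q * q ^ i \<noteq> 0" for i
      using power_Suc_less_1[OF q, of i] by simp
    have "(?x (j - Suc i) - q * ?x j) / (?x (j - Suc i) - ?x j) = (1 - q * q ^ Suc i) / (1 - q * q ^ i)" if "i < j" for i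
    proof -
      have j: "?x j = ?x (j - Suc i) * (q * q ^ i)"
        using that by (simp flip: power_Suc power_add)
      have nz: "?x (j - Suc i) \<noteq> 0"
        using a q by simp
      have eqs: "?x (j - Suc i) - q * ?x j = ?x (j - Suc i) * (1 - q * q ^ Suc i)"
        "?x (j - Suc i) - ?x j = ?x (j - Suc i) * (1 - q * q ^ i)"
        unfolding j by (simp_all add: algebra_simps)
      show ?thesis
        unfolding eqs by (rule mult_divide_mult_cancel_left[OF nz])
    qed
    then have "(\<Prod>i<j. (?x (j - Suc i) - q * ?x j) / (?x (j - Suc i) - ?x j)) = (\<Prod>i<j. (1 - q * q ^ Suc i) / (1 - q * q ^ i))"
      by (intro prod.cong) auto
    also have "\<dots> = (1 - q * q ^ j) / (1 - q)"
    proof (induction j)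
      case 0
      then show ?case using q by simp
    next
      case (Suc j)
      show ?case unfolding prod.lessThan_Suc Suc.IH using q_ne[of j] by simp
    qed
    also have "(\<Prod>i<j. (?x (j - Suc i) - q * ?x j) / (?x (j - Suc i) - ?x j)) =
        (\<Prod>i<j. (?x i - q * ?x j) / (?x i - ?x j))"
      by (rule prod.nat_diff_reindex)
    finally show ?thesis .
  qed
  have id: "?\<Phi> id = qpoch q q n / (1 - q) ^ n"
    unfolding id_apply tele by (simp add: qpoch_def prod_dividef)
  have "hl_R q n ?x \<kappa> = (\<Sum>w\<in>{id}. (\<Prod>i<n. ?x (w i) ^ \<kappa> i) * ?\<Phi> w)"
    unfolding hl_R_def
    by (rule sum.mono_neutral_right) (auto simp: finite_permutations permutes_id zero)
  then show ?thesis
    using id by simp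
qed

lemma hl_v_eq_qpoch:
  assumes q: "0 < q" "q < 1" and n: "col lam 0 \<le> n"
  shows "hl_v n lam q = qpoch q q (n - col lam 0) * hl_b q lam / (1 - q) ^ n"
proof -
  let ?N = "part lam 0"
  have "(\<Sum>i<Suc ?N. level_mult n lam i) = n"
    using sum_mult[OF n, of "Suc ?N"] by (simp add: col_eq_0)
  then have "(\<Prod>i<Suc ?N. (1 - q) ^ level_mult n lam i) = (1 - q) ^ n"
    by (simp only: power_sum[symmetric])
  moreover have "(\<Prod>i<Suc ?N. qpoch q q (level_mult n lam i)) = qpoch q q (n - col lam 0) * hl_b q lam"
    unfolding prod.lessThan_Suc_shift by (simp add: hl_b_eq[OF order_refl])
  ultimately show ?thesis
    using hl_v_eq[OF order_refl n, of q]
    by (simp only: lessThan_Suc_atMost[symmetric] prod_dividef)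
qed

lemma hl_P_geometric:
  assumes q: "0 < q" "q < 1" and a: "a \<noteq> 0" and n: "col lam 0 \<le> n"
  shows "hl_P q lam n (\<lambda>i. a * q ^ i) =
    a ^ psize lam * q ^ pstat lam / hl_b q lam * (qpoch q q n / qpoch q q (n - col lam 0))"
proof -
  have "(\<Prod>i<n. (a * q ^ i) ^ part lam i) = (\<Prod>i<n. a ^ part lam i * q ^ (i * part lam i))"
    by (simp add: power_mult_distrib power_mult)
  also have "\<dots> = a ^ psize lam * q ^ pstat lam"
    by (simp add: prod.distrib power_sum[symmetric] psize_eq_sum_part[OF n] pstat_eq_sum_part[OF n])
  finally show ?thesis
    using n q by (simp add: hl_P_eq_hl_R plength_eq_col hl_R_geometric[OF q a] hl_v_eq_qpoch[OF q n])
qed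

section \<open>Passage to infinitely many variables\<close>

lemma convergent_prod_qpoch:
  fixes q x :: real
  assumes "\<bar>q\<bar> < 1"
  shows "convergent_prod (\<lambda>i. 1 - x * q ^ i)"
proof -
  have "summable (\<lambda>i. norm (x * q ^ i))"
    using assms by (simp add: abs_mult power_abs summable_geometric)
  then have "summable (\<lambda>i. norm ((1 - x * q ^ i) - 1))"
    by simp
  then have "abs_convergent_prod (\<lambda>i. 1 - x * q ^ i)"
    by (simp only: abs_convergent_prod_conv_summable)
  then show ?thesis
    by (rule abs_convergent_prod_imp_convergent_prod)
qed

lemma qpoch_tendsto:
  assumes "\<bar>q\<bar> < 1"
  shows "qpoch x q \<longlonglongrightarrow> qpoch_inf x q"
proof -
  have "(\<lambda>n. \<Prod>i\<le>n. 1 - x * q ^ i) \<longlonglongrightarrow> qpoch_inf x q"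
    unfolding qpoch_inf_def by (rule convergent_prod_LIMSEQ[OF convergent_prod_qpoch[OF assms]])
  then have "(\<lambda>n. qpoch x q (Suc n)) \<longlonglongrightarrow> qpoch_inf x q"
    by (simp only: qpoch_def lessThan_Suc_atMost)
  then show ?thesis
    by (rule LIMSEQ_imp_Suc)
qed

lemma qpoch_inf_neq_0:
  assumes "\<bar>q\<bar> < 1" "\<And>i. x * q ^ i \<noteq> 1"
  shows "qpoch_inf x q \<noteq> 0"
  unfolding qpoch_inf_def using assms(2) by (intro prodinf_nonzero convergent_prod_qpoch assms(1)) auto

text \<open>The number of variables enters only through a ratio of two finite products with the same
  nonzero limit. The shift by \<open>col lam 0\<close> avoids the truncated difference and the
  initial values that are zero by definition.\<close>

lemma hl_P_geometric_tendsto: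
  assumes q: "0 < q" "q < 1" and a: "a \<noteq> 0"
  shows "(\<lambda>n. hl_P q lam n (\<lambda>i. a * q ^ i)) \<longlonglongrightarrow> a ^ psize lam * q ^ pstat lam / hl_b q lam"
proof -
  let ?c = "a ^ psize lam * q ^ pstat lam / hl_b q lam"
  have "q * q ^ i \<noteq> 1" for i
    using power_Suc_less_1[OF q, of i] by simp
  then have ne: "qpoch_inf q q \<noteq> 0"
    using q by (intro qpoch_inf_neq_0) auto
  have lim: "qpoch q q \<longlonglongrightarrow> qpoch_inf q q"
    using q by (intro qpoch_tendsto) auto
  have "(\<lambda>n. qpoch q q (n + col lam 0) / qpoch q q n) \<longlonglongrightarrow> qpoch_inf q q / qpoch_inf q q"
    using lim LIMSEQ_ignore_initial_segment[OF lim] ne by (intro tendsto_divide)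
  then have "(\<lambda>n. ?c * (qpoch q q (n + col lam 0) / qpoch q q n)) \<longlonglongrightarrow> ?c * 1"
    using ne by (intro tendsto_mult tendsto_const) simp
  then have "(\<lambda>n. hl_P q lam (n + col lam 0) (\<lambda>i. a * q ^ i)) \<longlonglongrightarrow> ?c"
    by (simp add: hl_P_geometric[OF q a])
  then show ?thesis
    by (rule LIMSEQ_offset)
qed

lemma specialize_hl_P:
  assumes q: "0 < q" "q < 1"
  shows "specialize (hl_P q lam) (\<lambda>i. q ^ (i + 1)) = q ^ psize lam * q ^ pstat lam / hl_b q lam"
  unfolding specialize_def using hl_P_geometric_tendsto[OF q, of q lam] q by (intro limI) simp

lemma specialize_hl_Q:
  assumes q: "0 < q" "q < 1"
  shows "specialize (hl_Q q lam) (\<lambda>i. q ^ i) = q ^ pstat lam"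
proof -
  have "(\<lambda>n. hl_b q lam * hl_P q lam n (\<lambda>i. 1 * q ^ i)) \<longlonglongrightarrow> hl_b q lam * (1 ^ psize lam * q ^ pstat lam / hl_b q lam)"
    by (intro tendsto_mult tendsto_const hl_P_geometric_tendsto[OF q]) simp
  then show ?thesis
    unfolding specialize_def hl_Q_def using hl_b_pos[OF q, of lam] by (intro limI) simp
qed

lemma pieri_h_eq_0: "psize lam < psize mu \<Longrightarrow> pieri_h q lam mu = 0"
  using psize_contains[of lam mu, OF _ order_refl] by (auto simp: pieri_h_def)

text \<open>All \<open>nu\<close> that occur have the same size, so a power of \<open>q\<close>
  comes out and the sum of \<open>sum_hl_g_eq_sk\<close> remains. If \<open>mu\<close> is larger
  than \<open>lam\<close>, the difference of sizes is truncated, but then both sides are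
  zero.\<close>

lemma specialize_hl_skewP:
  assumes q: "0 < q" "q < 1"
  shows "specialize (hl_skewP q lam mu) (\<lambda>i. q ^ (i + 1)) =
    q ^ (psize lam - psize mu) * (pieri_h q lam mu * hl_b q mu / hl_b q lam)"
proof -
  let ?d = "psize lam - psize mu"
  let ?G = "{nu. hl_g q mu nu lam \<noteq> 0}"
  have G: "?G \<subseteq> {nu. psize nu = ?d}"
    using hl_g_psize[OF q] by fastforce
  have "(\<lambda>n. hl_skewP q lam mu n (\<lambda>i. q * q ^ i)) \<longlonglongrightarrow>
      (\<Sum>nu\<in>?G. hl_g q mu nu lam * (q ^ psize nu * q ^ pstat nu / hl_b q nu))"
    unfolding hl_skewP_def using q
    by (intro tendsto_sum tendsto_mult tendsto_const hl_P_geometric_tendsto) auto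
  then have "specialize (hl_skewP q lam mu) (\<lambda>i. q ^ (i + 1)) =
      (\<Sum>nu\<in>?G. hl_g q mu nu lam * (q ^ psize nu * q ^ pstat nu / hl_b q nu))"
    unfolding specialize_def by (intro limI) simp
  also have "\<dots> = (\<Sum>nu | psize nu = ?d. hl_g q mu nu lam * (q ^ psize nu * q ^ pstat nu / hl_b q nu))"
    by (rule sum.mono_neutral_left[OF finite_psize_eq G]) auto
  also have "\<dots> = q ^ ?d * (\<Sum>nu | psize nu = ?d. q ^ pstat nu * hl_g q mu nu lam / hl_b q nu)"
    unfolding sum_distrib_left by (rule sum.cong) (auto simp: mult_ac)
  also have "(\<Sum>nu | psize nu = ?d. q ^ pstat nu * hl_g q mu nu lam / hl_b q nu) =
      pieri_h q lam mu * hl_b q mu / hl_b q lam"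
  proof (cases "psize mu \<le> psize lam")
    case True
    then show ?thesis by (intro sum_hl_g_eq_sk[OF q]) simp
  next
    case False
    then have "hl_g q mu nu lam = 0" for nu
      using hl_g_psize[OF q, of mu nu lam] by fastforce
    then show ?thesis
      using False by (simp add: pieri_h_eq_0)
  qed
  finally show ?thesis .
qed

text \<open>The factors \<open>b_lam\<close> and \<open>q^|lam|\<close> cancel between the skew
  value and \<open>P_lam\<close>. Thus \<open>lam\<close> survives only in the Pieri coefficient and
  in \<open>q^n(lam)\<close>, which the measure will cancel.\<close>

theorem sur_eq:
  assumes "p > 1"
  defines "q \<equiv> 1 / p"
  shows "sur p lam mu = pieri_h q lam mu * hl_b q mu / (q ^ psize mu * q ^ pstat mu * q ^ pstat lam)"
proof -
  have q: "0 < q" "q < 1"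
    using assms by (simp_all add: q_def)
  have sur: "sur p lam mu = q ^ (psize lam - psize mu) * (pieri_h q lam mu * hl_b q mu / hl_b q lam) /
     (q ^ psize lam * q ^ pstat lam / hl_b q lam * q ^ pstat mu)"
    unfolding sur_def Let_def q_def[symmetric] specialize_hl_P[OF q] specialize_hl_Q[OF q] specialize_hl_skewP[OF q] ..
  show ?thesis
  proof (cases "psize mu \<le> psize lam")
    case True
    then have "q ^ psize lam = q ^ psize mu * q ^ (psize lam - psize mu)"
      by (simp flip: power_add)
    then show ?thesis
      unfolding sur using q hl_b_pos[OF q, of lam] by (simp add: field_simps)
  next
    case False
    then show ?thesis
      unfolding sur by (simp add: pieri_h_eq_0)
  qed
qed

section \<open>Summation over partitions column by column\<close>

definition fps_dilate :: "real \<Rightarrow> real fps \<Rightarrow> real fps" where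
  "fps_dilate q f = Abs_fps (\<lambda>n. q ^ n * fps_nth f n)"

lemma fps_dilate_mult: "fps_dilate q (f * g) = fps_dilate q f * fps_dilate q g"
proof (rule fps_ext)
  fix n
  have "(\<Sum>i = 0..n. q ^ n * (fps_nth f i * fps_nth g (n - i))) =
      (\<Sum>i = 0..n. (q ^ i * fps_nth f i) * (q ^ (n - i) * fps_nth g (n - i)))"
  proof (rule sum.cong[OF refl])
    fix i assume "i \<in> {0..n}"
    then show "q ^ n * (fps_nth f i * fps_nth g (n - i)) = (q ^ i * fps_nth f i) * (q ^ (n - i) * fps_nth g (n - i))"
      using power_add[of q i "n - i"] by simp
  qed
  then show "fps_nth (fps_dilate q (f * g)) n = fps_nth (fps_dilate q f * fps_dilate q g) n"
    by (simp add: fps_dilate_def fps_mult_nth sum_distrib_left)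
qed

text \<open>
  Both factors of the Cauchy product \<open>C(z)\<close> satisfy a functional equation relating \<open>z\<close> and \<open>qz\<close>,
  and these combine to \<open>(1 - z) C(z) = C(qz)\<close>.
\<close>

lemma sum_qpoch_half:
  assumes q: "0 < q" "q < 1"
  shows "(\<Sum>d\<le>N. q ^ (Suc d choose 2) / (qpoch q q d * qpoch (q ^ 2) (q ^ 2) ((N - d) div 2))) = 1 / qpoch q q N"
proof -
  define a where "a d = q ^ (Suc d choose 2) / qpoch q q d" for d
  define b where "b n = 1 / qpoch (q ^ 2) (q ^ 2) (n div 2)" for n
  have q2: "0 < q ^ 2" "q ^ 2 < 1"
    using q by (simp_all add: power_less_one_iff)
  define A where "A = Abs_fps a"
  define B where "B = Abs_fps b"
  have pw: "1 - q * q ^ n \<noteq> 0" for n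
    using power_Suc_less_1[OF q, of n] by simp
  have a_rec: "a (Suc d) * (1 - q ^ Suc d) = q ^ Suc d * a d" for d
    using pw[of d] qpoch_neq_0[OF q, of d]
    by (simp add: a_def qpoch_Suc numeral_2_eq_2 power_add divide_simps)
  \<comment> \<open>The coefficients \<open>b\<close> agree in pairs,
    \<open>b (2 m) = b (2 m + 1)\<close>, so the two parities are treated separately.\<close>
  have b_rec: "b (Suc (Suc n)) - (1 - q) * b (Suc n) - q * b n = q ^ Suc (Suc n) * b (Suc (Suc n))" for n
  proof -
    have half: "b (Suc (Suc n)) * (1 - (q ^ 2) ^ Suc (n div 2)) = b n" for n
    proof -
      have "qpoch (q ^ 2) (q ^ 2) (Suc (Suc n) div 2) = qpoch (q ^ 2) (q ^ 2) (n div 2) * (1 - (q ^ 2) ^ Suc (n div 2))"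
        by (simp add: qpoch_Suc)
      moreover have "1 - (q ^ 2) ^ Suc (n div 2) \<noteq> 0"
        using power_Suc_less_1[OF q2, of "n div 2"] by simp
      ultimately show ?thesis
        unfolding b_def by (simp del: power_Suc)
    qed
    show ?thesis
    proof (cases "even n")
      case True
      then obtain m where m: "n = 2 * m"
        by (auto elim: evenE)
      have "b (Suc n) = b n" "(q ^ 2) ^ Suc (n div 2) = q ^ Suc (Suc n)"
        by (simp_all add: b_def m power_mult power2_eq_square)
      then show ?thesis
        using half[of n] by (simp add: algebra_simps)
    next
      case False
      then obtain m where m: "n = Suc (2 * m)"
        by (auto elim: oddE)
      have 1: "b (Suc (Suc n)) = b (Suc n)" and "b (Suc n) = b (Suc (Suc (2 * m)))" "b n = b (2 * m)"
        "(q ^ 2) ^ Suc (2 * m div 2) = q ^ Suc n"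
        by (simp_all add: b_def m power_mult power2_eq_square)
      then have 2: "b n = b (Suc n) * (1 - q ^ Suc n)"
        using half[of "2 * m"] by (simp only:)
      show ?thesis
        unfolding 1 2 by (simp add: algebra_simps)
    qed
  qed
  have b1: "b 0 = 1" "b (Suc 0) = 1"
    by (simp_all add: b_def)
  have A_eq: "A = (1 + fps_const q * fps_X) * fps_dilate q A"
  proof (rule fps_ext)
    fix n
    show "fps_nth A n = fps_nth ((1 + fps_const q * fps_X) * fps_dilate q A) n"
      using a_rec[of "n - 1"]
      by (cases n) (simp_all add: A_def fps_dilate_def distrib_right mult.assoc algebra_simps)
  qed
  \<comment> \<open>As an infinite product, \<open>B(z)\<close> is \<open>1 + z\<close> divided by
    all \<open>1 - z^2 q^(2 i)\<close>, \<open>i >= 0\<close>. Passing to \<open>q z\<close> removes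
    the factor \<open>1 - z^2\<close> from the denominator and replaces \<open>1 + z\<close> by
    \<open>1 + q z\<close>.\<close>
  have B_eq: "(1 - fps_X) * (1 + fps_const q * fps_X) * B = fps_dilate q B"
  proof (rule fps_ext)
    fix n
    have expand: "(1 - fps_X) * (1 + fps_const q * fps_X) * B =
        B - fps_const (1 - q) * (fps_X * B) - fps_const q * (fps_X * (fps_X * B))"
      by (simp add: algebra_simps flip: fps_const_sub)
    consider "n = 0" | "n = Suc 0" | m where "n = Suc (Suc m)"
      by (metis not0_implies_Suc)
    then show "fps_nth ((1 - fps_X) * (1 + fps_const q * fps_X) * B) n = fps_nth (fps_dilate q B) n"
      unfolding expand using b_rec[of "n - 2"] b1
      by cases (simp_all add: B_def fps_dilate_def)
  qed
  define C where "C = A * B"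
  have "(1 + fps_const q * fps_X) * ((1 - fps_X) * C) = A * fps_dilate q B"
    unfolding C_def B_eq[symmetric] by (simp only: mult_ac)
  also have "\<dots> = (1 + fps_const q * fps_X) * fps_dilate q C"
    unfolding C_def fps_dilate_mult by (subst A_eq) (simp only: mult_ac)
  finally have "(1 + fps_const q * fps_X) * ((1 - fps_X) * C) = (1 + fps_const q * fps_X) * fps_dilate q C" .
  moreover have "1 + fps_const q * fps_X \<noteq> 0"
  proof
    assume "1 + fps_const q * fps_X = 0"
    from arg_cong[OF this, of "\<lambda>f. fps_nth f 0"] show False by simp
  qed
  ultimately have C_eq: "(1 - fps_X) * C = fps_dilate q C"
    by simp
  have C_rec: "fps_nth C (Suc n) * (1 - q ^ Suc n) = fps_nth C n" for n
    using arg_cong[OF C_eq, of "\<lambda>f. fps_nth f (Suc n)"]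
    by (simp add: fps_dilate_def left_diff_distrib algebra_simps)
  have "fps_nth C N = 1 / qpoch q q N"
  proof (induction N)
    case 0
    then show ?case by (simp add: C_def A_def B_def a_def b_def binomial_eq_0)
  next
    case (Suc N)
    have "fps_nth C (Suc N) = fps_nth C N / (1 - q ^ Suc N)"
      using C_rec[of N] pw[of N] by (simp add: eq_divide_eq)
    then show ?case
      by (simp add: Suc.IH qpoch_Suc)
  qed
  then show ?thesis
    by (simp add: C_def A_def B_def a_def b_def fps_mult_nth atMost_atLeast0)
qed

section \<open>Removing and adding the first column\<close>

definition drop_column :: "partition \<Rightarrow> partition" where
  "drop_column lam = (SOME nu. \<forall>i. col nu i = col lam (Suc i))"

lemma col_drop_column [simp]: "col (drop_column lam) i = col lam (Suc i)"
proof -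
  have "\<exists>nu. \<forall>i. col nu i = col lam (Suc i)"
    by (rule ex_partition_col[of _ "part lam 0"]) (simp_all add: col_Suc_le col_eq_0)
  then show ?thesis
    unfolding drop_column_def using someI_ex[of "\<lambda>nu. \<forall>i. col nu i = col lam (Suc i)"] by blast
qed

lemma part_0_drop_column: "part (drop_column lam) 0 \<le> part lam 0 - 1"
  unfolding col_eq_0_iff[symmetric] by (cases "part lam 0") (simp_all add: col_eq_0)

definition add_column :: "nat \<Rightarrow> partition \<Rightarrow> partition" where
  "add_column c lam = (SOME nu. \<forall>i. col nu i = (case i of 0 \<Rightarrow> c | Suc i \<Rightarrow> col lam i))"

lemma col_add_column:
  assumes "col lam 0 \<le> c"
  shows "col (add_column c lam) i = (case i of 0 \<Rightarrow> c | Suc i \<Rightarrow> col lam i)"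
proof -
  have "\<exists>nu. \<forall>i. col nu i = (case i of 0 \<Rightarrow> c | Suc i \<Rightarrow> col lam i)"
    by (rule ex_partition_col[of _ "Suc (part lam 0)"])
       (use assms in \<open>auto simp: col_Suc_le col_eq_0 split: nat.split\<close>)
  then show ?thesis
    unfolding add_column_def
    using someI_ex[of "\<lambda>nu. \<forall>i. col nu i = (case i of 0 \<Rightarrow> c | Suc i \<Rightarrow> col lam i)"] by blast
qed

text \<open>The number \<open>N\<close> is the room that a preceding column leaves above the first
  column of \<open>mu\<close>.\<close>

definition containing :: "partition \<Rightarrow> nat \<Rightarrow> partition set" where
  "containing mu N = {lam. contains lam mu \<and> col lam 0 \<le> col mu 0 + N}"

text \<open>A first column of length \<open>col mu 0 + d\<close> leaves the remaining columns free
  to contain those of \<open>mu\<close>, as long as they are not longer than it. Measured from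
  \<open>col mu 1\<close>, this is the room \<open>col mu 0 - col mu 1 + d\<close>.\<close>

lemma bij_betw_split_first_column:
  "bij_betw (\<lambda>lam. (col lam 0 - col mu 0, drop_column lam)) {lam. contains lam mu \<and> col lam 0 - col mu 0 \<in> D}
     (Sigma D (\<lambda>d. containing (drop_column mu) (col mu 0 - col mu 1 + d)))"
proof (rule bij_betw_byWitness[where f' = "\<lambda>(d, lam). add_column (col mu 0 + d) lam"])
  let ?A = "{lam. contains lam mu \<and> col lam 0 - col mu 0 \<in> D}"
  let ?B = "Sigma D (\<lambda>d. containing (drop_column mu) (col mu 0 - col mu 1 + d))"
  have le: "col mu 1 \<le> col mu 0"
    using col_Suc_le[of mu 0] by simp
  show "\<forall>lam\<in>?A. (\<lambda>(d, lam). add_column (col mu 0 + d) lam) (col lam 0 - col mu 0, drop_column lam) = lam"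
  proof
    fix lam assume "lam \<in> ?A"
    then have "col mu 0 \<le> col lam 0" by (simp add: contains_def)
    then have "col (add_column (col mu 0 + (col lam 0 - col mu 0)) (drop_column lam)) i = col lam i" for i
      using col_Suc_le[of lam 0] by (subst col_add_column) (auto split: nat.split)
    then show "(\<lambda>(d, lam). add_column (col mu 0 + d) lam) (col lam 0 - col mu 0, drop_column lam) = lam"
      by (auto intro: partition_eqI)
  qed
  have pc: "col (add_column (col mu 0 + d) lam) i = (case i of 0 \<Rightarrow> col mu 0 + d | Suc i \<Rightarrow> col lam i)"
    if "(d, lam) \<in> ?B" for d lam i
    by (rule col_add_column) (use that le in \<open>auto simp: containing_def\<close>)
  show "\<forall>z\<in>?B. (\<lambda>lam. (col lam 0 - col mu 0, drop_column lam)) ((\<lambda>(d, lam). add_column (col mu 0 + d) lam) z) = z"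
  proof
    fix z assume z: "z \<in> ?B"
    obtain d lam where dl: "z = (d, lam)" by (cases z)
    have "drop_column (add_column (col mu 0 + d) lam) = lam"
      by (rule partition_eqI) (use pc[of d lam] z dl in simp)
    then show "(\<lambda>lam. (col lam 0 - col mu 0, drop_column lam)) ((\<lambda>(d, lam). add_column (col mu 0 + d) lam) z) = z"
      using pc[of d lam 0] z dl by simp
  qed
  show "(\<lambda>lam. (col lam 0 - col mu 0, drop_column lam)) ` ?A \<subseteq> ?B"
  proof (rule image_subsetI)
    fix lam assume lam: "lam \<in> ?A"
    then have "col mu i \<le> col lam i" for i
      by (simp add: contains_def)
    then have "contains (drop_column lam) (drop_column mu)" "col mu 0 \<le> col lam 0"
      by (simp_all add: contains_def)
    then show "(col lam 0 - col mu 0, drop_column lam) \<in> ?B"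
      using lam le col_Suc_le[of lam 0] by (simp add: containing_def)
  qed
  show "(\<lambda>(d, lam). add_column (col mu 0 + d) lam) ` ?B \<subseteq> ?A"
  proof (rule image_subsetI)
    fix z assume z: "z \<in> ?B"
    obtain d lam where dl: "z = (d, lam)" by (cases z)
    have "contains lam (drop_column mu)"
      using z dl by (simp add: containing_def)
    then have "contains (add_column (col mu 0 + d) lam) mu"
      using pc[of d lam] z dl unfolding contains_def by (auto split: nat.split)
    then show "(\<lambda>(d, lam). add_column (col mu 0 + d) lam) z \<in> ?A"
      using pc[of d lam 0] z dl by simp
  qed
qed

text \<open>Up to a factor independent of \<open>lam\<close>, this is the product of
  \<open>PSym_inf\<close> and \<open>sur\<close>; see \<open>PSym_inf_mult_sur\<close>.\<close>

definition sur_weight :: "real \<Rightarrow> partition \<Rightarrow> partition \<Rightarrow> real" where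
  "sur_weight q mu lam = (if contains lam mu then
     (\<Prod>i<part lam 0. q ^ (Suc (col lam i - col mu i) choose 2) * qpoch q q (col lam i - col mu (Suc i)) /
        (qpoch q q (col lam i - col mu i) * qpoch (q ^ 2) (q ^ 2) ((col lam i - col lam (Suc i)) div 2))) else 0)"

lemma sur_weight_eq:
  assumes "contains lam mu" "part lam 0 \<le> N"
  shows "sur_weight q mu lam = (\<Prod>i<N. q ^ (Suc (col lam i - col mu i) choose 2) * qpoch q q (col lam i - col mu (Suc i)) /
        (qpoch q q (col lam i - col mu i) * qpoch (q ^ 2) (q ^ 2) ((col lam i - col lam (Suc i)) div 2)))"
proof -
  have "sur_weight q mu lam = (\<Prod>i<part lam 0. q ^ (Suc (col lam i - col mu i) choose 2) * qpoch q q (col lam i - col mu (Suc i)) /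
        (qpoch q q (col lam i - col mu i) * qpoch (q ^ 2) (q ^ 2) ((col lam i - col lam (Suc i)) div 2)))"
    using assms by (simp add: sur_weight_def)
  also have "\<dots> = (\<Prod>i<N. q ^ (Suc (col lam i - col mu i) choose 2) * qpoch q q (col lam i - col mu (Suc i)) /
        (qpoch q q (col lam i - col mu i) * qpoch (q ^ 2) (q ^ 2) ((col lam i - col lam (Suc i)) div 2)))"
    by (rule prod.mono_neutral_left) (use assms in \<open>auto simp: col_eq_0 binomial_eq_0\<close>)
  finally show ?thesis .
qed

lemma qpoch_sq_pos:
  assumes "0 < q" "q < (1::real)"
  shows "qpoch (q ^ 2) (q ^ 2) n > 0"
  using assms by (intro qpoch_pos) (auto simp: power_less_one_iff)

lemma sur_weight_nonneg:
  assumes "0 < q" "q < 1"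
  shows "sur_weight q mu lam \<ge> 0"
  unfolding sur_weight_def using assms
  by (auto intro!: prod_nonneg mult_nonneg_nonneg divide_nonneg_nonneg
      simp: less_imp_le[OF qpoch_pos[OF assms]] less_imp_le[OF qpoch_sq_pos[OF assms]])

lemma sur_weight_split:
  assumes "contains lam mu"
  defines "d \<equiv> col lam 0 - col mu 0" and "m \<equiv> col mu 0 - col mu 1"
  shows "sur_weight q mu lam = q ^ (Suc d choose 2) * qpoch q q (m + d) / qpoch q q d *
    (sur_weight q (drop_column mu) (drop_column lam) / qpoch (q ^ 2) (q ^ 2) ((m + d - (col (drop_column lam) 0 - col (drop_column mu) 0)) div 2))"
proof -
  have c: "col mu i \<le> col lam i" for i
    using assms by (simp add: contains_def)
  have "contains (drop_column lam) (drop_column mu)"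
    using c by (simp add: contains_def)
  moreover have "part (drop_column lam) 0 \<le> part lam 0"
    using part_0_drop_column[of lam] by simp
  ultimately have tl: "sur_weight q (drop_column mu) (drop_column lam) =
      (\<Prod>i<part lam 0. q ^ (Suc (col lam (Suc i) - col mu (Suc i)) choose 2) * qpoch q q (col lam (Suc i) - col mu (Suc (Suc i))) /
        (qpoch q q (col lam (Suc i) - col mu (Suc i)) * qpoch (q ^ 2) (q ^ 2) ((col lam (Suc i) - col lam (Suc (Suc i))) div 2)))"
    by (simp add: sur_weight_eq[of _ _ "part lam 0"])
  have e1: "m + d = col lam 0 - col mu (Suc 0)"
    using c[of 0] col_Suc_le[of mu 0] by (simp add: m_def d_def)
  have e2: "m + d - (col (drop_column lam) 0 - col (drop_column mu) 0) = col lam 0 - col lam (Suc 0)"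
    unfolding e1 using c[of "Suc 0"] col_Suc_le[of lam 0] by simp
  show ?thesis
    unfolding e2 unfolding e1 unfolding tl d_def sur_weight_eq[OF assms(1) le_SucI[OF order_refl]] prod.lessThan_Suc_shift
    by simp
qed

text \<open>
  The contribution of everything after a column of length \<open>col mu 0 + N\<close>; the denominator
  belongs to that column but depends on the next one, the first column of \<open>lam\<close>.
\<close>

definition tail_weight :: "real \<Rightarrow> partition \<Rightarrow> nat \<Rightarrow> partition \<Rightarrow> real" where
  "tail_weight q mu N lam = sur_weight q mu lam / qpoch (q ^ 2) (q ^ 2) ((N - (col lam 0 - col mu 0)) div 2)"

lemma tail_weight_nonneg: "0 < q \<Longrightarrow> q < 1 \<Longrightarrow> tail_weight q mu N lam \<ge> 0"
  unfolding tail_weight_def by (intro divide_nonneg_nonneg sur_weight_nonneg less_imp_le[OF qpoch_sq_pos])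

text \<open>The numerator \<open>(q;q)\<close> of index \<open>col mu 0 - col mu 1 + d\<close> is
  going to cancel the total weight of all later columns, after which nothing depends on
  \<open>mu\<close> any more.\<close>

definition column_weight :: "real \<Rightarrow> partition \<Rightarrow> nat \<Rightarrow> real" where
  "column_weight q mu d = q ^ (Suc d choose 2) * qpoch q q (col mu 0 - col mu 1 + d) / qpoch q q d"

lemma column_weight_nonneg: "0 < q \<Longrightarrow> q < 1 \<Longrightarrow> column_weight q mu d \<ge> 0"
  unfolding column_weight_def by (auto intro!: mult_nonneg_nonneg divide_nonneg_nonneg simp: less_imp_le[OF qpoch_pos])

lemma sur_weight_eq_column_weight_tail_weight:
  assumes "contains lam mu"
  shows "sur_weight q mu lam = column_weight q mu (col lam 0 - col mu 0) *
    tail_weight q (drop_column mu) (col mu 0 - col mu 1 + (col lam 0 - col mu 0)) (drop_column lam)"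
  using sur_weight_split[OF assms, of q] by (simp add: column_weight_def tail_weight_def)

lemma containing_eq: "containing mu N = {lam. contains lam mu \<and> col lam 0 - col mu 0 \<in> {..N}}"
  by (auto simp: containing_def)

text \<open>Summation over all later columns before the first one. As \<open>f\<close> may change
  sign, the interchange rests on absolute summability, where the nonnegative weights leave only
  \<open>f\<close> to be replaced by its absolute value.\<close>

lemma has_sum_split_first_column:
  fixes f g :: "nat \<Rightarrow> real"
  assumes q: "0 < q" "q < 1"
    and tail: "\<And>d. d \<in> D \<Longrightarrow>
      (tail_weight q (drop_column mu) (col mu 0 - col mu 1 + d) has_sum g d) (containing (drop_column mu) (col mu 0 - col mu 1 + d))"
    and summable: "(\<lambda>d. \<bar>f d\<bar> * column_weight q mu d * g d) summable_on D"
    and S: "((\<lambda>d. f d * column_weight q mu d * g d) has_sum S) D"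
  shows "((\<lambda>lam. f (col lam 0 - col mu 0) * sur_weight q mu lam) has_sum S) {lam. contains lam mu \<and> col lam 0 - col mu 0 \<in> D}"
proof -
  let ?m = "col mu 0 - col mu 1"
  let ?B = "\<lambda>d. containing (drop_column mu) (?m + d)"
  let ?F = "\<lambda>z. f (fst z) * column_weight q mu (fst z) * tail_weight q (drop_column mu) (?m + fst z) (snd z)"
  let ?G = "\<lambda>z. \<bar>f (fst z)\<bar> * column_weight q mu (fst z) * tail_weight q (drop_column mu) (?m + fst z) (snd z)"
  have "?G summable_on Sigma D ?B"
  proof (rule summable_on_SigmaI[OF _ summable])
    fix d assume "d \<in> D"
    from has_sum_cmult_right[OF tail[OF this], of "\<bar>f d\<bar> * column_weight q mu d"]
    show "((\<lambda>l. ?G (d, l)) has_sum \<bar>f d\<bar> * column_weight q mu d * g d) (?B d)" by simp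
    show "?G (d, l) \<ge> 0" for l
      using q by (auto intro!: mult_nonneg_nonneg column_weight_nonneg tail_weight_nonneg)
  qed
  moreover have "norm (?F z) = ?G z" for z
    using q by (simp add: abs_mult abs_of_nonneg column_weight_nonneg tail_weight_nonneg)
  ultimately have "?F summable_on Sigma D ?B"
    by (intro abs_summable_summable[of ?F]) (simp only:)
  moreover have "((\<lambda>l. ?F (d, l)) has_sum f d * column_weight q mu d * g d) (?B d)" if "d \<in> D" for d
    using has_sum_cmult_right[OF tail[OF that], of "f d * column_weight q mu d"] by simp
  ultimately have "(?F has_sum S) (Sigma D ?B)"
    by (intro has_sum_SigmaI[OF _ S]) auto
  then have "((\<lambda>lam. ?F (col lam 0 - col mu 0, drop_column lam)) has_sum S) {lam. contains lam mu \<and> col lam 0 - col mu 0 \<in> D}"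
    by (rule iffD2[OF has_sum_reindex_bij_betw[OF bij_betw_split_first_column[of mu D], where f = ?F]])
  then show ?thesis
    by (rule has_sum_cong[THEN iffD1, rotated]) (simp add: sur_weight_eq_column_weight_tail_weight)
qed

lemma has_sum_tail_weight_step:
  assumes q: "0 < q" "q < 1"
    and tail: "\<And>d. d \<le> N \<Longrightarrow>
      (tail_weight q (drop_column mu) (col mu 0 - col mu 1 + d) has_sum g d) (containing (drop_column mu) (col mu 0 - col mu 1 + d))"
  shows "(tail_weight q mu N has_sum (\<Sum>d\<le>N. column_weight q mu d / qpoch (q ^ 2) (q ^ 2) ((N - d) div 2) * g d)) (containing mu N)"
proof -
  let ?f = "\<lambda>d. 1 / qpoch (q ^ 2) (q ^ 2) ((N - d) div 2)"
  have "((\<lambda>lam. ?f (col lam 0 - col mu 0) * sur_weight q mu lam) has_sum (\<Sum>d\<le>N. ?f d * column_weight q mu d * g d)) (containing mu N)"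
    unfolding containing_eq
    by (rule has_sum_split_first_column[OF q tail]) (auto intro: has_sum_finite)
  then show ?thesis
    by (simp add: tail_weight_def[abs_def])
qed

section \<open>The moments\<close>

lemma drop_column_empty [simp]: "drop_column empty_partition = empty_partition"
  by (rule partition_eqI) simp

lemma contains_empty [simp]: "contains lam empty_partition"
  by (simp add: contains_def)

lemma tail_weight_empty_empty: "tail_weight q empty_partition N empty_partition = 1 / qpoch (q ^ 2) (q ^ 2) (N div 2)"
  by (simp add: tail_weight_def sur_weight_def)

lemma tail_weight_empty_split:
  assumes "col lam 0 \<le> N"
  shows "tail_weight q empty_partition N lam =
    column_weight q empty_partition (col lam 0) / qpoch (q ^ 2) (q ^ 2) ((N - col lam 0) div 2) *
    tail_weight q empty_partition (col lam 0) (drop_column lam)"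
  using sur_weight_eq_column_weight_tail_weight[of lam empty_partition q] by (simp add: tail_weight_def[of q empty_partition N lam])

lemma column_weight_empty:
  assumes "0 < q" "q < 1"
  shows "column_weight q empty_partition d = q ^ (Suc d choose 2)"
  using qpoch_neq_0[OF assms, of d] by (simp add: column_weight_def)

text \<open>This supplies summability before the value is known. Removing a column lowers the bound
  on the number of columns, and the claimed bound reproduces itself by
  \<open>sum_qpoch_half\<close>; with no columns left, the only weight is the \<open>d = 0\<close>
  term of that sum.\<close>

lemma sum_tail_weight_empty_le:
  assumes q: "0 < q" "q < 1"
  shows "finite F \<Longrightarrow> (\<And>lam. lam \<in> F \<Longrightarrow> col lam 0 \<le> N \<and> part lam 0 \<le> n) \<Longrightarrow>
    (\<Sum>lam\<in>F. tail_weight q empty_partition N lam) \<le> 1 / qpoch q q N"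
proof (induction n arbitrary: N F)
  case 0
  have nonneg: "0 \<le> q ^ (Suc d choose 2) / (qpoch q q d * qpoch (q ^ 2) (q ^ 2) ((N - d) div 2))" for d
    using q by (intro divide_nonneg_nonneg mult_nonneg_nonneg less_imp_le[OF qpoch_pos] less_imp_le[OF qpoch_sq_pos]) auto
  have "F \<subseteq> {empty_partition}"
    using 0 by (auto simp: eq_empty_partition_iff col_eq_0)
  then have "(\<Sum>lam\<in>F. tail_weight q empty_partition N lam) \<le> (\<Sum>lam\<in>{empty_partition}. tail_weight q empty_partition N lam)"
    using q by (intro sum_mono2) (auto simp: tail_weight_nonneg)
  also have "\<dots> = q ^ (Suc 0 choose 2) / (qpoch q q 0 * qpoch (q ^ 2) (q ^ 2) ((N - 0) div 2))"
    by (simp add: tail_weight_empty_empty binomial_eq_0)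
  also have "\<dots> \<le> (\<Sum>d\<le>N. q ^ (Suc d choose 2) / (qpoch q q d * qpoch (q ^ 2) (q ^ 2) ((N - d) div 2)))"
    by (rule member_le_sum) (use nonneg in auto)
  also have "\<dots> = 1 / qpoch q q N"
    by (rule sum_qpoch_half[OF q])
  finally show ?case .
next
  case (Suc n)
  let ?\<phi> = "\<lambda>lam. (col lam 0, drop_column lam)"
  let ?a = "\<lambda>d. q ^ (Suc d choose 2) / qpoch (q ^ 2) (q ^ 2) ((N - d) div 2)"
  define G where "G d = drop_column ` {lam \<in> F. col lam 0 = d}" for d
  have inj: "inj_on ?\<phi> F"
  proof (intro inj_onI partition_eqI)
    fix a b i assume "?\<phi> a = ?\<phi> b"
    then have "col a 0 = col b 0" "col (drop_column a) j = col (drop_column b) j" for j by simp_all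
    then show "col a i = col b i" by (cases i) simp_all
  qed
  have image: "?\<phi> ` F = Sigma {..N} G"
    using Suc.prems(2) by (auto simp: G_def image_iff)
  have finG: "finite (G d)" for d
    using Suc.prems(1) by (simp add: G_def)
  have G_bound: "col lam 0 \<le> d \<and> part lam 0 \<le> n" if lam: "lam \<in> G d" for lam d
  proof -
    obtain l where l: "l \<in> F" "col l 0 = d" "lam = drop_column l"
      using lam by (auto simp: G_def)
    have "part (drop_column l) 0 \<le> n"
      using part_0_drop_column[of l] Suc.prems(2)[OF l(1)] by linarith
    then show ?thesis
      using l col_Suc_le[of l 0] by simp
  qed
  have a_nonneg: "?a d \<ge> 0" for d
    using q by (intro divide_nonneg_nonneg less_imp_le[OF qpoch_sq_pos]) auto
  have "(\<Sum>lam\<in>F. tail_weight q empty_partition N lam) =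
      (\<Sum>lam\<in>F. (\<lambda>(d, l). ?a d * tail_weight q empty_partition d l) (?\<phi> lam))"
    using Suc.prems(2) by (intro sum.cong) (auto simp: tail_weight_empty_split column_weight_empty[OF q])
  also have "\<dots> = (\<Sum>(d, l)\<in>Sigma {..N} G. ?a d * tail_weight q empty_partition d l)"
    unfolding image[symmetric] by (simp add: sum.reindex[OF inj] case_prod_unfold)
  also have "\<dots> = (\<Sum>d\<le>N. ?a d * (\<Sum>l\<in>G d. tail_weight q empty_partition d l))"
    using finG by (simp add: sum.Sigma[symmetric] sum_distrib_left)
  also have "\<dots> \<le> (\<Sum>d\<le>N. ?a d * (1 / qpoch q q d))"
    by (intro sum_mono mult_left_mono Suc.IH a_nonneg finG) (use G_bound in auto)
  also have "\<dots> = 1 / qpoch q q N"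
    using sum_qpoch_half[OF q, of N] by (simp add: mult.commute)
  finally show ?case .
qed

text \<open>Removing a column from the empty partition gives it back, so the term
  \<open>d = N\<close> of the recursion contains the unknown total itself. For \<open>N > 0\<close>
  its coefficient is less than 1, and \<open>1 / qpoch q q N\<close> satisfies the same linear
  equation. For \<open>N = 0\<close> only the empty partition remains.\<close>

lemma has_sum_tail_weight_empty:
  assumes q: "0 < q" "q < 1"
  shows "(tail_weight q empty_partition N has_sum 1 / qpoch q q N) (containing empty_partition N)"
proof -
  let ?U = "tail_weight q empty_partition" and ?X = "containing empty_partition"
  let ?b = "\<lambda>N d. qpoch (q ^ 2) (q ^ 2) ((N - d) div 2)"
  have X: "lam \<in> ?X N \<longleftrightarrow> col lam 0 \<le> N" for lam N
    by (simp add: containing_def)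
  have summable: "?U N summable_on ?X N" for N
  proof (rule nonneg_bounded_partial_sums_imp_summable_on)
    show "?U N lam \<ge> 0" for lam
      by (rule tail_weight_nonneg[OF q])
    show "eventually (\<lambda>F. sum (?U N) F \<le> 1 / qpoch q q N) (finite_subsets_at_top (?X N))"
    proof (rule eventually_finite_subsets_at_top_weakI)
      fix F assume F: "finite F" "F \<subseteq> ?X N"
      show "sum (?U N) F \<le> 1 / qpoch q q N"
      proof (rule sum_tail_weight_empty_le[OF q F(1)])
        fix lam assume "lam \<in> F"
        then show "col lam 0 \<le> N \<and> part lam 0 \<le> (\<Sum>lam\<in>F. part lam 0)"
          using F X by (auto intro: member_le_sum)
      qed
    qed
  qed
  define I where "I N = infsum (?U N) (?X N)" for N
  have I: "(?U N has_sum I N) (?X N)" for N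
    unfolding I_def using summable by (rule has_sum_infsum)
  have "(?U N has_sum (\<Sum>d\<le>N. column_weight q empty_partition d / ?b N d * I d)) (?X N)" for N
    by (rule has_sum_tail_weight_step[OF q]) (use I in simp)
  then have I_rec: "I N = (\<Sum>d\<le>N. q ^ (Suc d choose 2) / ?b N d * I d)" for N
    using has_sum_unique[OF I] by (simp add: column_weight_empty[OF q])
  have "I N = 1 / qpoch q q N"
  proof (induction N rule: less_induct)
    case (less N)
    show ?case
    proof (cases N)
      case 0
      have "?X 0 = {empty_partition}"
        by (auto simp: X eq_empty_partition_iff)
      then show ?thesis
        by (simp add: 0 I_def tail_weight_empty_empty)
    next
      case (Suc M)
      let ?s = "\<Sum>d<N. q ^ (Suc d choose 2) / (qpoch q q d * ?b N d)"
      let ?Q = "q ^ (Suc N choose 2)"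
      have "I N = (\<Sum>d<N. q ^ (Suc d choose 2) / ?b N d * I d) + ?Q * I N"
        using I_rec[of N] by (simp add: lessThan_Suc_atMost[symmetric])
      also have "(\<Sum>d<N. q ^ (Suc d choose 2) / ?b N d * I d) = ?s"
        by (rule sum.cong[OF refl]) (simp add: less.IH mult.commute)
      finally have 1: "I N = ?s + ?Q * I N" .
      have 2: "1 / qpoch q q N = ?s + ?Q * (1 / qpoch q q N)"
        using sum_qpoch_half[OF q, of N] by (simp add: lessThan_Suc_atMost[symmetric])
      have "(Suc N choose 2) \<noteq> 0"
        by (simp add: Suc)
      then have "?Q < 1"
        using q by (simp add: power_less_one_iff)
      moreover have "(1 - ?Q) * (I N - 1 / qpoch q q N) = 0"
      proof -
        have "(1 - Q) * (x - y) = 0" if "x = s + Q * x" "y = s + Q * y" for Q x y s :: real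
        proof -
          have "x - y = Q * (x - y)"
            unfolding right_diff_distrib using that by linarith
          then show ?thesis by (simp add: left_diff_distrib)
        qed
        then show ?thesis using 1 2 by blast
      qed
      ultimately show ?thesis by simp
    qed
  qed
  then show ?thesis
    using I[of N] by simp
qed

text \<open>Induction on the columns of \<open>mu\<close>: the total of the later columns cancels
  the numerator of \<open>column_weight\<close>, and \<open>sum_qpoch_half\<close> closes the
  step.\<close>

theorem has_sum_tail_weight:
  assumes q: "0 < q" "q < 1"
  shows "(tail_weight q mu N has_sum 1 / qpoch q q N) (containing mu N)"
proof -
  have "part mu 0 \<le> n \<Longrightarrow> ?thesis" for n
  proof (induction n arbitrary: mu N)
    case 0
    then have "mu = empty_partition"
      by (simp add: eq_empty_partition_iff col_eq_0)
    then show ?case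
      using has_sum_tail_weight_empty[OF q] by simp
  next
    case (Suc n)
    have "part (drop_column mu) 0 \<le> n"
      using part_0_drop_column[of mu] Suc.prems by simp
    then have "(tail_weight q mu N has_sum (\<Sum>d\<le>N. column_weight q mu d / qpoch (q ^ 2) (q ^ 2) ((N - d) div 2) *
        (1 / qpoch q q (col mu 0 - col mu 1 + d)))) (containing mu N)"
      by (intro has_sum_tail_weight_step[OF q] Suc.IH)
    also have "(\<Sum>d\<le>N. column_weight q mu d / qpoch (q ^ 2) (q ^ 2) ((N - d) div 2) *
        (1 / qpoch q q (col mu 0 - col mu 1 + d))) = 1 / qpoch q q N"
      unfolding sum_qpoch_half[OF q, of N, symmetric]
      by (rule sum.cong[OF refl]) (simp add: column_weight_def qpoch_neq_0[OF q])
    finally show ?case .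
  qed
  then show ?thesis by blast
qed

section \<open>Euler's \<open>q\<close>-exponential series\<close>

definition qexp :: "real \<Rightarrow> real \<Rightarrow> real" where
  "qexp q y = (\<Sum>d. q ^ (Suc d choose 2) / qpoch q q d * y ^ d)"

lemma summable_qexp:
  assumes q: "0 < q" "q < 1"
  shows "summable (\<lambda>d. q ^ (Suc d choose 2) / qpoch q q d * y ^ d)"
proof -
  have "(\<lambda>d. \<bar>y\<bar> * q ^ Suc d / (1 - q ^ Suc d)) \<longlonglongrightarrow> \<bar>y\<bar> * 0 / (1 - 0)"
    using q by (intro tendsto_intros LIMSEQ_Suc[OF LIMSEQ_realpow_zero]) auto
  then have "eventually (\<lambda>d. \<bar>y\<bar> * q ^ Suc d / (1 - q ^ Suc d) < 1 / 2) sequentially"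
    by (rule order_tendstoD) simp
  then obtain M where M: "\<And>d. d \<ge> M \<Longrightarrow> \<bar>y\<bar> * q ^ Suc d / (1 - q ^ Suc d) < 1 / 2"
    by (auto simp: eventually_sequentially)
  show ?thesis
  proof (rule summable_ratio_test[of "1 / 2" M])
    fix d assume d: "d \<ge> M"
    let ?t = "\<lambda>d. q ^ (Suc d choose 2) / qpoch q q d * y ^ d"
    have "?t (Suc d) = (y * q ^ Suc d / (1 - q ^ Suc d)) * ?t d"
      by (simp add: qpoch_Suc numeral_2_eq_2 power_add mult_ac)
    then have "norm (?t (Suc d)) = (\<bar>y\<bar> * q ^ Suc d / (1 - q ^ Suc d)) * norm (?t d)"
      using q power_Suc_less_1[OF q, of d] by (simp add: abs_mult)
    also have "\<dots> \<le> 1 / 2 * norm (?t d)"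
      by (intro mult_right_mono less_imp_le[OF M[OF d]]) simp
    finally show "norm (?t (Suc d)) \<le> 1 / 2 * norm (?t d)" .
  qed simp
qed

text \<open>Splitting off the factor \<open>1 + y q\<close> of the product. In the series it comes
  from the recursion of the coefficients,
  \<open>c (d + 1) (1 - q^(d+1)) = q^(d+1) c d\<close>.\<close>

lemma qexp_eq:
  assumes q: "0 < q" "q < 1"
  shows "qexp q y = (1 + y * q) * qexp q (y * q)"
proof -
  let ?c = "\<lambda>d. q ^ (Suc d choose 2) / qpoch q q d"
  have "qexp q y - qexp q (y * q) = (\<Sum>d. ?c d * y ^ d - ?c d * (y * q) ^ d)"
    unfolding qexp_def by (rule suminf_diff[OF summable_qexp[OF q] summable_qexp[OF q]])
  also have "\<dots> = (\<Sum>d. ?c (Suc d) * y ^ Suc d - ?c (Suc d) * (y * q) ^ Suc d)"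
    using suminf_split_head[OF summable_diff[OF summable_qexp[OF q, of y] summable_qexp[OF q, of "y * q"]]] by simp
  also have "\<dots> = (\<Sum>d. (y * q) * (?c d * (y * q) ^ d))"
  proof (rule suminf_cong)
    fix d
    have c: "?c (Suc d) * (1 - q ^ Suc d) = q ^ Suc d * ?c d"
      using power_Suc_less_1[OF q, of d]
      by (simp add: qpoch_Suc numeral_2_eq_2 power_add)
    have "?c (Suc d) * y ^ Suc d - ?c (Suc d) * (y * q) ^ Suc d = ?c (Suc d) * (1 - q ^ Suc d) * y ^ Suc d"
    proof -
      have "c * Y - c * (Y * r) = c * (1 - r) * Y" for c Y r :: real
        by (simp add: algebra_simps)
      then show ?thesis by (simp only: power_mult_distrib)
    qed
    also have "\<dots> = (y * q) * (?c d * (y * q) ^ d)"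
      unfolding c by (simp add: power_mult_distrib)
    finally show "?c (Suc d) * y ^ Suc d - ?c (Suc d) * (y * q) ^ Suc d = (y * q) * (?c d * (y * q) ^ d)" .
  qed
  also have "\<dots> = (y * q) * qexp q (y * q)"
    unfolding qexp_def by (rule suminf_mult[OF summable_qexp[OF q]])
  finally show ?thesis by (simp add: algebra_simps)
qed

text \<open>Iterating the functional equation, with continuity at 0, gives \<open>qexp q 1\<close>
  as the product of all \<open>1 + q^i\<close>. Euler's identity between odd and distinct parts then
  follows from its finite form \<open>(q;q^2)_n (-q;q)_n (q;q)_n = (q;q)_{2n}\<close>.\<close>

lemma qpoch_inf_mult_qexp_1:
  assumes q: "0 < q" "q < 1"
  shows "qpoch_inf q (q ^ 2) * qexp q 1 = 1"
proof -
  have q2: "\<bar>q ^ 2\<bar> < 1" and q1: "\<bar>q\<bar> < 1"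
    using q by (simp_all add: power_less_one_iff)
  have prod: "qexp q 1 = qpoch (- q) q n * qexp q (q ^ n)" for n
  proof (induction n)
    case (Suc n)
    then show ?case
      using qexp_eq[OF q, of "q ^ n"] by (simp add: qpoch_Suc mult_ac)
  qed simp
  have "isCont (\<lambda>y. \<Sum>d. q ^ (Suc d choose 2) / qpoch q q d * y ^ d) 0"
    by (rule isCont_powser[OF summable_qexp[OF q, of 1]]) simp
  then have "isCont (qexp q) 0"
    by (simp only: qexp_def[abs_def])
  then have "(\<lambda>n. qexp q (q ^ n)) \<longlonglongrightarrow> qexp q 0"
    by (rule isCont_tendsto_compose[OF _ LIMSEQ_realpow_zero]) (use q in auto)
  moreover have "qexp q 0 = 1"
    unfolding qexp_def powser_zero by (simp add: binomial_eq_0)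
  ultimately have "(\<lambda>n. qpoch (- q) q n * qexp q (q ^ n)) \<longlonglongrightarrow> qpoch_inf (- q) q * 1"
    using qpoch_tendsto[OF q1] by (intro tendsto_mult) auto
  then have E: "qexp q 1 = qpoch_inf (- q) q"
    unfolding prod[symmetric] by (simp add: LIMSEQ_const_iff)
  have euler: "qpoch q (q ^ 2) n * qpoch (- q) q n * qpoch q q n = qpoch q q (2 * n)" for n
  proof (induction n)
    case (Suc n)
    have "qpoch q q (2 * Suc n) = qpoch q q (2 * n) * ((1 - q * q ^ (2 * n)) * ((1 + q * q ^ n) * (1 - q * q ^ n)))"
      by (simp add: qpoch_Suc algebra_simps power_mult power2_eq_square power_mult_distrib)
    also have "\<dots> = qpoch q (q ^ 2) (Suc n) * qpoch (- q) q (Suc n) * qpoch q q (Suc n)"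
      unfolding Suc.IH[symmetric] by (simp add: qpoch_Suc power_mult[symmetric] mult_ac)
    finally show ?case ..
  qed simp
  have "(\<lambda>n. qpoch q (q ^ 2) n * qpoch (- q) q n * qpoch q q n) \<longlonglongrightarrow>
      qpoch_inf q (q ^ 2) * qpoch_inf (- q) q * qpoch_inf q q"
    by (intro tendsto_mult qpoch_tendsto q1 q2)
  moreover have "(\<lambda>n. qpoch q q (2 * n)) \<longlonglongrightarrow> qpoch_inf q q"
    using LIMSEQ_subseq_LIMSEQ[OF qpoch_tendsto[OF q1, of q], of "\<lambda>n. 2 * n"]
    by (simp add: strict_mono_def o_def)
  ultimately have "qpoch_inf q (q ^ 2) * qpoch_inf (- q) q * qpoch_inf q q = qpoch_inf q q"
    unfolding euler by (rule LIMSEQ_unique)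
  moreover have "qpoch_inf q q \<noteq> 0"
    using power_Suc_less_1[OF q] by (intro qpoch_inf_neq_0 q1) (metis less_irrefl)
  ultimately show ?thesis
    by (simp add: E)
qed

text \<open>After cancellation of the tail totals, \<open>mu\<close> is left only in the power of
  \<open>y\<close>. The quadratic exponent of \<open>q\<close> makes the series converge absolutely
  for every real \<open>y\<close>, in particular for \<open>y = p^k\<close> and its
  negative.\<close>

lemma has_sum_sur_weight:
  assumes q: "0 < q" "q < 1"
  shows "((\<lambda>lam. y ^ col lam 0 * sur_weight q mu lam) has_sum y ^ col mu 0 * qexp q y) UNIV"
proof -
  let ?g = "\<lambda>d. 1 / qpoch q q (col mu 0 - col mu 1 + d)"
  have column_weight: "z ^ d * column_weight q mu d * ?g d = q ^ (Suc d choose 2) / qpoch q q d * z ^ d" for z d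
    by (simp add: column_weight_def qpoch_neq_0[OF q])
  have norm: "norm (q ^ (Suc d choose 2) / qpoch q q d * y ^ d) = q ^ (Suc d choose 2) / qpoch q q d * \<bar>y\<bar> ^ d" for d
    using q by (simp add: abs_mult power_abs qpoch_pos abs_of_pos)
  have hs: "((\<lambda>d. q ^ (Suc d choose 2) / qpoch q q d * y ^ d) has_sum qexp q y) UNIV"
    unfolding qexp_def
    by (rule norm_summable_imp_has_sum) (use summable_qexp[OF q] norm in \<open>auto intro: summable_sums\<close>)
  have "((\<lambda>lam. y ^ (col lam 0 - col mu 0) * sur_weight q mu lam) has_sum qexp q y)
      {lam. contains lam mu \<and> col lam 0 - col mu 0 \<in> UNIV}"
  proof (rule has_sum_split_first_column[OF q, where g = ?g])
    show "(tail_weight q (drop_column mu) (col mu 0 - col mu 1 + d) has_sum ?g d) (containing (drop_column mu) (col mu 0 - col mu 1 + d))" for d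
      by (rule has_sum_tail_weight[OF q])
    show "((\<lambda>d. y ^ d * column_weight q mu d * ?g d) has_sum qexp q y) UNIV"
      unfolding column_weight by (rule hs)
    show "(\<lambda>d. \<bar>y ^ d\<bar> * column_weight q mu d * ?g d) summable_on UNIV"
      unfolding power_abs column_weight
      by (rule norm_summable_imp_summable_on)
         (use summable_qexp[OF q, of "\<bar>y\<bar>"] norm in \<open>simp add: power_abs abs_mult\<close>)
  qed
  from has_sum_cmult_right[OF this, of "y ^ col mu 0"]
  have "((\<lambda>lam. y ^ col mu 0 * (y ^ (col lam 0 - col mu 0) * sur_weight q mu lam)) has_sum y ^ col mu 0 * qexp q y)
      {lam. contains lam mu \<and> col lam 0 - col mu 0 \<in> UNIV}" .
  then show ?thesis
  proof (rule has_sum_cong_neutral[THEN iffD1, rotated -1])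
    fix lam assume "lam \<in> {lam. contains lam mu \<and> col lam 0 - col mu 0 \<in> UNIV} \<inter> UNIV"
    then have "col mu 0 \<le> col lam 0" by (simp add: contains_def)
    then show "y ^ col mu 0 * (y ^ (col lam 0 - col mu 0) * sur_weight q mu lam) = y ^ col lam 0 * sur_weight q mu lam"
      by (simp add: mult.assoc[symmetric] power_add[symmetric])
  qed (auto simp: sur_weight_def)
qed

text \<open>In each column \<open>b_mu\<close> cancels one denominator of the Gaussian binomial,
  \<open>q^n(lam)\<close> cancels as a whole, and \<open>q^|lam|\<close> divided by
  \<open>q^|mu|\<close> raises the exponent \<open>d choose 2\<close> to
  \<open>Suc d choose 2\<close>.\<close>

lemma PSym_inf_mult_sur:
  assumes p: "p > 1"
  defines "q \<equiv> 1 / p"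
  shows "PSym_inf p lam * sur p lam mu = qpoch_inf q (q ^ 2) / q ^ pstat mu * sur_weight q mu lam"
proof (cases "contains lam mu")
  case False
  then show ?thesis
    using sur_eq[OF p] by (simp add: sur_weight_def pieri_h_def)
next
  case True
  have q: "0 < q" "q < 1"
    using p by (simp_all add: q_def)
  let ?N = "part lam 0"
  let ?d = "\<lambda>i. col lam i - col mu i" and ?e = "\<lambda>i. col lam i - col mu (Suc i)"
  let ?h = "\<lambda>i. qpoch (q ^ 2) (q ^ 2) ((col lam i - col lam (Suc i)) div 2)"
  have c: "col mu i \<le> col lam i" for i
    using True by (simp add: contains_def)
  have de: "?d i \<le> ?e i" "?e i - ?d i = col mu i - col mu (Suc i)" for i
    using c[of i] col_Suc_le[of mu i] by auto
  have PS: "PSym_inf p lam = q ^ pstat lam * q ^ psize lam * qpoch_inf q (q ^ 2) / (\<Prod>i<?N. ?h i)"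
    unfolding PSym_inf_def Let_def q_def[symmetric] power_add
    using prod_pmult_eq[OF order_refl, of "\<lambda>m. qpoch (q ^ 2) (q ^ 2) (m div 2)" lam] by simp
  have 1: "pieri_h q lam mu * hl_b q mu = (\<Prod>i<?N. q ^ (?d i choose 2) * qpoch q q (?e i) / qpoch q q (?d i))"
    unfolding pieri_h_eq[OF q True order_refl] hl_b_eq[OF contains_part_0[OF True]] prod.distrib[symmetric]
    by (rule prod.cong[OF refl]) (simp add: qbinom_def de qpoch_neq_0[OF q] del: diff_diff_left)
  have 2: "q ^ psize lam = q ^ psize mu * (\<Prod>i<?N. q ^ ?d i)"
    by (simp only: psize_contains[OF True order_refl] power_add power_sum)
  have 3: "q ^ (?d i choose 2) * q ^ ?d i = q ^ (Suc (?d i) choose 2)" for i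
    by (simp add: numeral_2_eq_2 power_add)
  have num: "pieri_h q lam mu * hl_b q mu * q ^ psize lam =
      q ^ psize mu * (\<Prod>i<?N. q ^ (Suc (?d i) choose 2) * qpoch q q (?e i) / qpoch q q (?d i))"
  proof -
    have "pieri_h q lam mu * hl_b q mu * q ^ psize lam =
        q ^ psize mu * (\<Prod>i<?N. q ^ (?d i choose 2) * qpoch q q (?e i) / qpoch q q (?d i) * q ^ ?d i)"
      unfolding 1 2 prod.distrib by (simp only: mult_ac)
    also have "(\<Prod>i<?N. q ^ (?d i choose 2) * qpoch q q (?e i) / qpoch q q (?d i) * q ^ ?d i) =
        (\<Prod>i<?N. q ^ (Suc (?d i) choose 2) * qpoch q q (?e i) / qpoch q q (?d i))"
      unfolding 3[symmetric] by (rule prod.cong[OF refl]) simp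
    finally show ?thesis .
  qed
  have sur_weight: "sur_weight q mu lam = (\<Prod>i<?N. q ^ (Suc (?d i) choose 2) * qpoch q q (?e i) / qpoch q q (?d i)) / (\<Prod>i<?N. ?h i)"
    using True unfolding sur_weight_def prod_dividef[symmetric] by simp
  have "PSym_inf p lam * sur p lam mu * q ^ pstat mu = qpoch_inf q (q ^ 2) * sur_weight q mu lam"
  proof -
    let ?A = "\<Prod>i<?N. q ^ (Suc (?d i) choose 2) * qpoch q q (?e i) / qpoch q q (?d i)"
    have "PSym_inf p lam * sur p lam mu * q ^ pstat mu =
        qpoch_inf q (q ^ 2) * ((pieri_h q lam mu * hl_b q mu * q ^ psize lam) / q ^ psize mu) / (\<Prod>i<?N. ?h i)"
      unfolding PS sur_eq[OF p, folded q_def] using q by (simp add: mult_ac)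
    also have "(pieri_h q lam mu * hl_b q mu * q ^ psize lam) / q ^ psize mu = ?A"
      unfolding num using q by simp
    finally show ?thesis
      by (simp add: sur_weight)
  qed
  then show ?thesis
    using q by (simp add: field_simps)
qed

lemma qexp_power:
  assumes p: "p > 1"
  shows "qexp (1 / p) (p ^ k) = (\<Prod>j<k. 1 + p ^ j) * qexp (1 / p) 1"
proof (induction k)
  case (Suc k)
  have "qexp (1 / p) (p ^ Suc k) = (1 + p ^ k) * qexp (1 / p) (p ^ k)"
    using qexp_eq[of "1 / p" "p ^ Suc k"] p by simp
  then show ?case
    by (simp add: Suc.IH mult_ac)
qed simp

text \<open>The functional equation lowers \<open>k\<close> down to 1, where it produces the factor
  \<open>1 - p^0\<close>.\<close>

lemma qexp_minus_power:
  assumes p: "p > 1" and "k > 0"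
  shows "qexp (1 / p) (- (p ^ k)) = 0"
  using assms(2)
proof (induction k)
  case (Suc k)
  have "qexp (1 / p) (- (p ^ Suc k)) = (1 - p ^ k) * qexp (1 / p) (- (p ^ k))"
    using qexp_eq[of "1 / p" "- (p ^ Suc k)"] p by simp
  then show ?case
    using Suc.IH by (cases "k = 0") auto
qed simp

text \<open>Taking \<open>p^j\<close> out of \<open>1 + p^j\<close> leaves the factors of
  \<open>(-1;q)_k\<close>.\<close>

lemma power_choose_2_div_qpoch:
  assumes p: "p > 1"
  shows "(1 / p) ^ (k choose 2) / qpoch (- 1) (1 / p) k * (\<Prod>j<k. 1 + p ^ j) = 1"
proof -
  have "(\<Prod>j<k. 1 + p ^ j) = (\<Prod>j<k. p ^ j * (1 - (- 1) * (1 / p) ^ j))"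
    by (rule prod.cong[OF refl]) (use p in \<open>simp add: field_simps\<close>)
  also have "\<dots> = p ^ (k choose 2) * qpoch (- 1) (1 / p) k"
    by (simp only: prod.distrib qpoch_def power_sum[symmetric] sum_lessThan_choose_2)
  finally have e: "(\<Prod>j<k. 1 + p ^ j) = p ^ (k choose 2) * qpoch (- 1) (1 / p) k" .
  have "(\<Prod>j<k. 1 + p ^ j) > 0"
    using p by (intro prod_pos) (auto intro: add_pos_pos)
  then have "qpoch (- 1) (1 / p) k \<noteq> 0"
    unfolding e by auto
  then show ?thesis
    unfolding e using p by (simp add: power_one_over)
qed

theorem theorem1p10:
  fixes p \<alpha> :: real and \<mu> :: partition and k :: nat
  assumes "p > 1" and "\<alpha> \<in> {-1..1}" and "k > 0"
  shows "moment p \<mu> (PM p \<alpha> k) = moment p \<mu> (PSym p k) \<and>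
         moment p \<mu> (PSym p k) = p ^ (pstat \<mu> + k * plength \<mu>)"
proof -
  note p = assms(1)
  define q where "q = 1 / p"
  have q: "0 < q" "q < 1"
    using p by (simp_all add: q_def)
  define C where "C = q ^ (k choose 2) / qpoch (- 1) q k"
  \<comment> \<open>All factors that do not depend on \<open>lam\<close>.\<close>
  define D where "D = C * (qpoch_inf q (q ^ 2) / q ^ pstat \<mu>)"
  have D: "D * ((\<Prod>j<k. 1 + p ^ j) * qexp q 1) = p ^ pstat \<mu>"
  proof -
    have "D * ((\<Prod>j<k. 1 + p ^ j) * qexp q 1) =
        (C * (\<Prod>j<k. 1 + p ^ j)) * (qpoch_inf q (q ^ 2) * qexp q 1) / q ^ pstat \<mu>"
      by (simp add: D_def)
    also have "\<dots> = 1 / q ^ pstat \<mu>"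
      unfolding C_def power_choose_2_div_qpoch[OF p, of k, folded q_def] qpoch_inf_mult_qexp_1[OF q] by simp
    also have "\<dots> = p ^ pstat \<mu>"
      by (simp add: q_def power_one_over)
    finally show ?thesis .
  qed
  have sym_term: "PSym p k lam * sur p lam \<mu> = D * ((p ^ k) ^ col lam 0 * sur_weight q \<mu> lam)" for lam
  proof -
    have "PSym p k lam = C * (p ^ k) ^ col lam 0 * PSym_inf p lam"
      by (simp add: PSym_def Let_def conj_part_Suc C_def q_def power_mult)
    then have "PSym p k lam * sur p lam \<mu> = C * (p ^ k) ^ col lam 0 * (PSym_inf p lam * sur p lam \<mu>)"
      by simp
    then show ?thesis
      unfolding PSym_inf_mult_sur[OF p, of lam \<mu>, folded q_def] by (simp add: D_def)
  qed
  \<comment> \<open>The sign of the \<alpha>-term is absorbed into the base of the power, turning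
    \<open>p^k\<close> into its negative.\<close>
  have PM_term: "PM p \<alpha> k lam * sur p lam \<mu> = D * ((p ^ k) ^ col lam 0 * sur_weight q \<mu> lam) +
      \<alpha> * D * ((- (p ^ k)) ^ col lam 0 * sur_weight q \<mu> lam)" for lam
  proof -
    have "PM p \<alpha> k lam = PSym p k lam * (1 + (- 1) ^ col lam 0 * \<alpha>)"
      by (simp add: PM_def PSym_def Let_def conj_part_Suc)
    then have "PM p \<alpha> k lam * sur p lam \<mu> = (1 + (- 1) ^ col lam 0 * \<alpha>) * (PSym p k lam * sur p lam \<mu>)"
      by simp
    also have "\<dots> = D * ((p ^ k) ^ col lam 0 * sur_weight q \<mu> lam) + \<alpha> * D * ((- (p ^ k)) ^ col lam 0 * sur_weight q \<mu> lam)"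
      unfolding sym_term power_minus[of "p ^ k"] by (simp add: algebra_simps)
    finally show ?thesis .
  qed
  have sym: "((\<lambda>lam. D * ((p ^ k) ^ col lam 0 * sur_weight q \<mu> lam)) has_sum p ^ (pstat \<mu> + k * plength \<mu>)) UNIV"
  proof -
    have "D * ((p ^ k) ^ col \<mu> 0 * qexp q (p ^ k)) = p ^ (pstat \<mu> + k * plength \<mu>)"
      using D by (simp add: qexp_power[OF p, folded q_def] power_add power_mult plength_eq_col mult_ac)
    then show ?thesis
      using has_sum_cmult_right[OF has_sum_sur_weight[OF q, of "p ^ k" \<mu>], of D] by simp
  qed
  have "((\<lambda>lam. \<alpha> * D * ((- (p ^ k)) ^ col lam 0 * sur_weight q \<mu> lam)) has_sum 0) UNIV"
    using has_sum_cmult_right[OF has_sum_sur_weight[OF q, of "- (p ^ k)" \<mu>], of "\<alpha> * D"]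
    by (simp add: qexp_minus_power[OF p assms(3), folded q_def])
  from has_sum_add[OF sym this]
  have "((\<lambda>lam. PM p \<alpha> k lam * sur p lam \<mu>) has_sum p ^ (pstat \<mu> + k * plength \<mu>)) UNIV"
    by (simp add: PM_term)
  moreover have "((\<lambda>lam. PSym p k lam * sur p lam \<mu>) has_sum p ^ (pstat \<mu> + k * plength \<mu>)) UNIV"
    using sym by (simp only: sym_term)
  ultimately show ?thesis
    unfolding moment_def by (simp add: infsumI)
qed

end
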